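(* Let $p\in(0,1)$ be fixed and, for $n\in\mathbb{N}$, let $\mathbf{D}_{n,p}$ be the degree of a uniformly chosen vertex of the random cluster graph $\mathbf{CG}_{n,p}$. (i) If $p>1/2$, then $\lim_{n\to\infty}\mathbb{P}(\mathbf{D}_{n,p}=n-1)=1$. (ii) If $p=1/2$, let $X_n$ be a Poisson random variable with parameter $\log n-\log\log n+o(1)$. Then (a) for all $z\in\mathbb{C}$, $\mathbb{E}z^{\mathbf{D}_{n,1/2}}\sim\mathbb{E}z^{X_n}$ as $n\to\infty$; and (b) $\lim_{n\to\infty}\operatorname{d}_{TV}(\mathbf{D}_{n,1/2},X_n)=0$. (iii) If $p<1/2$, then $\mathbb{E}\mathbf{D}_{n,p}=\Theta(\sqrt{\log n})$. Moreover, for each $\lambda\in[0,1)$ there exists a subsequence $(n_k)_{k\in\mathbb{N}}$ such that $$\mathbf{D}_{n_k,p}-\left\lfloor\sqrt{\frac{2\log n_k}{\log(1-p)-\log p}}-1-\frac{1}{\log(1-p)-\log p}\right\rfloor\longrightarrow X_\lambda$$ in distribution as $k\to\infty$, where $X_\lambda$ is the integer-valued random variable with $$\mathbb{P}(X_\lambda=d)=\frac{\left(\frac{p}{1-p}\right)^{(d-\lambda)^2/2}}{\sum_{d'\in\mathbb{Z}}\left(\frac{p}{1-p}\right)^{(d'-\lambda)^2/2}}\qquad\text{for all }d\in\mathbb{Z}.$$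
   Context: A cluster graph is a simple undirected graph on the labelled vertex set $\{1,\dots,n\}$ every connected component of which is a complete graph. For $p\in(0,1)$, the random cluster graph $\mathbf{CG}_{n,p}$ is the Erdős–Rényi random graph on $n$ vertices with edge probability $p$ (each of the $\binom n2$ edges present independently with probability $p$), conditioned on the event that it is a cluster graph. The uniform vertex is chosen independently of the graph. The total variation distance is $\operatorname{d}_{TV}(Y,Z)=\sup_E|\mathbb{P}(Y\in E)-\mathbb{P}(Z\in E)|$. All asymptotics are as $n\to\infty$ with $p$ fixed; $f\sim g$ means $f/g\to1$, and $f=\Theta(g)$ means $f/g$ is eventually bounded above and bounded below away from $0$. *)

theory Defs
  imports "HOL-Probability.Probability"
begin

text \<open>
  A simple undirected graph on the labelled vertex set \<open>{1..n}\<close> is identified with its edge set,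
  a set of two-element subsets of \<open>{1..n}\<close>.
\<close>

definition potential_edges :: "nat \<Rightarrow> nat set set" where
  "potential_edges n = {e. e \<subseteq> {1..n} \<and> card e = 2}"

definition degree :: "nat set set \<Rightarrow> nat \<Rightarrow> nat" where
  "degree E v = card {e \<in> E. v \<in> e}"

definition adjacency :: "nat set set \<Rightarrow> (nat \<times> nat) set" where
  "adjacency E = {(u, v). {u, v} \<in> E}"

text \<open>The vertex sets of the connected components, isolated vertices included.\<close>

definition components :: "nat \<Rightarrow> nat set set \<Rightarrow> nat set set" where
  "components n E = {1..n} // {(u, v) \<in> {1..n} \<times> {1..n}. (u, v) \<in> (adjacency E)\<^sup>*}"

definition cluster_graph :: "nat \<Rightarrow> nat set set \<Rightarrow> bool" where
  "cluster_graph n E \<longleftrightarrow> E \<subseteq> potential_edges n \<and>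
     (\<forall>C \<in> components n E. \<forall>u \<in> C. \<forall>v \<in> C. u \<noteq> v \<longrightarrow> {u, v} \<in> E)"

definition erdos_renyi :: "nat \<Rightarrow> real \<Rightarrow> nat set set pmf" where
  "erdos_renyi n p = map_pmf (\<lambda>f. {e \<in> potential_edges n. f e})
     (Pi_pmf (potential_edges n) False (\<lambda>_. bernoulli_pmf p))"

definition random_cluster_graph :: "nat \<Rightarrow> real \<Rightarrow> nat set set pmf" where
  "random_cluster_graph n p = cond_pmf (erdos_renyi n p) {E. cluster_graph n E}"

text \<open>
  The law of the degree of a uniform vertex chosen independently of the graph. It is meaningful
  for \<open>n \<ge> 1\<close> only, since for \<open>n = 0\<close> there is no vertex to choose.
\<close>

definition degree_pmf :: "nat \<Rightarrow> real \<Rightarrow> nat pmf" where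
  "degree_pmf n p = map_pmf (\<lambda>(E, v). degree E v)
     (pair_pmf (random_cluster_graph n p) (pmf_of_set {1..n}))"

definition tv_dist :: "'a pmf \<Rightarrow> 'a pmf \<Rightarrow> real" where
  "tv_dist P Q = (SUP E. \<bar>measure_pmf.prob P E - measure_pmf.prob Q E\<bar>)"

definition int_conv_in_distr :: "(nat \<Rightarrow> int pmf) \<Rightarrow> int pmf \<Rightarrow> bool" where
  "int_conv_in_distr P Q \<longleftrightarrow>
     weak_conv_m (\<lambda>k. distr (measure_pmf (P k)) borel real_of_int)
                 (distr (measure_pmf Q) borel real_of_int)"

definition discrete_gaussian :: "real \<Rightarrow> real \<Rightarrow> int pmf" where
  "discrete_gaussian q a = embed_pmf (\<lambda>d.
     q powr ((real_of_int d - a)\<^sup>2 / 2) / (\<Sum>\<^sub>\<infinity>d'::int. q powr ((real_of_int d' - a)\<^sup>2 / 2)))"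

text \<open>
  The event conditioned on has positive probability, and the weights of \<^const>\<open>discrete_gaussian\<close>
  do form a probability mass function; so \<^const>\<open>cond_pmf\<close> and \<^const>\<open>embed_pmf\<close> are used
  within their intended domains.
\<close>

lemma finite_potential_edges [simp]: "finite (potential_edges n)"
  by (rule finite_subset[of _ "Pow {1..n}"]) (auto simp: potential_edges_def)

lemma cluster_graph_empty: "cluster_graph n {}"
  by (auto simp: cluster_graph_def components_def adjacency_def quotient_def)

lemma cluster_graph_possible:
  assumes "0 < p" "p < 1"
  shows "set_pmf (erdos_renyi n p) \<inter> {E. cluster_graph n E} \<noteq> {}"
proof -
  have "(\<lambda>_. False) \<in> set_pmf (Pi_pmf (potential_edges n) False (\<lambda>_. bernoulli_pmf p))"
    using assms by (simp add: set_Pi_pmf set_pmf_bernoulli PiE_dflt_def)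
  then have "{} \<in> set_pmf (erdos_renyi n p)"
    by (force simp: erdos_renyi_def)
  then show ?thesis
    using cluster_graph_empty by blast
qed

lemma summable_discrete_gaussian:
  fixes q a :: real
  assumes "0 < q" "q < 1"
  shows "(\<lambda>d::int. q powr ((real_of_int d - a)\<^sup>2 / 2)) summable_on UNIV"
proof -
  have geom: "(\<lambda>n::nat. q ^ n) summable_on UNIV"
    using assms by (intro norm_summable_imp_summable_on) (simp add: summable_geometric)
  have pos: "(\<lambda>d::int. q ^ nat \<bar>d\<bar>) summable_on range int"
    using geom by (subst summable_on_reindex) (auto simp: o_def)
  have neg: "(\<lambda>d::int. q ^ nat \<bar>d\<bar>) summable_on range (\<lambda>n. - int n)"
    using geom by (subst summable_on_reindex) (auto simp: o_def inj_on_def)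
  have UNIV_eq: "(UNIV :: int set) = range int \<union> range (\<lambda>n. - int n)"
  proof (intro equalityI subsetI)
    fix x :: int
    show "x \<in> range int \<union> range (\<lambda>n. - int n)"
      by (cases x rule: int_cases2) auto
  qed auto
  have "(\<lambda>d::int. q ^ nat \<bar>d\<bar>) summable_on UNIV"
    unfolding UNIV_eq using pos neg assms by (intro summable_on_union)
  then have "(\<lambda>d::int. q powr (- \<bar>a\<bar> - 1/2) * q ^ nat \<bar>d\<bar>) summable_on UNIV"
    by (rule summable_on_cmult_right)
  then show ?thesis
  proof (rule summable_on_comparison_test)
    fix d :: int
    have "0 \<le> (\<bar>real_of_int d - a\<bar> - 1)\<^sup>2" by simp
    then have "2 * \<bar>real_of_int d - a\<bar> \<le> (real_of_int d - a)\<^sup>2 + 1"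
      by (simp add: power2_eq_square algebra_simps)
    then have "- \<bar>a\<bar> - 1/2 + \<bar>real_of_int d\<bar> \<le> (real_of_int d - a)\<^sup>2 / 2"
      using abs_triangle_ineq[of "real_of_int d - a" a] by (simp add: field_simps)
    then have "q powr ((real_of_int d - a)\<^sup>2 / 2) \<le> q powr (- \<bar>a\<bar> - 1/2 + \<bar>real_of_int d\<bar>)"
      using assms by (intro powr_mono') auto
    also have "\<dots> = q powr (- \<bar>a\<bar> - 1/2) * q powr real (nat \<bar>d\<bar>)"
      by (simp add: powr_add)
    also have "\<dots> = q powr (- \<bar>a\<bar> - 1/2) * q ^ nat \<bar>d\<bar>"
      using assms by (subst powr_realpow) auto
    finally show "q powr ((real_of_int d - a)\<^sup>2 / 2) \<le> q powr (- \<bar>a\<bar> - 1/2) * q ^ nat \<bar>d\<bar>" .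
  qed auto
qed

lemma pmf_discrete_gaussian:
  fixes q a :: real
  assumes "0 < q" "q < 1"
  shows "pmf (discrete_gaussian q a) d =
    q powr ((real_of_int d - a)\<^sup>2 / 2) / (\<Sum>\<^sub>\<infinity>d'::int. q powr ((real_of_int d' - a)\<^sup>2 / 2))"
proof -
  define w where "w = (\<lambda>d::int. q powr ((real_of_int d - a)\<^sup>2 / 2))"
  define Z where "Z = (\<Sum>\<^sub>\<infinity>d. w d)"
  have w: "w summable_on UNIV" and w_pos: "w d > 0" for d
    using summable_discrete_gaussian[OF assms] assms by (auto simp: w_def)
  have "sum w {0} \<le> Z"
    unfolding Z_def using w w_pos by (intro finite_sum_le_infsum) (auto intro: less_imp_le)
  with w_pos[of 0] have Z: "Z > 0" by simp
  have abs: "Infinite_Set_Sum.abs_summable_on (\<lambda>d. w d / Z) UNIV"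
    using summable_on_cmult_left[OF w, of "1 / Z"] Z w_pos
    by (subst abs_summable_equivalent[symmetric]) (simp add: less_imp_le)
  have "(\<integral>\<^sup>+d. ennreal (w d / Z) \<partial>count_space UNIV) = ennreal (infsetsum (\<lambda>d. w d / Z) UNIV)"
    using abs Z w_pos by (intro nn_integral_conv_infsetsum) (auto intro: less_imp_le)
  also have "infsetsum (\<lambda>d. w d / Z) UNIV = (\<Sum>\<^sub>\<infinity>d. w d / Z)"
    by (rule infsetsum_infsum[OF abs])
  also have "(\<Sum>\<^sub>\<infinity>d. w d / Z) = 1"
    using Z infsum_cmult_left'[of w "1 / Z" UNIV] by (simp flip: Z_def)
  finally have "pmf (embed_pmf (\<lambda>d. w d / Z)) d = w d / Z"
    using Z w_pos by (intro pmf_embed_pmf) (auto intro: less_imp_le)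
  then show ?thesis
    by (simp add: discrete_gaussian_def w_def Z_def)
qed

end

theory Submission
  imports Defs "HOL-Real_Asymp.Real_Asymp"
begin

text \<open>
  A cluster graph is a partition into cliques, so with \<open>r = p / (1 - p)\<close> the degree \<open>D\<close> satisfies
  \<open>P (D = d) = (n - 1 choose d) r\<^bsup>d(d+1)/2\<^esup> c\<^bsub>n-1-d\<^esub> / c\<^bsub>n\<^esub>\<close>, where \<open>c\<^bsub>n\<^esub>\<close> is the total weight
  of the partitions.

  For \<open>r > 1\<close> the single clique dominates \<open>c\<^bsub>n\<^esub>\<close>. For \<open>r = 1\<close> the \<open>c\<^bsub>n\<^esub>\<close> are the Bell numbers, and
  Dobinski's formula exhibits \<open>D\<close> as a mixture of binomials whose mixing law is sharply
  concentrated; both claims follow by comparing binomials with Poisson laws.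

  For \<open>r < 1\<close> the saddle point method is avoided by an argument of Bender and Canfield: \<open>c\<^bsub>n\<^esub> / n!\<close>
  is log-concave and \<open>c\<^bsub>n\<^esub>\<close> is log-convex, so the ratios \<open>y\<^bsub>n\<^esub> = n c\<^bsub>n-1\<^esub> / c\<^bsub>n\<^esub>\<close> vary slowly. Thus
  \<open>P (D = d)\<close> is nearly proportional to \<open>r\<^bsup>d(d+1)/2\<^esup> y\<^bsub>n\<^esub>\<^bsup>d\<^esup> / d!\<close>, whose centre is located by
  normalisation.
\<close>

section \<open>Weighted counting of cluster graphs\<close>

text \<open>At \<open>r = 1\<close> the mixing weights \<open>k^m / k!\<close> peak where
  \<open>exp (m / k) = k\<close>. There \<open>x = m / k\<close> solves
  \<open>x * exp x = m\<close>, so x = ln n - ln ln n + o(1): this is the Poisson rate. The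
  generating function at z can be as small as a power of n, so its asymptotics do not follow from
  total variation; the mixing tail must be smaller than every power of n. For \<open>r < 1\<close>
  let \<open>\<rho> = - ln r\<close> and write ln y = \<rho> (h + 1/2) + ln h. The weights
  r^(d(d+1)/2) y^(d+1) / d! are then almost Gaussian around h, and the largest has logarithm
  \<rho>/2 (h+1)^2 + h + O(ln h). It has to balance ln n, which yields the centre sqrt (2 ln n /
  \<rho>) - 1 - 1/\<rho>. Displacing h by a fixed \<eta> changes that logarithm by about \<rho>
  \<eta> h, far more than ln h, so crude factorial bounds locate the centre up to o(1). The width of
  the Gaussian stays bounded, hence the fractional part of the centre remains visible and limits
  exist only along subsequences.\<close>

definition two_subsets :: "'a set \<Rightarrow> 'a set set" where
  "two_subsets S = {e. e \<subseteq> S \<and> card e = 2}"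

text \<open>Transitivity of adjacency, the absence of an induced path on three vertices, replaces
  components. Arbitrary vertex sets are allowed because deleting a clique from \<open>{1..n}\<close>
  need not leave an initial interval.\<close>

definition cluster_graphs :: "'a set \<Rightarrow> 'a set set set" where
  "cluster_graphs S = {E. E \<subseteq> two_subsets S \<and>
     (\<forall>u v w. {u, v} \<in> E \<longrightarrow> {v, w} \<in> E \<longrightarrow> u \<noteq> w \<longrightarrow> {u, w} \<in> E)}"

lemma finite_two_subsets [simp]: "finite S \<Longrightarrow> finite (two_subsets S)"
  by (rule finite_subset[of _ "Pow S"]) (auto simp: two_subsets_def)

lemma card_two_subsets: "finite S \<Longrightarrow> card (two_subsets S) = card S choose 2"
  unfolding two_subsets_def by (rule n_subsets)

lemma finite_cluster_graphs [simp]: "finite S \<Longrightarrow> finite (cluster_graphs S)"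
  by (rule finite_subset[of _ "Pow (two_subsets S)"]) (auto simp: cluster_graphs_def)

lemma insert2_in_two_subsets [simp]: "{u, v} \<in> two_subsets S \<longleftrightarrow> u \<in> S \<and> v \<in> S \<and> u \<noteq> v"
  by (cases "u = v") (auto simp: two_subsets_def)

lemma two_subsetsE:
  assumes "e \<in> two_subsets S"
  obtains u v where "e = {u, v}" "u \<in> S" "v \<in> S" "u \<noteq> v"
  using assms by (auto simp: two_subsets_def card_2_iff)

lemma cluster_graphs_edge:
  assumes "E \<in> cluster_graphs S" "{a, b} \<in> E"
  shows "a \<in> S \<and> b \<in> S \<and> a \<noteq> b"
proof -
  have "{a, b} \<in> two_subsets S" using assms unfolding cluster_graphs_def by blast
  then show ?thesis by simp
qed

lemma cluster_graph_iff: "cluster_graph n E \<longleftrightarrow> E \<in> cluster_graphs {1..n}"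
proof -
  have pe: "potential_edges n = two_subsets {1..n}"
    by (simp add: potential_edges_def two_subsets_def)
  define R where "R = {(u, v) \<in> {1..n} \<times> {1..n}. (u, v) \<in> (adjacency E)\<^sup>*}"
  have comp: "components n E = {1..n} // R"
    by (simp add: components_def R_def)
  show ?thesis
  proof
    assume E: "cluster_graph n E"
    then have sub: "E \<subseteq> two_subsets {1..n}"
      by (simp add: cluster_graph_def pe)
    have "{u, w} \<in> E" if "{u, v} \<in> E" "{v, w} \<in> E" "u \<noteq> w" for u v w
    proof -
      have in_n: "u \<in> {1..n}" "v \<in> {1..n}" "w \<in> {1..n}"
        using sub that(1,2) by (auto simp: subset_iff)
      have "(u, v) \<in> adjacency E" "(v, w) \<in> adjacency E"
        using that by (auto simp: adjacency_def)
      then have "(u, w) \<in> (adjacency E)\<^sup>*" by auto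
      then have "u \<in> R `` {u}" "w \<in> R `` {u}"
        using in_n by (auto simp: R_def)
      moreover have "R `` {u} \<in> components n E"
        unfolding comp using in_n by (intro quotientI)
      ultimately show ?thesis
        using E \<open>u \<noteq> w\<close> by (auto simp: cluster_graph_def)
    qed
    with sub show "E \<in> cluster_graphs {1..n}"
      by (auto simp: cluster_graphs_def)
  next
    assume E: "E \<in> cluster_graphs {1..n}"
    have tr: "{u, w} \<in> E" if "{u, v} \<in> E" "{v, w} \<in> E" "u \<noteq> w" for u v w
      using E that by (auto simp: cluster_graphs_def)
    \<comment> \<open>By transitivity, a path shrinks to a single edge or to nothing.\<close>
    have reach: "u = v \<or> {u, v} \<in> E" if "(u, v) \<in> (adjacency E)\<^sup>*" for u v
      using that
    proof (induction rule: rtrancl_induct)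
      case (step y z)
      then show ?case
        using tr[of u y z] by (auto simp: adjacency_def)
    qed auto
    have "{u, v} \<in> E" if C: "C \<in> components n E" and "u \<in> C" "v \<in> C" "u \<noteq> v" for C u v
    proof -
      obtain x where "C = R `` {x}" using C unfolding comp by (auto elim: quotientE)
      with that have x: "(x, u) \<in> (adjacency E)\<^sup>*" "(x, v) \<in> (adjacency E)\<^sup>*"
        by (auto simp: R_def)
      show ?thesis
        using reach[OF x(1)] reach[OF x(2)] tr[of u x v] \<open>u \<noteq> v\<close> by (auto simp: insert_commute)
    qed
    then show "cluster_graph n E"
      using E by (auto simp: cluster_graph_def cluster_graphs_def pe)
  qed
qed

definition neighbours :: "'a set set \<Rightarrow> 'a \<Rightarrow> 'a set" where
  "neighbours E v = {u. {u, v} \<in> E}"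

lemma card_neighbours:
  assumes "E \<subseteq> two_subsets S"
  shows "card {e \<in> E. v \<in> e} = card (neighbours E v)"
proof (rule bij_betw_same_card[symmetric], rule bij_betwI')
  fix u w assume "u \<in> neighbours E v" "w \<in> neighbours E v"
  then show "({u, v} = {w, v}) = (u = w)" by (auto simp: doubleton_eq_iff)
next
  fix u assume "u \<in> neighbours E v"
  then show "{u, v} \<in> {e \<in> E. v \<in> e}" by (auto simp: neighbours_def)
next
  fix e assume "e \<in> {e \<in> E. v \<in> e}"
  then show "\<exists>u\<in>neighbours E v. e = {u, v}"
    using assms by (auto simp: neighbours_def insert_commute elim!: two_subsetsE dest!: subsetD)
qed

text \<open>The component of \<open>v\<close> is the clique on \<open>v\<close> and its neighbours,
  and no other edge touches it. So a graph is determined by the neighbourhood \<open>T\<close> and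
  the edges avoiding \<open>insert v T\<close>, which is what the inverse \<open>g\<close> reads
  off.\<close>

lemma cluster_graphs_split:
  assumes v: "v \<in> S"
  shows "bij_betw (\<lambda>(T, E). two_subsets (insert v T) \<union> E)
    (SIGMA T:Pow (S - {v}). cluster_graphs (S - {v} - T)) (cluster_graphs S)"
    (is "bij_betw ?f ?A ?B")
  and "\<And>T E. T \<subseteq> S - {v} \<Longrightarrow> E \<in> cluster_graphs (S - {v} - T) \<Longrightarrow>
    neighbours (two_subsets (insert v T) \<union> E) v = T"
proof -
  show nb: "neighbours (two_subsets (insert v T) \<union> E) v = T"
    if "T \<subseteq> S - {v}" "E \<in> cluster_graphs (S - {v} - T)" for T E
  proof -
    have "{u, v} \<notin> E" for u
      using that insert2_in_two_subsets by (fastforce simp: cluster_graphs_def)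
    then show ?thesis using that by (auto simp: neighbours_def)
  qed
  define g where "g = (\<lambda>E. (neighbours E v, {e \<in> E. e \<inter> insert v (neighbours E v) = {}}))"
  show "bij_betw ?f ?A ?B"
  proof (rule bij_betw_byWitness[where f' = g])
    show "\<forall>a\<in>?A. g (?f a) = a"
    proof safe
      fix T E assume T: "T \<subseteq> S - {v}" and E: "E \<in> cluster_graphs (S - {v} - T)"
      have "e \<inter> insert v T = {}" if "e \<in> E" for e
        using E that by (auto simp: cluster_graphs_def two_subsets_def)
      then have "{e \<in> two_subsets (insert v T) \<union> E. e \<inter> insert v T = {}} = E"
        by (auto elim!: two_subsetsE)
      then show "g (two_subsets (insert v T) \<union> E) = (T, E)"
        using nb[OF T E] by (simp add: g_def)
    qed
    show "\<forall>E\<in>?B. ?f (g E) = E"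
    proof
      fix E assume E: "E \<in> cluster_graphs S"
      have tr: "{u, w} \<in> E" if "{u, v} \<in> E" "{v, w} \<in> E" "u \<noteq> w" for u v w
        using E that by (auto simp: cluster_graphs_def)
      have sub: "E \<subseteq> two_subsets S" using E by (auto simp: cluster_graphs_def)
      have "two_subsets (insert v (neighbours E v)) \<subseteq> E"
      proof
        fix e assume "e \<in> two_subsets (insert v (neighbours E v))"
        then obtain a b where ab: "e = {a, b}" "a \<noteq> b" "a = v \<or> {a, v} \<in> E" "b = v \<or> {b, v} \<in> E"
          by (auto simp: neighbours_def elim!: two_subsetsE)
        then show "e \<in> E" using tr[of a v b] by (auto simp: insert_commute)
      qed
      moreover have "e \<in> two_subsets (insert v (neighbours E v))"
        if "e \<in> E" "e \<inter> insert v (neighbours E v) \<noteq> {}" for e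
      proof -
        from that sub have "e \<in> two_subsets S" by auto
        then obtain a b where ab: "e = {a, b}" "a \<noteq> b" by (rule two_subsetsE)
        have *: "{a, b} \<in> two_subsets (insert v (neighbours E v))"
          if "a \<in> insert v (neighbours E v)" "a \<noteq> b" "{a, b} \<in> E" for a b
          using that tr[of b a v] by (auto simp: neighbours_def insert_commute)
        from that ab consider "a \<in> insert v (neighbours E v)" | "b \<in> insert v (neighbours E v)"
          by auto
        then show ?thesis
          using *[of a b] *[of b a] ab that(1) by cases (auto simp: insert_commute)
      qed
      ultimately show "?f (g E) = E" by (auto simp: g_def)
    qed
    show "?f ` ?A \<subseteq> ?B"
    proof safe
      fix T E assume T: "T \<subseteq> S - {v}" and E: "E \<in> cluster_graphs (S - {v} - T)"
      have E1: "a \<in> S - {v} - T \<and> b \<in> S - {v} - T \<and> a \<noteq> b" if "{a, b} \<in> E" for a b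
        using cluster_graphs_edge[OF E that] .
      have E2: "{u, w} \<in> E" if "{u, v} \<in> E" "{v, w} \<in> E" "u \<noteq> w" for u v w
        using E that by (auto simp: cluster_graphs_def)
      have sub: "two_subsets (insert v T) \<union> E \<subseteq> two_subsets S"
        using T E v by (auto simp: two_subsets_def cluster_graphs_def)
      show "two_subsets (insert v T) \<union> E \<in> cluster_graphs S"
        unfolding cluster_graphs_def
      proof (intro CollectI conjI allI impI sub)
        fix a b c assume *: "{a, b} \<in> two_subsets (insert v T) \<union> E"
          "{b, c} \<in> two_subsets (insert v T) \<union> E" "a \<noteq> c"
        then show "{a, c} \<in> two_subsets (insert v T) \<union> E"
          using E1[of a b] E1[of b c] E2[of a b c] by auto
      qed
    qed
    show "g ` ?B \<subseteq> ?A"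
    proof (rule image_subsetI)
      fix E assume E: "E \<in> cluster_graphs S"
      obtain T E' where g: "g E = (T, E')" by fastforce
      have sub: "E \<subseteq> two_subsets S" using E by (auto simp: cluster_graphs_def)
      have T: "u \<in> S - {v}" if "u \<in> T" for u
        using that g cluster_graphs_edge[OF E, of u v] by (auto simp: g_def neighbours_def)
      have "E' \<subseteq> two_subsets (S - {v} - T)"
        using g sub by (auto simp: g_def two_subsets_def)
      moreover have "E' = {e \<in> E. e \<inter> insert v T = {}}" using g by (auto simp: g_def)
      ultimately have "E' \<in> cluster_graphs (S - {v} - T)"
        using E by (auto simp: cluster_graphs_def)
      then show "g E \<in> ?A" using g T by auto
    qed
  qed
qed

lemma sum_Pow_card:
  fixes g :: "nat \<Rightarrow> 'b::semiring_1"
  assumes "finite A"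
  shows "(\<Sum>T\<in>Pow A. g (card T)) = (\<Sum>d\<le>card A. of_nat (card A choose d) * g d)"
proof -
  have "(\<Sum>T\<in>Pow A. g (card T)) = (\<Sum>d\<le>card A. \<Sum>T | T \<in> Pow A \<and> card T = d. g (card T))"
    using assms by (intro sum.group[symmetric]) (auto intro: card_mono)
  also have "\<dots> = (\<Sum>d\<le>card A. of_nat (card A choose d) * g d)"
    using n_subsets[OF assms] by (intro sum.cong) auto
  finally show ?thesis .
qed

text \<open>Recursion over the component of one vertex with \<open>d\<close> further members; a
  clique on \<open>d + 1\<close> vertices has \<open>Suc d choose 2\<close> edges. At
  \<open>r = 1\<close> this is the Bell number recursion.\<close>

fun cluster_weight :: "real \<Rightarrow> nat \<Rightarrow> real" where
  "cluster_weight r 0 = 1"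
| "cluster_weight r (Suc n) =
     (\<Sum>d\<le>n. real (n choose d) * r ^ (Suc d choose 2) * cluster_weight r (n - d))"

declare cluster_weight.simps(2) [simp del]

lemma cluster_weight_pos: "r > 0 \<Longrightarrow> cluster_weight r n > 0"
proof (induction n rule: less_induct)
  case (less n)
  show ?case
  proof (cases n)
    case (Suc m)
    then show ?thesis
      using less by (auto simp: cluster_weight.simps(2) intro!: sum_pos mult_pos_pos)
  qed auto
qed

text \<open>The test function \<open>f\<close> lets one decomposition serve twice:
  \<open>f = 1\<close> gives the recursion of the total weight, the indicator of
  \<open>card T = d\<close> gives the degree law.\<close>

lemma sum_cluster_graphs_neighbours:
  fixes r :: real and f :: "'a set \<Rightarrow> real"
  assumes "finite S" "v \<in> S"
  shows "(\<Sum>E\<in>cluster_graphs S. r ^ card E * f (neighbours E v)) =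
    (\<Sum>T\<in>Pow (S - {v}). r ^ (Suc (card T) choose 2) * f T *
       (\<Sum>E\<in>cluster_graphs (S - {v} - T). r ^ card E))"
proof -
  let ?A = "SIGMA T:Pow (S - {v}). cluster_graphs (S - {v} - T)"
  have card: "card (two_subsets (insert v T) \<union> E) = (Suc (card T) choose 2) + card E"
    if "T \<subseteq> S - {v}" "E \<in> cluster_graphs (S - {v} - T)" for T E
  proof -
    have fin: "finite T" "v \<notin> T" "finite E"
      using that assms finite_subset[of T S] finite_subset[of E "two_subsets (S - {v} - T)"]
      by (auto simp: cluster_graphs_def)
    have "e \<notin> E" if "e \<in> two_subsets (insert v T)" for e
      using that cluster_graphs_edge[OF \<open>E \<in> _\<close>] by (auto elim!: two_subsetsE)
    then have "card (two_subsets (insert v T) \<union> E) = card (two_subsets (insert v T)) + card E"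
      using fin by (intro card_Un_disjoint) auto
    then show ?thesis using fin by (simp add: card_two_subsets)
  qed
  have "(\<Sum>E\<in>cluster_graphs S. r ^ card E * f (neighbours E v)) =
    (\<Sum>(T, E)\<in>?A. r ^ ((Suc (card T) choose 2) + card E) * f T)"
    by (subst sum.reindex_bij_betw[OF cluster_graphs_split(1)[OF assms(2)], symmetric])
       (intro sum.cong, auto simp: card cluster_graphs_split(2)[OF assms(2)])
  also have "\<dots> = (\<Sum>T\<in>Pow (S - {v}). \<Sum>E\<in>cluster_graphs (S - {v} - T).
      r ^ ((Suc (card T) choose 2) + card E) * f T)"
    using assms by (intro sum.Sigma[symmetric]) auto
  also have "\<dots> = (\<Sum>T\<in>Pow (S - {v}). r ^ (Suc (card T) choose 2) * f T *
       (\<Sum>E\<in>cluster_graphs (S - {v} - T). r ^ card E))"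
    by (simp add: sum_distrib_left power_add mult_ac)
  finally show ?thesis .
qed

lemma sum_cluster_graphs:
  assumes "finite S"
  shows "(\<Sum>E\<in>cluster_graphs S. r ^ card E) = cluster_weight r (card S)"
  using assms
proof (induction "card S" arbitrary: S rule: less_induct)
  case less
  show ?case
  proof (cases "S = {}")
    case True
    then have "cluster_graphs S = {{}}" by (auto simp: cluster_graphs_def two_subsets_def)
    then show ?thesis using True by simp
  next
    case False
    then obtain v where v: "v \<in> S" by auto
    define n where "n = card (S - {v})"
    have n: "card S = Suc n"
      using v less.prems by (metis n_def card.remove)
    have "(\<Sum>E\<in>cluster_graphs S. r ^ card E) = (\<Sum>T\<in>Pow (S - {v}). r ^ (Suc (card T) choose 2) *
       (\<Sum>E\<in>cluster_graphs (S - {v} - T). r ^ card E))"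
      using sum_cluster_graphs_neighbours[OF less.prems v, of r "\<lambda>_. 1"] by simp
    also have "\<dots> = (\<Sum>T\<in>Pow (S - {v}). r ^ (Suc (card T) choose 2) * cluster_weight r (n - card T))"
    proof (intro sum.cong refl)
      fix T assume T: "T \<in> Pow (S - {v})"
      then have "finite T" using less.prems finite_subset[of T S] by auto
      then have *: "card (S - {v} - T) = n - card T"
        unfolding n_def using T by (intro card_Diff_subset) auto
      have "(\<Sum>E\<in>cluster_graphs (S - {v} - T). r ^ card E) = cluster_weight r (card (S - {v} - T))"
        by (rule less.hyps) (use n * less.prems in auto)
      then show "r ^ (Suc (card T) choose 2) * (\<Sum>E\<in>cluster_graphs (S - {v} - T). r ^ card E) =
        r ^ (Suc (card T) choose 2) * cluster_weight r (n - card T)"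
        by (simp add: *)
    qed
    also have "\<dots> = cluster_weight r (card S)"
      using sum_Pow_card[of "S - {v}" "\<lambda>d. r ^ (Suc d choose 2) * cluster_weight r (n - d)"] less.prems
      unfolding n by (simp add: cluster_weight.simps(2) n_def mult_ac)
    finally show ?thesis .
  qed
qed

lemma sum_cluster_graphs_degree:
  assumes "finite S" "v \<in> S" "card S = Suc n"
  shows "(\<Sum>E | E \<in> cluster_graphs S \<and> card (neighbours E v) = d. r ^ card E) =
    real (n choose d) * r ^ (Suc d choose 2) * cluster_weight r (n - d)"
proof -
  let ?i = "\<lambda>k. of_bool (k = d) :: real"
  have n: "card (S - {v}) = n" using assms by simp
  have "(\<Sum>E | E \<in> cluster_graphs S \<and> card (neighbours E v) = d. r ^ card E) =
      (\<Sum>E\<in>cluster_graphs S. r ^ card E * ?i (card (neighbours E v)))"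
    using assms by (intro sum.mono_neutral_cong_left) auto
  also have "\<dots> = (\<Sum>T\<in>Pow (S - {v}). r ^ (Suc (card T) choose 2) * ?i (card T) * cluster_weight r (n - card T))"
    unfolding sum_cluster_graphs_neighbours[OF assms(1,2), of r "\<lambda>T. ?i (card T)"]
  proof (intro sum.cong refl)
    fix T assume T: "T \<in> Pow (S - {v})"
    then have "finite T" using assms finite_subset[of T S] by auto
    then have *: "card (S - {v} - T) = n - card T"
      unfolding n[symmetric] using T by (intro card_Diff_subset) auto
    show "r ^ (Suc (card T) choose 2) * ?i (card T) * (\<Sum>E\<in>cluster_graphs (S - {v} - T). r ^ card E) =
      r ^ (Suc (card T) choose 2) * ?i (card T) * cluster_weight r (n - card T)"
      using assms by (subst sum_cluster_graphs) (auto simp: *)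
  qed
  also have "\<dots> = (\<Sum>k\<le>n. real (n choose k) * (r ^ (Suc k choose 2) * ?i k * cluster_weight r (n - k)))"
    using sum_Pow_card[of "S - {v}" "\<lambda>k. r ^ (Suc k choose 2) * ?i k * cluster_weight r (n - k)"] assms
    by (simp add: n)
  also have "\<dots> = (\<Sum>k\<in>{..n} \<inter> {d}. real (n choose k) * (r ^ (Suc k choose 2) * cluster_weight r (n - k)))"
    by (intro sum.mono_neutral_cong_right) auto
  also have "\<dots> = real (n choose d) * r ^ (Suc d choose 2) * cluster_weight r (n - d)"
    by (cases "d \<le> n") (auto simp: Int_absorb1 mult_ac binomial_eq_0)
  finally show ?thesis .
qed

section \<open>The laws of the random cluster graph and of its degree\<close>

lemma pmf_erdos_renyi:
  assumes "0 < p" "p < 1" "E \<subseteq> potential_edges n"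
  shows "pmf (erdos_renyi n p) E =
    (1 - p) ^ card (potential_edges n) * (p / (1 - p)) ^ card E"
proof -
  let ?P = "Pi_pmf (potential_edges n) False (\<lambda>_. bernoulli_pmf p)"
  let ?f = "\<lambda>f. {e \<in> potential_edges n. f e}"
  have set: "set_pmf ?P = PiE_dflt (potential_edges n) False (\<lambda>_. UNIV)"
    using assms by (simp add: set_Pi_pmf set_pmf_bernoulli)
  have inj: "inj_on ?f (set_pmf ?P)"
    unfolding set by (rule inj_onI, rule ext) (auto simp: PiE_dflt_def set_eq_iff)
  have E: "(\<lambda>e. e \<in> E) \<in> set_pmf ?P"
    unfolding set using assms(3) by (auto simp: PiE_dflt_def)
  have "?f (\<lambda>e. e \<in> E) = E" using assms(3) by auto
  then have "pmf (erdos_renyi n p) E = pmf ?P (\<lambda>e. e \<in> E)"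
    unfolding erdos_renyi_def using pmf_map_inj[OF inj E] by simp
  also have "\<dots> = (\<Prod>e\<in>potential_edges n. pmf (bernoulli_pmf p) (e \<in> E))"
    using assms(3) by (intro pmf_Pi') auto
  \<comment> \<open>Pulling \<open>1 - p\<close> out of every potential edge leaves a factor
    independent of \<open>E\<close>, which cancels under conditioning.\<close>
  also have "\<dots> = (\<Prod>e\<in>potential_edges n. (1 - p) * (if e \<in> E then p / (1 - p) else 1))"
    using assms by (intro prod.cong) auto
  also have "\<dots> = (1 - p) ^ card (potential_edges n) * (\<Prod>e\<in>E. p / (1 - p))"
    unfolding prod.distrib using assms(3)
    by (simp add: prod.If_cases Int_absorb1)
  finally show ?thesis by simp
qed

lemma pmf_random_cluster_graph:
  assumes "0 < p" "p < 1"
  shows "pmf (random_cluster_graph n p) E =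
    (if E \<in> cluster_graphs {1..n} then (p / (1 - p)) ^ card E / cluster_weight (p / (1 - p)) n else 0)"
proof -
  have sub: "E \<subseteq> potential_edges n" if "E \<in> cluster_graphs {1..n}" for E
    using that by (simp add: cluster_graphs_def two_subsets_def potential_edges_def)
  have ev: "{E. cluster_graph n E} = cluster_graphs {1..n}"
    by (auto simp: cluster_graph_iff)
  have "measure_pmf.prob (erdos_renyi n p) {E. cluster_graph n E} =
      (\<Sum>E\<in>cluster_graphs {1..n}. pmf (erdos_renyi n p) E)"
    by (simp add: ev measure_measure_pmf_finite)
  also have "\<dots> = (1 - p) ^ card (potential_edges n) * cluster_weight (p / (1 - p)) n"
    using assms sub sum_cluster_graphs[of "{1..n}" "p / (1 - p)"]
    by (simp add: pmf_erdos_renyi sum_distrib_left[symmetric])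
  finally show ?thesis
    unfolding random_cluster_graph_def pmf_cond[OF cluster_graph_possible[OF assms]]
    using assms sub by (auto simp: pmf_erdos_renyi ev)
qed

text \<open>Every vertex has the same degree law, so averaging over the vertex changes nothing. With
  \<open>Suc n\<close> vertices, \<open>n - d\<close> is the number of vertices outside the clique
  of the chosen one.\<close>

lemma pmf_degree_pmf:
  assumes "0 < p" "p < 1"
  shows "pmf (degree_pmf (Suc n) p) d = real (n choose d) * (p / (1 - p)) ^ (Suc d choose 2) *
    cluster_weight (p / (1 - p)) (n - d) / cluster_weight (p / (1 - p)) (Suc n)"
proof -
  let ?r = "p / (1 - p)" and ?S = "{1..Suc n}"
  let ?R = "real (n choose d) * ?r ^ (Suc d choose 2) * cluster_weight ?r (n - d) / cluster_weight ?r (Suc n)"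
  have *: "pmf (map_pmf (\<lambda>E. degree E v) (random_cluster_graph (Suc n) p)) d = ?R"
    if "v \<in> ?S" for v
  proof -
    have deg: "degree E v = card (neighbours E v)" if "E \<in> cluster_graphs ?S" for E
      using that card_neighbours[of E ?S v] by (simp add: degree_def cluster_graphs_def)
    have "pmf (map_pmf (\<lambda>E. degree E v) (random_cluster_graph (Suc n) p)) d =
        measure_pmf.prob (random_cluster_graph (Suc n) p) {E \<in> cluster_graphs ?S. degree E v = d}"
      unfolding pmf_map using assms
      by (intro measure_pmf.finite_measure_eq_AE)
         (auto simp: AE_measure_pmf_iff set_pmf_iff pmf_random_cluster_graph split: if_splits)
    also have "\<dots> = (\<Sum>E | E \<in> cluster_graphs ?S \<and> degree E v = d. ?r ^ card E / cluster_weight ?r (Suc n))"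
      using assms by (subst measure_measure_pmf_finite) (auto simp: pmf_random_cluster_graph)
    also have "\<dots> = (\<Sum>E | E \<in> cluster_graphs ?S \<and> card (neighbours E v) = d. ?r ^ card E) / cluster_weight ?r (Suc n)"
      unfolding sum_divide_distrib using deg by (intro sum.cong) auto
    also have "\<dots> = ?R"
      using that by (subst sum_cluster_graphs_degree) auto
    finally show ?thesis .
  qed
  have "degree_pmf (Suc n) p = bind_pmf (pmf_of_set ?S)
      (\<lambda>v. map_pmf (\<lambda>E. degree E v) (random_cluster_graph (Suc n) p))"
    unfolding degree_pmf_def pair_pmf_def map_pmf_def
    by (subst bind_commute_pmf) (simp add: bind_assoc_pmf bind_return_pmf)
  then have "pmf (degree_pmf (Suc n) p) d =
      (\<Sum>v\<in>?S. pmf (map_pmf (\<lambda>E. degree E v) (random_cluster_graph (Suc n) p)) d) / card ?S"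
    by (simp add: pmf_bind integral_pmf_of_set)
  also have "\<dots> = ?R" by (simp add: *)
  finally show ?thesis .
qed

section \<open>The case p > 1/2\<close>

lemma choose_two_add: "(m + n choose 2) = (m choose 2) + (n choose 2) + m * n"
  by (induction m) (auto simp: numeral_2_eq_2 algebra_simps)

text \<open>\<open>Suc d * (n - d)\<close> counts the edges missing between parts of sizes
  \<open>d + 1\<close> and \<open>n - d\<close>. Let \<open>k\<close> be the smaller size. The
  larger part holds at least half of the vertices, so this count is at least
  \<open>(n + 1) * k / 2\<close>, while the binomial is at most \<open>(n + 1) ^ k\<close>; the
  quotient is at most \<open>x ^ k\<close>. The sum of two powers covers both cases.\<close>

lemma supercritical_coefficient_le:
  fixes r :: real
  assumes r: "r > 1" and d: "d < n"
  defines "x \<equiv> real (Suc n) / sqrt r ^ Suc n"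
  shows "real (n choose d) / r ^ (Suc d * (n - d)) \<le> x ^ Suc d + x ^ (n - d)"
proof -
  have *: "real (n choose d) / r ^ (Suc d * (n - d)) \<le> x ^ k"
    if "real (n choose d) \<le> real (Suc n) ^ k" "Suc n * k \<le> 2 * (Suc d * (n - d))" for k
  proof -
    have "sqrt r ^ (Suc n * k) \<le> sqrt r ^ (2 * (Suc d * (n - d)))"
      using r that by (intro power_increasing) auto
    also have "\<dots> = r ^ (Suc d * (n - d))"
      using r by (subst power_mult) simp
    finally have "real (n choose d) / r ^ (Suc d * (n - d)) \<le> real (Suc n) ^ k / sqrt r ^ (Suc n * k)"
      using r that by (intro frac_le) auto
    also have "\<dots> = x ^ k" by (simp only: x_def power_divide power_mult)
    finally show ?thesis .
  qed
  have x: "x \<ge> 0" using r by (simp add: x_def)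
  show ?thesis
  proof (cases "Suc d \<le> n - d")
    case True
    have "(n choose d) \<le> n ^ d" using d by (intro binomial_le_pow) auto
    also have "\<dots> \<le> Suc n ^ d" by (intro power_mono) auto
    also have "\<dots> \<le> Suc n ^ Suc d" by simp
    finally have "real (n choose d) \<le> real (Suc n) ^ Suc d"
      by (metis of_nat_le_iff of_nat_power)
    moreover have "Suc n \<le> 2 * (n - d)" using True d by linarith
    then have "Suc n * Suc d \<le> 2 * (n - d) * Suc d" by (rule mult_right_mono) simp
    then have "Suc n * Suc d \<le> 2 * (Suc d * (n - d))" by (simp only: mult_ac)
    ultimately show ?thesis using *[of "Suc d"] x by (smt (verit) zero_le_power)
  next
    case False
    have "(n choose d) = (n choose (n - d))" using d by (intro binomial_symmetric) auto
    also have "\<dots> \<le> n ^ (n - d)" by (intro binomial_le_pow) auto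
    also have "\<dots> \<le> Suc n ^ (n - d)" by (intro power_mono) auto
    finally have "real (n choose d) \<le> real (Suc n) ^ (n - d)"
      by (metis of_nat_le_iff of_nat_power)
    moreover have "Suc n \<le> 2 * Suc d" using False by presburger
    then have "Suc n * (n - d) \<le> 2 * Suc d * (n - d)" by (rule mult_right_mono) simp
    then have "Suc n * (n - d) \<le> 2 * (Suc d * (n - d))" by (simp only: mult_ac)
    ultimately show ?thesis using *[of "n - d"] x by (smt (verit) zero_le_power)
  qed
qed

lemma tendsto_prob_complete_graph:
  assumes "1 / 2 < p" "p < 1"
  shows "(\<lambda>n. measure_pmf.prob (degree_pmf n p) {n - 1}) \<longlonglongrightarrow> 1"
proof -
  define r where "r = p / (1 - p)"
  have r: "r > 1" using assms by (simp add: r_def field_simps)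
  \<comment> \<open>\<open>a n\<close> is the reciprocal of the probability of the complete graph,
    so it has to tend to 1.\<close>
  define a where "a = (\<lambda>n. cluster_weight r n / r ^ (n choose 2))"
  define x where "x = (\<lambda>n. real (Suc n) / sqrt r ^ Suc n)"
  have a_nonneg: "a n \<ge> 0" for n
    using r cluster_weight_pos[of r n] by (simp add: a_def)
  have a_Suc: "a (Suc n) = 1 + (\<Sum>d<n. real (n choose d) / r ^ (Suc d * (n - d)) * a (n - d))" for n
  proof -
    have *: "r ^ (Suc d choose 2) / r ^ (Suc n choose 2) = 1 / (r ^ (n - d choose 2) * r ^ (Suc d * (n - d)))"
      if "d \<le> n" for d
    proof -
      have "(Suc n choose 2) = (Suc d choose 2) + ((n - d choose 2) + Suc d * (n - d))"
        using choose_two_add[of "Suc d" "n - d"] that by simp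
      then show ?thesis using r by (simp add: power_add)
    qed
    have "a (Suc n) = (\<Sum>d\<le>n. real (n choose d) * (r ^ (Suc d choose 2) / r ^ (Suc n choose 2)) * cluster_weight r (n - d))"
      by (simp add: a_def cluster_weight.simps(2) sum_divide_distrib)
    also have "\<dots> = (\<Sum>d\<le>n. real (n choose d) / r ^ (Suc d * (n - d)) * a (n - d))"
      by (intro sum.cong refl, subst *) (auto simp: a_def)
    also have "\<dots> = 1 + (\<Sum>d<n. real (n choose d) / r ^ (Suc d * (n - d)) * a (n - d))"
      by (simp add: lessThan_Suc_atMost[symmetric] a_def numeral_2_eq_2)
    finally show ?thesis .
  qed
  have "x \<longlonglongrightarrow> 0"
    unfolding x_def using r by real_asymp
  have upper: "a (Suc n) \<le> 1 + 4 * x n * M" if M: "\<And>k. k \<le> n \<Longrightarrow> a k \<le> M" "M \<ge> 0" and x: "x n \<le> 1 / 2" for n M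
  proof -
    have x0: "x n \<ge> 0" using r by (simp add: x_def)
    have geom: "(\<Sum>d<n. x n ^ d) \<le> 2"
    proof -
      have "(\<Sum>d<n. x n ^ d) = (1 - x n ^ n) / (1 - x n)"
        using x by (subst sum_gp_strict) auto
      also have "\<dots> \<le> 1 / (1 / 2)" using x x0 by (intro frac_le) auto
      finally show ?thesis by simp
    qed
    have "(\<Sum>d<n. real (n choose d) / r ^ (Suc d * (n - d)) * a (n - d)) \<le>
        (\<Sum>d<n. (x n ^ Suc d + x n ^ (n - d)) * M)"
      using r M a_nonneg supercritical_coefficient_le[of r _ n]
      by (intro sum_mono mult_mono) (auto simp: x_def intro: order_trans)
    also have "\<dots> = (x n * (\<Sum>d<n. x n ^ d) + (\<Sum>d<n. x n ^ (n - d))) * M"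
      by (simp only: sum_distrib_left sum_distrib_right[symmetric] sum.distrib power_Suc)
    also have "(\<Sum>d<n. x n ^ (n - d)) = (\<Sum>d<n. x n ^ Suc d)"
      by (rule sum.reindex_bij_witness[of _ "\<lambda>d. n - Suc d" "\<lambda>d. n - Suc d"]) (auto simp: Suc_diff_Suc)
    also have "\<dots> = x n * (\<Sum>d<n. x n ^ d)" by (simp add: sum_distrib_left)
    also have "(x n * (\<Sum>d<n. x n ^ d) + x n * (\<Sum>d<n. x n ^ d)) * M \<le> (x n * 2 + x n * 2) * M"
      using geom x0 M(2) by (intro mult_right_mono add_mono mult_left_mono) auto
    finally show ?thesis unfolding a_Suc by (simp add: algebra_simps)
  qed
  \<comment> \<open>Below \<open>1 / 8\<close> the factor \<open>4 * x n\<close> is at most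
    \<open>1 / 2\<close>, so a bound \<open>M \<ge> 2\<close> reproduces itself:
    \<open>1 + M / 2 \<le> M\<close>. Once \<open>a\<close> is bounded, \<open>upper\<close> gives
    the limit.\<close>
  have "eventually (\<lambda>n. x n < 1 / 8) sequentially"
    using \<open>x \<longlonglongrightarrow> 0\<close> by (rule order_tendstoD) simp
  then obtain N where N: "\<And>n. n \<ge> N \<Longrightarrow> x n < 1 / 8"
    by (auto simp: eventually_sequentially)
  define M where "M = Max (insert 2 (a ` {..N}))"
  have M2: "M \<ge> 2" unfolding M_def by (intro Max_ge) auto
  have M: "a k \<le> M" for k
  proof (induction k rule: less_induct)
    case (less k)
    show ?case
    proof (cases "k \<le> N")
      case True
      then show ?thesis unfolding M_def by (intro Max_ge) auto
    next
      case False
      then obtain n where n: "k = Suc n" "n \<ge> N" by (cases k) auto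
      have "a (Suc n) \<le> 1 + 4 * x n * M"
        using less n N[of n] M2 by (intro upper) auto
      also have "4 * x n * M \<le> 1 / 2 * M" using N[of n] n M2 by (intro mult_right_mono) auto
      finally show ?thesis using n M2 by simp
    qed
  qed
  have "(\<lambda>n. a (Suc n)) \<longlonglongrightarrow> 1"
  proof (rule tendsto_sandwich)
    show "eventually (\<lambda>n. 1 \<le> a (Suc n)) sequentially"
      using r a_nonneg unfolding a_Suc by (intro always_eventually) (auto intro!: sum_nonneg)
    show "eventually (\<lambda>n. a (Suc n) \<le> 1 + 4 * x n * M) sequentially"
      unfolding eventually_sequentially
    proof (intro exI allI impI)
      fix n assume "n \<ge> N"
      then show "a (Suc n) \<le> 1 + 4 * x n * M"
        using M M2 N[of n] by (intro upper) auto
    qed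
    show "(\<lambda>n. 1 + 4 * x n * M) \<longlonglongrightarrow> 1"
      using \<open>x \<longlonglongrightarrow> 0\<close> by (auto intro!: tendsto_eq_intros)
  qed auto
  then have "(\<lambda>n. inverse (a (Suc n))) \<longlonglongrightarrow> inverse 1"
    by (rule tendsto_inverse) simp
  moreover have "measure_pmf.prob (degree_pmf (Suc n) p) {Suc n - 1} = inverse (a (Suc n))" for n
    using assms by (simp add: measure_pmf_single pmf_degree_pmf a_def r_def)
  ultimately have "(\<lambda>n. measure_pmf.prob (degree_pmf (Suc n) p) {Suc n - 1}) \<longlonglongrightarrow> 1"
    by simp
  then show ?thesis by (rule LIMSEQ_imp_Suc)
qed

section \<open>The case p = 1/2\<close>

lemma power_div_fact_le_exp:
  fixes x :: real
  assumes "x \<ge> 0"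
  shows "x ^ d / fact d \<le> exp x"
proof -
  have "(\<Sum>n\<in>{d}. inverse (fact n) * x ^ n) \<le> (\<Sum>n. inverse (fact n) * x ^ n)"
    using assms by (intro sum_le_suminf summable_exp) auto
  then show ?thesis by (simp add: exp_def divide_inverse mult.commute scaleR_conv_of_real)
qed

section \<open>Comparing binomial and Poisson laws\<close>

lemma prob_pmf_compl: "measure_pmf.prob P (- E) = 1 - measure_pmf.prob P E"
  using measure_pmf.prob_compl[of E P] by (simp add: Compl_eq_Diff_UNIV)

text \<open>Since \<open>1 - q \<le> exp (- q)\<close>, the binomial mass at \<open>d\<close> is at
  most \<open>exp (q * d)\<close> times the Poisson mass. Moving the exponential to the left and
  using \<open>exp (- q * d) \<ge> 1 - q * d\<close> costs \<open>q * d\<close> times the binomial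
  mass, and the mean \<open>m * q\<close> turns this into \<open>m * q\<^sup>2\<close>. The
  one-sided bound for the complement of \<open>E\<close> gives the other sign.\<close>

lemma prob_binomial_poisson_le:
  assumes q: "0 < q" "q \<le> 1" and m: "m > 0"
  shows "\<bar>measure_pmf.prob (binomial_pmf m q) E - measure_pmf.prob (poisson_pmf (real m * q)) E\<bar> \<le> real m * q\<^sup>2"
proof -
  let ?B = "binomial_pmf m q" and ?P = "poisson_pmf (real m * q)"
  have rate: "real m * q > 0" using q m by simp
  have pointwise: "pmf ?B d \<le> pmf ?P d + q * (real d * pmf ?B d)" if "d \<le> m" for d
  proof -
    have "real (m choose d) \<le> real m ^ d / fact d"
    proof -
      have "(m choose d) * fact d \<le> m ^ d"
      proof -
        have "fact m = ((m choose d) * fact d) * fact (m - d)"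
          using binomial_fact_lemma[OF that] by (simp only: mult_ac)
        then have "fact m div fact (m - d) = (m choose d) * fact d" by simp
        with fact_div_fact_le_pow[OF that] show ?thesis by simp
      qed
      then have "real (m choose d) * fact d \<le> real m ^ d"
        by (metis of_nat_fact of_nat_le_iff of_nat_mult of_nat_power)
      then show ?thesis by (simp add: field_simps)
    qed
    moreover have "(1 - q) ^ (m - d) \<le> exp (- q * real (m - d))"
    proof -
      have "(1 - q) ^ (m - d) \<le> exp (- q) ^ (m - d)"
        using q exp_ge_add_one_self[of "- q"] by (intro power_mono) auto
      then show ?thesis by (simp add: exp_of_nat2_mult[symmetric])
    qed
    ultimately have "real (m choose d) * q ^ d * (1 - q) ^ (m - d) \<le>
        real m ^ d / fact d * q ^ d * exp (- q * real (m - d))"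
      using q by (intro mult_mono) auto
    then have "pmf ?B d \<le> real m ^ d / fact d * q ^ d * exp (- q * real (m - d))"
      using q by simp
    also have "\<dots> = pmf ?P d * exp (q * real d)"
      using rate that by (simp add: power_mult_distrib exp_add[symmetric] algebra_simps of_nat_diff)
    finally have "pmf ?B d * exp (- q * real d) \<le> pmf ?P d * exp (q * real d) * exp (- q * real d)"
      by (intro mult_right_mono) auto
    also have "\<dots> = pmf ?P d" by (simp add: exp_add[symmetric] mult.assoc)
    finally have "pmf ?B d * exp (- q * real d) \<le> pmf ?P d" .
    moreover have "pmf ?B d * (1 - q * real d) \<le> pmf ?B d * exp (- q * real d)"
      using exp_ge_add_one_self[of "- q * real d"] by (intro mult_left_mono) auto
    ultimately show ?thesis by (simp add: algebra_simps)
  qed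
  have mean: "(\<Sum>d\<le>m. real d * pmf ?B d) = real m * q"
  proof -
    obtain k where k: "m = Suc k" using m by (cases m) auto
    have "(\<Sum>d\<le>m. real d * pmf ?B d) = (\<Sum>d\<le>k. real (Suc d) * pmf ?B (Suc d))"
      unfolding k by (subst sum.atMost_Suc_shift) simp
    also have "\<dots> = (\<Sum>d\<le>k. (real m * q) * pmf (binomial_pmf k q) d)"
    proof (intro sum.cong refl)
      fix d
      have "real (Suc d) * real (Suc k choose Suc d) = real (Suc k) * real (k choose d)"
        using Suc_times_binomial[of d k] by (metis of_nat_mult)
      then show "real (Suc d) * pmf ?B (Suc d) = (real m * q) * pmf (binomial_pmf k q) d"
        using q by (simp add: k mult.assoc[symmetric] del: of_nat_Suc binomial_Suc_Suc)
    qed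
    also have "\<dots> = (real m * q) * (\<Sum>d\<le>k. pmf (binomial_pmf k q) d)"
      by (simp add: sum_distrib_left)
    also have "(\<Sum>d\<le>k. pmf (binomial_pmf k q) d) = 1"
      using q by (intro sum_pmf_eq_1) (auto simp: set_pmf_binomial_eq)
    finally show ?thesis by simp
  qed
  have one_sided: "measure_pmf.prob ?B E - measure_pmf.prob ?P E \<le> real m * q\<^sup>2" for E
  proof -
    have "measure_pmf.prob ?B E = measure_pmf.prob ?B (E \<inter> {..m})"
      using q by (intro measure_pmf.finite_measure_eq_AE)
        (auto simp: AE_measure_pmf_iff set_pmf_binomial_eq split: if_splits)
    also have "\<dots> = (\<Sum>d\<in>E \<inter> {..m}. pmf ?B d)" by (simp add: measure_measure_pmf_finite)
    also have "\<dots> \<le> (\<Sum>d\<in>E \<inter> {..m}. pmf ?P d + q * (real d * pmf ?B d))"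
      by (intro sum_mono pointwise) auto
    also have "\<dots> = measure_pmf.prob ?P (E \<inter> {..m}) + q * (\<Sum>d\<in>E \<inter> {..m}. real d * pmf ?B d)"
      by (simp only: sum.distrib sum_distrib_left measure_measure_pmf_finite[OF finite_Int] finite_atMost disj_not1 simp_thms)
    also have "measure_pmf.prob ?P (E \<inter> {..m}) \<le> measure_pmf.prob ?P E"
      by (intro measure_pmf.finite_measure_mono) auto
    also have "(\<Sum>d\<in>E \<inter> {..m}. real d * pmf ?B d) \<le> (\<Sum>d\<le>m. real d * pmf ?B d)"
      by (intro sum_mono2) auto
    also note mean
    finally show ?thesis using q by (simp add: power2_eq_square mult_ac)
  qed
  show ?thesis
    using one_sided[of E] one_sided[of "- E"] by (simp add: prob_pmf_compl)
qed

text \<open>For \<open>a \<le> b\<close> the masses at rate \<open>b\<close> dominate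
  \<open>exp (a - b)\<close> times those at rate \<open>a\<close>, and
  \<open>1 - exp (a - b) \<le> b - a\<close>. The complement gives the other sign.\<close>

lemma prob_poisson_poisson_le:
  assumes "0 < a" "0 < b"
  shows "\<bar>measure_pmf.prob (poisson_pmf a) E - measure_pmf.prob (poisson_pmf b) E\<bar> \<le> \<bar>a - b\<bar>"
proof -
  have *: "measure_pmf.prob (poisson_pmf a) E - measure_pmf.prob (poisson_pmf b) E \<le> b - a"
    if "0 < a" "a \<le> b" for a b E
  proof -
    have "exp (- (b - a)) * pmf (poisson_pmf a) d \<le> pmf (poisson_pmf b) d" for d
    proof -
      have "exp (- (b - a)) * pmf (poisson_pmf a) d = a ^ d / fact d * exp (- b)"
      proof -
        have "exp (- b) = exp (a - b) * exp (- a)" by (simp add: exp_add[symmetric])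
        then show ?thesis using that by simp
      qed
      also have "\<dots> \<le> b ^ d / fact d * exp (- b)"
        using that by (intro mult_right_mono divide_right_mono power_mono) auto
      finally show ?thesis using that by simp
    qed
    then have "infsetsum (\<lambda>d. exp (- (b - a)) * pmf (poisson_pmf a) d) E \<le> infsetsum (pmf (poisson_pmf b)) E"
      by (intro infsetsum_mono abs_summable_on_cmult_right pmf_abs_summable) auto
    then have "exp (- (b - a)) * measure_pmf.prob (poisson_pmf a) E \<le> measure_pmf.prob (poisson_pmf b) E"
      by (subst (asm) infsetsum_cmult_right) (auto simp: measure_pmf_conv_infsetsum intro: pmf_abs_summable)
    moreover have "1 - exp (- (b - a)) \<le> b - a"
      using exp_ge_add_one_self[of "- (b - a)"] by linarith
    then have "(1 - exp (- (b - a))) * measure_pmf.prob (poisson_pmf a) E \<le> (b - a) * 1"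
      using that by (intro mult_mono) auto
    ultimately show ?thesis by (simp add: algebra_simps)
  qed
  have **: "\<bar>measure_pmf.prob (poisson_pmf a) E - measure_pmf.prob (poisson_pmf b) E\<bar> \<le> b - a"
    if "0 < a" "a \<le> b" for a b
    using *[OF that, of E] *[OF that, of "- E"] by (simp add: prob_pmf_compl)
  show ?thesis
  proof (cases "a \<le> b")
    case True
    then show ?thesis using **[of a b] assms by simp
  next
    case False
    then show ?thesis using **[of b a] assms by (simp add: abs_minus_commute)
  qed
qed

lemma expectation_poisson_power:
  assumes "0 < \<mu>"
  shows "measure_pmf.expectation (poisson_pmf \<mu>) (\<lambda>d. (z :: complex) ^ d) = exp (complex_of_real \<mu> * (z - 1))"
proof -
  have sums: "(\<lambda>d. pmf (poisson_pmf \<mu>) d *\<^sub>R z ^ d) sums exp (of_real \<mu> * (z - 1))"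
  proof -
    have "(\<lambda>d. (of_real \<mu> * z) ^ d /\<^sub>R fact d * exp (- of_real \<mu>)) sums (exp (of_real \<mu> * z) * exp (- of_real \<mu>))"
      by (intro sums_mult2 exp_converges)
    also have "exp (of_real \<mu> * z) * exp (- of_real \<mu>) = exp (of_real \<mu> * (z - 1))"
      by (simp add: exp_add[symmetric] algebra_simps)
    also have "(\<lambda>d. (of_real \<mu> * z) ^ d /\<^sub>R fact d * exp (- of_real \<mu>)) = (\<lambda>d. pmf (poisson_pmf \<mu>) d *\<^sub>R z ^ d)"
      using assms by (auto simp: power_mult_distrib scaleR_conv_of_real exp_of_real[symmetric] divide_inverse mult_ac)
    finally show ?thesis .
  qed
  have "summable (\<lambda>d. norm (pmf (poisson_pmf \<mu>) d *\<^sub>R z ^ d))"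
  proof -
    have "summable (\<lambda>d. norm ((of_real \<mu> * z) ^ d /\<^sub>R fact d) * exp (- \<mu>))"
      by (intro summable_mult2 summable_norm_exp)
    then show ?thesis using assms
      by (simp add: norm_mult norm_power power_mult_distrib divide_inverse mult_ac)
  qed
  then have abs: "Infinite_Set_Sum.abs_summable_on (\<lambda>d. pmf (poisson_pmf \<mu>) d *\<^sub>R z ^ d) UNIV"
    by (simp add: abs_summable_on_nat_iff')
  have "measure_pmf.expectation (poisson_pmf \<mu>) (\<lambda>d. z ^ d) = infsetsum (\<lambda>d. pmf (poisson_pmf \<mu>) d *\<^sub>R z ^ d) UNIV"
    unfolding infsetsum_def measure_pmf_eq_density by (subst integral_density) simp_all
  also have "\<dots> = exp (of_real \<mu> * (z - 1))"
    using infsetsum_nat'[OF abs] sums by (simp add: sums_iff)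
  finally show ?thesis .
qed

section \<open>Dobinski's formula and the mixture of binomials\<close>

lemma summable_power_over_fact:
  fixes x :: real
  assumes "x \<ge> 0"
  shows "summable (\<lambda>k. (real k + x) ^ m / fact k)"
proof (rule summable_comparison_test')
  have "summable (\<lambda>k. exp 1 ^ k /\<^sub>R fact k :: real)" by (rule summable_exp_generic)
  then show "summable (\<lambda>k. fact m * exp x * (exp 1 ^ k /\<^sub>R fact k) :: real)" by (rule summable_mult)
  fix k
  have "(real k + x) ^ m / fact m \<le> exp (real k + x)"
    using assms by (intro power_div_fact_le_exp) auto
  then have "(real k + x) ^ m \<le> fact m * (exp x * exp 1 ^ k)"
    by (simp add: field_simps exp_add exp_of_nat_mult[symmetric])
  then show "norm ((real k + x) ^ m / fact k) \<le> fact m * exp x * (exp 1 ^ k /\<^sub>R fact k)"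
    using assms by (simp add: field_simps)
qed

text \<open>Dobinski's series, \<open>exp 1\<close> times the Bell number; the constant cancels in
  the degree law.\<close>

definition bell_sum :: "nat \<Rightarrow> real" where
  "bell_sum n = (\<Sum>k. real k ^ n / fact k)"

lemma summable_bell_sum: "summable (\<lambda>k. real k ^ n / fact k)"
  using summable_power_over_fact[of 0 n] by simp

lemma bell_sum_Suc: "bell_sum (Suc n) = (\<Sum>k. (real k + 1) ^ n / fact k)"
proof -
  have "bell_sum (Suc n) = (\<Sum>k. real (Suc k) ^ Suc n / fact (Suc k))"
    unfolding bell_sum_def by (subst suminf_split_head[OF summable_bell_sum]) simp
  also have "(\<lambda>k. real (Suc k) ^ Suc n / fact (Suc k) :: real) = (\<lambda>k. (real k + 1) ^ n / fact k)"
    by (auto simp: add.commute)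
  finally show ?thesis .
qed

text \<open>Shifting the index and expanding \<open>(k + 1) ^ m\<close> shows that the series obeys
  the recursion of \<open>cluster_weight 1\<close>; the factor \<open>exp 1\<close> comes from
  \<open>n = 0\<close>.\<close>

lemma dobinski: "bell_sum n = exp 1 * cluster_weight 1 n"
proof (induction n rule: less_induct)
  case (less n)
  show ?case
  proof (cases n)
    case 0
    then show ?thesis by (simp add: bell_sum_def exp_def divide_inverse)
  next
    case (Suc m)
    have "bell_sum n = (\<Sum>k. (real k + 1) ^ m / fact k)" by (simp add: Suc bell_sum_Suc)
    also have "\<dots> = (\<Sum>k. \<Sum>d\<le>m. real (m choose d) * (real k ^ (m - d) / fact k))"
      by (subst add.commute) (simp add: binomial_ring sum_divide_distrib)
    also have "\<dots> = (\<Sum>d\<le>m. real (m choose d) * bell_sum (m - d))"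
      unfolding bell_sum_def
      by (subst suminf_sum) (auto intro!: summable_mult summable_bell_sum simp: suminf_mult[OF summable_bell_sum] simp del: times_divide_eq_right)
    also have "\<dots> = (\<Sum>d\<le>m. real (m choose d) * (exp 1 * cluster_weight 1 (m - d)))"
      using less Suc by (intro sum.cong) auto
    also have "\<dots> = exp 1 * cluster_weight 1 n"
      by (simp add: Suc cluster_weight.simps(2) sum_distrib_left mult_ac)
    finally show ?thesis .
  qed
qed

lemma bell_sum_pos: "bell_sum n > 0"
  by (simp add: dobinski cluster_weight_pos)

lemma pmf_degree_half: "pmf (degree_pmf (Suc m) (1 / 2)) d = real (m choose d) * bell_sum (m - d) / bell_sum (Suc m)"
  by (simp add: pmf_degree_pmf dobinski)

text \<open>By Dobinski's formula the degree is a mixture, over \<open>k\<close> with weights \<open>(k + 1)\<^sup>m / k!\<close>,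
  of binomial variables with parameters \<open>m\<close> and \<open>1 / (k + 1)\<close>.\<close>

lemma prob_degree_half_sums:
  "(\<lambda>k. (real k + 1) ^ m / fact k / bell_sum (Suc m) * measure_pmf.prob (binomial_pmf m (1 / (real k + 1))) E)
     sums measure_pmf.prob (degree_pmf (Suc m) (1 / 2)) E"
proof -
  \<comment> \<open>The factor \<open>(k + 1) ^ m\<close> clears the denominators of
    \<open>1 / (k + 1)\<close> and \<open>1 - 1 / (k + 1)\<close>.\<close>
  have bin: "(real k + 1) ^ m * measure_pmf.prob (binomial_pmf m (1 / (real k + 1))) E =
      (\<Sum>d\<in>E \<inter> {..m}. real (m choose d) * real k ^ (m - d))" for k
  proof -
    have "measure_pmf.prob (binomial_pmf m (1 / (real k + 1))) E =
        measure_pmf.prob (binomial_pmf m (1 / (real k + 1))) (E \<inter> {..m})"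
      by (intro measure_pmf.finite_measure_eq_AE)
        (auto simp: AE_measure_pmf_iff set_pmf_binomial_eq split: if_splits)
    also have "\<dots> = (\<Sum>d\<in>E \<inter> {..m}. real (m choose d) * (1 / (real k + 1)) ^ d * (1 - 1 / (real k + 1)) ^ (m - d))"
      by (simp add: measure_measure_pmf_finite)
    also have "(real k + 1) ^ m * \<dots> = (\<Sum>d\<in>E \<inter> {..m}. real (m choose d) * real k ^ (m - d))"
      unfolding sum_distrib_left
    proof (intro sum.cong refl)
      fix d assume "d \<in> E \<inter> {..m}"
      then have "(real k + 1) ^ m = (real k + 1) ^ d * (real k + 1) ^ (m - d)"
        by (simp add: power_add[symmetric])
      moreover have "1 - 1 / (real k + 1) = real k / (real k + 1)" by (simp add: field_simps)
      ultimately show "(real k + 1) ^ m * (real (m choose d) * (1 / (real k + 1)) ^ d * (1 - 1 / (real k + 1)) ^ (m - d)) =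
          real (m choose d) * real k ^ (m - d)"
        by (simp add: power_divide)
    qed
    finally show ?thesis .
  qed
  \<comment> \<open>Cutting \<open>E\<close> down to \<open>{..m}\<close> makes the sum over
    \<open>d\<close> finite, so it commutes with the series.\<close>
  have "(\<lambda>k. \<Sum>d\<in>E \<inter> {..m}. real (m choose d) * (real k ^ (m - d) / fact k) / bell_sum (Suc m)) sums
      (\<Sum>d\<in>E \<inter> {..m}. real (m choose d) * bell_sum (m - d) / bell_sum (Suc m))"
    unfolding bell_sum_def[of "m - _"]
    by (intro sums_sum sums_divide sums_mult summable_sums summable_bell_sum)
  also have "(\<Sum>d\<in>E \<inter> {..m}. real (m choose d) * bell_sum (m - d) / bell_sum (Suc m)) =
      measure_pmf.prob (degree_pmf (Suc m) (1 / 2)) (E \<inter> {..m})"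
    by (simp add: measure_measure_pmf_finite pmf_degree_half)
  also have "\<dots> = measure_pmf.prob (degree_pmf (Suc m) (1 / 2)) E"
    by (intro measure_pmf.finite_measure_eq_AE)
       (auto simp: AE_measure_pmf_iff set_pmf_iff pmf_degree_half not_le intro: ccontr)
  also have "(\<lambda>k. \<Sum>d\<in>E \<inter> {..m}. real (m choose d) * (real k ^ (m - d) / fact k) / bell_sum (Suc m)) =
      (\<lambda>k. (real k + 1) ^ m / fact k / bell_sum (Suc m) * measure_pmf.prob (binomial_pmf m (1 / (real k + 1))) E)"
  proof
    fix k
    have "(\<Sum>d\<in>E \<inter> {..m}. real (m choose d) * (real k ^ (m - d) / fact k) / bell_sum (Suc m)) =
        (\<Sum>d\<in>E \<inter> {..m}. real (m choose d) * real k ^ (m - d)) / fact k / bell_sum (Suc m)"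
      by (simp add: sum_divide_distrib)
    then show "(\<Sum>d\<in>E \<inter> {..m}. real (m choose d) * (real k ^ (m - d) / fact k) / bell_sum (Suc m)) =
        (real k + 1) ^ m / fact k / bell_sum (Suc m) * measure_pmf.prob (binomial_pmf m (1 / (real k + 1))) E"
      by (simp add: bin[symmetric])
  qed
  finally show ?thesis .
qed

text \<open>The binomial with parameters \<open>m\<close> and \<open>1 / (k + 1)\<close> has
  generating function \<open>(1 + (z - 1) / (k + 1)) ^ m\<close>, which the factor
  \<open>(k + 1) ^ m\<close> of the mixing weight turns into \<open>(k + z) ^ m\<close>.\<close>

lemma expectation_degree_half_sums:
  "(\<lambda>k. (of_nat k + z) ^ m / of_real (fact k * bell_sum (Suc m)))
     sums measure_pmf.expectation (degree_pmf (Suc m) (1 / 2)) (\<lambda>d. (z :: complex) ^ d)"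
proof -
  have "measure_pmf.expectation (degree_pmf (Suc m) (1 / 2)) (\<lambda>d. z ^ d) =
      (\<Sum>d\<le>m. pmf (degree_pmf (Suc m) (1 / 2)) d *\<^sub>R z ^ d)"
    by (rule integral_measure_pmf) (auto simp: set_pmf_iff pmf_degree_half not_le intro: ccontr)
  also have "\<dots> = (\<Sum>d\<le>m. of_nat (m choose d) * of_real (bell_sum (m - d)) / of_real (bell_sum (Suc m)) * z ^ d)"
    by (simp add: pmf_degree_half scaleR_conv_of_real)
  finally have E: "measure_pmf.expectation (degree_pmf (Suc m) (1 / 2)) (\<lambda>d. z ^ d) = \<dots>" .
  have "(\<lambda>k. \<Sum>d\<le>m. of_nat (m choose d) * of_real (real k ^ (m - d) / fact k) / of_real (bell_sum (Suc m)) * z ^ d) sums \<dots>"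
    unfolding bell_sum_def[of "m - _"]
    by (intro sums_sum sums_divide sums_mult2 sums_mult sums_of_real summable_sums summable_bell_sum)
  also have "(\<lambda>k. \<Sum>d\<le>m. of_nat (m choose d) * of_real (real k ^ (m - d) / fact k) / of_real (bell_sum (Suc m)) * z ^ d) =
     (\<lambda>k. (of_nat k + z) ^ m / of_real (fact k * bell_sum (Suc m)))"
    by (subst add.commute) (simp add: binomial_ring sum_divide_distrib mult_ac)
  finally show ?thesis unfolding E .
qed

text \<open>Each distance from \<open>f\<close> is attained at most twice, once on either
  side.\<close>

lemma sum_dist_le_suminf:
  fixes g :: "nat \<Rightarrow> real"
  assumes "summable g" "\<And>j. g j \<ge> 0"
  shows "(\<Sum>d<n. g (nat \<bar>int d - int f\<bar>)) \<le> 2 * suminf g"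
proof -
  let ?\<phi> = "\<lambda>d. nat \<bar>int d - int f\<bar>"
  have *: "(\<Sum>d\<in>A. g (?\<phi> d)) \<le> suminf g" if "finite A" "inj_on ?\<phi> A" for A
    using assms that sum_le_suminf[of g "?\<phi> ` A"] by (simp add: sum.reindex)
  have "(\<Sum>d<n. g (?\<phi> d)) \<le> (\<Sum>d\<in>{..<f} \<union> {f..<n}. g (?\<phi> d))"
    using assms by (intro sum_mono2) auto
  also have "\<dots> = (\<Sum>d\<in>{..<f}. g (?\<phi> d)) + (\<Sum>d\<in>{f..<n}. g (?\<phi> d))"
    by (intro sum.union_disjoint) auto
  also have "\<dots> \<le> suminf g + suminf g"
    by (intro add_mono *) (auto simp: inj_on_def)
  finally show ?thesis by simp
qed

section \<open>Geometric decay away from the saddle point\<close>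

lemma geometric_growth:
  fixes u :: "nat \<Rightarrow> real"
  assumes "\<And>j. j \<ge> b \<Longrightarrow> u (Suc j) \<le> q * u j" "0 \<le> q"
  shows "u (b + i) \<le> q ^ i * u b"
proof (induction i)
  case (Suc i)
  have "u (b + Suc i) \<le> q * u (b + i)" using assms(1)[of "b + i"] by simp
  also have "\<dots> \<le> q * (q ^ i * u b)" using assms(2) by (intro mult_left_mono Suc.IH)
  finally show ?case by (simp add: mult_ac)
qed simp

lemma geometric_growth_down:
  fixes u :: "nat \<Rightarrow> real"
  assumes "\<And>j. j < a \<Longrightarrow> u j \<le> q * u (Suc j)" "0 \<le> q" "i \<le> a"
  shows "u (a - i) \<le> q ^ i * u a"
  using assms(3)
proof (induction i)
  case (Suc i)
  have "u (a - Suc i) \<le> q * u (a - i)"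
    using assms(1)[of "a - Suc i"] Suc.prems by (simp add: Suc_diff_Suc)
  also have "\<dots> \<le> q * (q ^ i * u a)" using Suc assms(2) by (intro mult_left_mono) auto
  finally show ?case by (simp add: mult_ac)
qed simp

text \<open>The quotient of consecutive terms, \<open>((j + 1) / j) ^ N / (j + 1)\<close>, is at
  most \<open>exp (N / j) / j\<close>, which decreases in \<open>j\<close>. So a bound at the real
  point \<open>\<beta>\<close> controls all \<open>j \<ge> \<beta>\<close>.\<close>

lemma power_over_fact_decay:
  fixes \<beta> q :: real
  assumes "0 < \<beta>" "exp (real N / \<beta>) / \<beta> \<le> q" "\<beta> \<le> real b"
  shows "real (b + i) ^ N / fact (b + i) \<le> q ^ i * (real b ^ N / fact b)"
proof (rule geometric_growth)
  have "0 < exp (real N / \<beta>) / \<beta>" using assms by simp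
  with assms show q: "0 \<le> q" by linarith
  fix j assume j: "j \<ge> b"
  then have pos: "real j > 0" and ge: "real j \<ge> \<beta>" using assms by auto
  have "((real j + 1) / real j) ^ N \<le> exp (1 / real j) ^ N"
    using pos exp_ge_add_one_self[of "1 / real j"] by (intro power_mono) (auto simp: field_simps)
  also have "\<dots> = exp (real N / real j)" by (simp add: exp_of_nat_mult[symmetric])
  also have "\<dots> \<le> exp (real N / \<beta>)"
    using assms ge by (simp add: divide_left_mono)
  finally have "((real j + 1) / real j) ^ N / (real j + 1) \<le> exp (real N / \<beta>) / \<beta>"
    using assms ge by (intro frac_le) auto
  also have "\<dots> \<le> q" by fact
  finally have "((real j + 1) / real j) ^ N / (real j + 1) * (real j ^ N / fact j) \<le> q * (real j ^ N / fact j)"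
    by (intro mult_right_mono) auto
  moreover have "((real j + 1) / real j) ^ N / (real j + 1) * (real j ^ N / fact j) = real (Suc j) ^ N / fact (Suc j)"
    using pos by (simp add: power_divide add.commute)
  ultimately show "real (Suc j) ^ N / fact (Suc j) \<le> q * (real j ^ N / fact j)" by simp
qed

text \<open>Mirror image below the peak, from the reverse estimate
  \<open>exp (1 / (j + 1)) \<le> (j + 1) / j\<close>. Its \<open>j + 1\<close> fits a step down from
  \<open>Suc j \<le> \<alpha>\<close>.\<close>

lemma power_over_fact_decay_down:
  fixes \<alpha> q :: real
  assumes "0 < q" "1 / q \<le> exp (real N / \<alpha>) / \<alpha>" "real a \<le> \<alpha>" "i \<le> a" "N > 0"
  shows "real (a - i) ^ N / fact (a - i) \<le> q ^ i * (real a ^ N / fact a)"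
proof (rule geometric_growth_down[OF _ _ assms(4)])
  show "0 \<le> q" using assms by simp
  fix j assume j: "j < a"
  show "real j ^ N / fact j \<le> q * (real (Suc j) ^ N / fact (Suc j))"
  proof (cases "j = 0")
    case True
    then show ?thesis using assms by (simp add: zero_power)
  next
    case False
    then have pos: "real j > 0" by simp
    have le: "real j + 1 \<le> \<alpha>" using j assms by linarith
    have "1 / q \<le> exp (real N / \<alpha>) / \<alpha>" by fact
    also have "\<dots> \<le> exp (real N / (real j + 1)) / (real j + 1)"
      using le by (intro frac_le) (auto intro!: divide_left_mono mult_pos_pos)
    also have "exp (real N / (real j + 1)) = exp (1 / (real j + 1)) ^ N"
      by (simp add: exp_of_nat_mult[symmetric])
    also have "exp (1 / (real j + 1)) ^ N / (real j + 1) \<le> ((real j + 1) / real j) ^ N / (real j + 1)"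
    proof (intro divide_right_mono power_mono)
      have "1 - 1 / (real j + 1) \<le> exp (- (1 / (real j + 1)))"
        using exp_ge_add_one_self[of "- (1 / (real j + 1))"] by simp
      moreover have "1 - 1 / (real j + 1) = real j / (real j + 1)" by (simp add: field_simps)
      ultimately have "real j / (real j + 1) * exp (1 / (real j + 1)) \<le> exp (- (1 / (real j + 1))) * exp (1 / (real j + 1))"
        by (intro mult_right_mono) auto
      also have "\<dots> = 1" by (simp add: exp_add[symmetric])
      finally show "exp (1 / (real j + 1)) \<le> (real j + 1) / real j"
        using pos by (simp add: field_simps)
    qed auto
    finally have "1 / q \<le> ((real j + 1) / real j) ^ N / (real j + 1)" .
    then have "q * (1 / q) \<le> q * (((real j + 1) / real j) ^ N / (real j + 1))"
      using assms by (intro mult_left_mono) auto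
    then have "1 * (real j ^ N / fact j) \<le> q * (((real j + 1) / real j) ^ N / (real j + 1)) * (real j ^ N / fact j)"
      using assms by (intro mult_right_mono) auto
    also have "\<dots> = q * (real (Suc j) ^ N / fact (Suc j))"
      using pos by (simp add: power_divide add.commute)
    finally show ?thesis by simp
  qed
qed

text \<open>A single term of the series bounds the peak by the normaliser; the loss
  \<open>j ^ (A - 1)\<close> is polynomial, and the decay will absorb it.\<close>

lemma power_over_fact_le_bell_sum:
  assumes "j > 0" "A > 0"
  shows "real j ^ (m + A) / fact j \<le> real j ^ (A - 1) * bell_sum (Suc m)"
proof -
  have "(\<Sum>k\<in>{j}. real k ^ Suc m / fact k) \<le> bell_sum (Suc m)"
    unfolding bell_sum_def by (intro sum_le_suminf summable_bell_sum) auto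
  then have "real j ^ (A - 1) * (real j ^ Suc m / fact j) \<le> real j ^ (A - 1) * bell_sum (Suc m)"
    by (intro mult_left_mono) auto
  moreover have "m + A = (A - 1) + Suc m" using assms by simp
  then have "real j ^ (m + A) = real j ^ (A - 1) * real j ^ Suc m" by (simp only: power_add)
  ultimately show ?thesis by simp
qed

text \<open>For \<open>norm z \<le> A\<close> the terms \<open>norm (k + z) ^ m / fact k\<close>
  should be compared with one sequence of the form \<open>j ^ N / fact j\<close>. The estimate
  \<open>fact (k + A) \<le> fact k * (k + A) ^ A\<close> moves them there, with
  \<open>j = k + A\<close>.\<close>

lemma shifted_power_over_fact_le:
  "(real k + real A) ^ m / fact k \<le> real (k + A) ^ (m + A) / fact (k + A)"
proof -
  have "fact (k + A) div fact (k + A - A) \<le> (k + A) ^ A" by (intro fact_div_fact_le_pow) simp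
  then have "fact k * (fact (k + A) div fact k) \<le> fact k * (k + A) ^ A"
    by (intro mult_left_mono) simp_all
  moreover have "fact k * (fact (k + A) div fact k) = (fact (k + A) :: nat)"
    by (intro dvd_mult_div_cancel fact_dvd) simp
  ultimately have "fact (k + A) \<le> fact k * (k + A) ^ A" by simp
  then have "real (fact (k + A)) \<le> real (fact k * (k + A) ^ A)" by (rule of_nat_mono)
  then have "(fact (k + A) :: real) \<le> fact k * real (k + A) ^ A" by simp
  then have "real (k + A) ^ m * fact (k + A) \<le> real (k + A) ^ m * (fact k * real (k + A) ^ A)"
    by (intro mult_left_mono) auto
  then show ?thesis by (simp add: field_simps power_add)
qed

text \<open>The rate is taken at n = m + 1, since \<open>Suc m\<close> vertices lead to binomials
  with parameter \<open>m\<close>.\<close>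

definition poisson_rate :: "nat \<Rightarrow> real" where
  "poisson_rate m = ln (real m + 1) - ln (ln (real m + 1))"

text \<open>Saddle point bound: with \<open>u\<^sub>j = j\<^bsup>m + A\<^esup> / j!\<close>, the ratio \<open>u\<^bsub>j + 1\<^esub> / u\<^sub>j\<close> is about
  \<open>exp (m / j) / j\<close>, which is close to \<open>exp (\<plusminus> e)\<close> at \<open>j = m / (poisson_rate m \<plusminus> e)\<close>. So the
  mixing weights decay geometrically over the two gaps between \<open>m / (poisson_rate m \<plusminus> e)\<close> and
  \<open>m / (poisson_rate m \<plusminus> 2 * e)\<close>, whose lengths exceed every multiple of \<open>ln m\<close>.\<close>

lemma bell_sum_tail_tendsto_0:
  fixes e :: real
  assumes e: "e > 0" and A: "A > 0"
  shows "(\<lambda>m. (real m + 1) ^ C * (\<Sum>k. if \<bar>real m / (real k + 1) - poisson_rate m\<bar> \<le> 2 * e then 0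
     else (real k + real A) ^ m / fact k) / bell_sum (Suc m)) \<longlonglongrightarrow> 0"
proof -
  \<comment> \<open>The ratio tends to \<open>exp (- e)\<close> at \<open>\<beta> m\<close> and to
    \<open>exp e\<close> at \<open>\<alpha> m\<close>; \<open>q\<close> and \<open>1 / q\<close>
    leave a margin to these limits. The square root \<open>s\<close> of \<open>q\<close> splits the
    decay: one half pays for the gap, the other is summed as a geometric series.\<close>
  define q where "q = exp (- e / 2)"
  define s where "s = exp (- e / 4)"
  have s: "0 < s" "s < 1" and q: "0 < q" using e by (auto simp: q_def s_def)
  have "q * exp (e / 2) = 1" by (simp add: q_def mult_exp_exp)
  then have q_inv: "1 / q = exp (e / 2)" using q by (simp add: field_simps)
  have sq: "s * s = q" by (simp add: q_def s_def mult_exp_exp)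
  define L where "L = poisson_rate"
  define \<beta> where "\<beta> = (\<lambda>m. real m / (L m - e))"
  define \<alpha> where "\<alpha> = (\<lambda>m. real m / (L m + e))"
  \<comment> \<open>The lengths of the gaps, less what rounding \<open>\<beta> m\<close> up and
    \<open>\<alpha> m\<close> down costs and, in \<open>\<delta>\<close>, less the index shift
    \<open>A\<close>.\<close>
  define \<gamma> where "\<gamma> = (\<lambda>m. real m / (L m - 2 * e) - \<beta> m - 1)"
  define \<delta> where "\<delta> = (\<lambda>m. \<alpha> m - 1 - real m / (L m + 2 * e) - real A)"
  define t where "t = (\<lambda>m k. if \<bar>real m / (real k + 1) - L m\<bar> \<le> 2 * e then 0
     else (real k + real A) ^ m / fact k)"
  note defs = \<alpha>_def \<beta>_def \<gamma>_def \<delta>_def L_def poisson_rate_def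
  have "((\<lambda>m. exp ((real m + real A) / \<beta> m) / \<beta> m) \<longlongrightarrow> exp (- e)) sequentially"
    unfolding defs using e by real_asymp
  then have ev1: "eventually (\<lambda>m. exp ((real m + real A) / \<beta> m) / \<beta> m < q) sequentially"
    by (rule order_tendstoD) (use e in \<open>simp add: q_def\<close>)
  have "((\<lambda>m. exp ((real m + real A) / \<alpha> m) / \<alpha> m) \<longlongrightarrow> exp e) sequentially"
    unfolding defs using e by real_asymp
  then have ev2: "eventually (\<lambda>m. exp ((real m + real A) / \<alpha> m) / \<alpha> m > 1 / q) sequentially"
    by (rule order_tendstoD) (use e in \<open>simp add: q_inv\<close>)
  have ev3: "eventually (\<lambda>m. L m > 2 * e) sequentially"
    unfolding defs by real_asymp
  have ev4: "eventually (\<lambda>m. \<gamma> m > 0) sequentially"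
    unfolding defs using e by real_asymp
  have ev5: "eventually (\<lambda>m. \<delta> m > 0) sequentially"
    unfolding defs using e by real_asymp
  have ev6: "eventually (\<lambda>m. \<beta> m > 0 \<and> \<beta> m + 1 \<le> real m) sequentially"
    unfolding defs using e by (intro eventually_conj; real_asymp)
  have ev7: "eventually (\<lambda>m. \<alpha> m \<le> real m) sequentially"
    unfolding defs using e by real_asymp
  have bound: "eventually (\<lambda>m. suminf (t m) \<le> real m ^ (A - 1) * bell_sum (Suc m) * (s powr \<gamma> m + s powr \<delta> m) * (2 / (1 - s))) sequentially"
    using ev1 ev2 ev3 ev4 ev5 ev6 ev7 eventually_gt_at_top[of 0]
  proof eventually_elim
    case (elim m)
    define b where "b = nat \<lceil>\<beta> m\<rceil>"
    define a where "a = nat \<lfloor>\<alpha> m\<rfloor>"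
    have b: "\<beta> m \<le> real b" "real b < \<beta> m + 1" "b > 0" "b \<le> m"
      using elim(6) unfolding b_def by linarith+
    have \<alpha>_pos: "\<alpha> m > real A + 1"
    proof -
      have "real m / (L m + 2 * e) \<ge> 0" using elim(3) e by simp
      then show ?thesis using elim(5) unfolding \<delta>_def by linarith
    qed
    have a: "real a \<le> \<alpha> m" "\<alpha> m < real a + 1" "a > 0" "a \<le> m" "A \<le> a"
      using \<alpha>_pos elim(7) unfolding a_def by linarith+
    define M where "M = real m ^ (A - 1) * bell_sum (Suc m)"
    have M: "M \<ge> 0" using bell_sum_pos[of "Suc m"] by (simp add: M_def less_imp_le)
    have u_le: "real j ^ (m + A) / fact j \<le> M" if "0 < j" "j \<le> m" for j
    proof -
      have "real j ^ (m + A) / fact j \<le> real j ^ (A - 1) * bell_sum (Suc m)"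
        using that A by (intro power_over_fact_le_bell_sum) auto
      also have "\<dots> \<le> M" unfolding M_def
        using that bell_sum_pos[of "Suc m"] by (intro mult_right_mono power_mono) auto
      finally show ?thesis .
    qed
    have half: "q ^ i \<le> s powr x * s ^ i" if "x \<le> real i" for i x
    proof -
      have "q ^ i = s ^ i * s ^ i" by (simp add: sq[symmetric] power_mult_distrib)
      then have "q ^ i = s powr real i * s ^ i" using s by (simp add: powr_realpow)
      also have "\<dots> \<le> s powr x * s ^ i" using s that by (intro mult_right_mono powr_mono') auto
      finally show ?thesis .
    qed
    have t_le: "t m k \<le> M * (s powr \<gamma> m * s ^ nat \<bar>int k - int (b - 1)\<bar> + s powr \<delta> m * s ^ nat \<bar>int k - int (a - A)\<bar>)" for k
    proof -
      have nn: "0 \<le> M * (s powr \<gamma> m * s ^ nat \<bar>int k - int (b - 1)\<bar>)" "0 \<le> M * (s powr \<delta> m * s ^ nat \<bar>int k - int (a - A)\<bar>)"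
        using M s by auto
      consider "\<bar>real m / (real k + 1) - L m\<bar> \<le> 2 * e" | "real m / (real k + 1) < L m - 2 * e"
        | "real m / (real k + 1) > L m + 2 * e" by linarith
      then show ?thesis
      proof cases
        case 1
        then show ?thesis using nn by (simp add: t_def distrib_left)
      next
        case 2
        then have "real m / (L m - 2 * e) < real k + 1"
          using elim(3) by (simp add: field_simps)
        then have k: "\<gamma> m \<le> real k + 1 - real b" using b unfolding \<gamma>_def by linarith
        then have kb: "k + 1 \<ge> b" using elim(4) by linarith
        define i where "i = nat \<bar>int k - int (b - 1)\<bar>"
        have i: "i = k + 1 - b" using kb b(3) unfolding i_def by linarith
        have "t m k \<le> (real k + real A) ^ m / fact k" by (simp add: t_def)
        also have "\<dots> \<le> real (k + A) ^ (m + A) / fact (k + A)" by (rule shifted_power_over_fact_le)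
        \<comment> \<open>\<open>i\<close> is the distance of \<open>k\<close> from
          \<open>b - 1\<close>, so \<open>k + A\<close> lies \<open>A - 1\<close> steps further out;
          their additional decay is given away.\<close>
        also have "k + A = b + (i + (A - 1))" using i kb A by linarith
        also have "real (b + (i + (A - 1))) ^ (m + A) / fact (b + (i + (A - 1))) \<le> q ^ (i + (A - 1)) * (real b ^ (m + A) / fact b)"
          using elim(1) elim(6) b by (intro power_over_fact_decay[of "\<beta> m"]) auto
        also have "\<dots> \<le> q ^ i * M"
        proof (intro mult_mono u_le power_decreasing)
          show "q \<le> 1" using e by (simp add: q_def)
        qed (use q b M in auto)
        also have "\<dots> \<le> (s powr \<gamma> m * s ^ i) * M"
          using k kb M by (intro mult_right_mono half) (auto simp: i of_nat_diff)
        finally show ?thesis using nn by (simp add: i_def distrib_left mult_ac)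
      next
        case 3
        then have "real k + 1 < real m / (L m + 2 * e)"
          using elim(3) e by (simp add: field_simps)
        then have k: "\<delta> m \<le> real a - real (k + A)" using a unfolding \<delta>_def by simp
        then have ka: "k + A \<le> a" using elim(5) by linarith
        define i where "i = nat \<bar>int k - int (a - A)\<bar>"
        have i: "i = a - (k + A)" using ka a(5) unfolding i_def by linarith
        have "t m k \<le> (real k + real A) ^ m / fact k" by (simp add: t_def)
        also have "\<dots> \<le> real (k + A) ^ (m + A) / fact (k + A)" by (rule shifted_power_over_fact_le)
        also have "k + A = a - i" using i ka by linarith
        also have "real (a - i) ^ (m + A) / fact (a - i) \<le> q ^ i * (real a ^ (m + A) / fact a)"
          using elim(2) q a i A by (intro power_over_fact_decay_down[of q _ "\<alpha> m"]) auto
        also have "\<dots> \<le> q ^ i * M"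
          using q a by (intro mult_left_mono u_le) auto
        also have "\<dots> \<le> (s powr \<delta> m * s ^ i) * M"
          using k ka M by (intro mult_right_mono half) (auto simp: i of_nat_diff)
        finally show ?thesis using nn by (simp add: i_def distrib_left mult_ac)
      qed
    qed
    have geom: "(\<Sum>k<n. s ^ nat \<bar>int k - int f\<bar>) \<le> 2 / (1 - s)" for n f
      using sum_dist_le_suminf[where g = "\<lambda>j. s ^ j" and n = n and f = f] s
      by (simp add: summable_geometric suminf_geometric)
    have "(\<Sum>k<n. t m k) \<le> M * (s powr \<gamma> m + s powr \<delta> m) * (2 / (1 - s))" for n
    proof -
      have "(\<Sum>k<n. t m k) \<le> (\<Sum>k<n. M * (s powr \<gamma> m * s ^ nat \<bar>int k - int (b - 1)\<bar> + s powr \<delta> m * s ^ nat \<bar>int k - int (a - A)\<bar>))"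
        by (intro sum_mono t_le)
      also have "\<dots> = M * (s powr \<gamma> m * (\<Sum>k<n. s ^ nat \<bar>int k - int (b - 1)\<bar>) + s powr \<delta> m * (\<Sum>k<n. s ^ nat \<bar>int k - int (a - A)\<bar>))"
        by (simp add: sum_distrib_left[symmetric] sum.distrib)
      also have "\<dots> \<le> M * (s powr \<gamma> m * (2 / (1 - s)) + s powr \<delta> m * (2 / (1 - s)))"
        using M s by (intro mult_left_mono add_mono geom) auto
      finally show ?thesis by (simp add: algebra_simps add_divide_distrib)
    qed
    moreover have "summable (t m)"
      by (rule summable_comparison_test'[OF summable_power_over_fact[of "real A" m]]) (auto simp: t_def)
    ultimately show ?case unfolding M_def by (intro suminf_le_const) auto
  qed
  \<comment> \<open>Both gaps have order \<open>m / (ln m)\<^sup>2\<close>, so the exponential decay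
    over them beats every power of \<open>m\<close>.\<close>
  have lim: "(\<lambda>m. (real m + 1) ^ C * (real m ^ (A - 1) * (s powr \<gamma> m + s powr \<delta> m) * (2 / (1 - s)))) \<longlonglongrightarrow> 0"
  proof -
    have "(\<lambda>m. (real m + 1) ^ C * real m ^ (A - 1) * exp (- (e / 4) * \<gamma> m)) \<longlonglongrightarrow> 0"
      unfolding defs using e by real_asymp
    moreover have "(\<lambda>m. (real m + 1) ^ C * real m ^ (A - 1) * exp (- (e / 4) * \<delta> m)) \<longlonglongrightarrow> 0"
      unfolding defs using e by real_asymp
    ultimately have "(\<lambda>m. ((real m + 1) ^ C * real m ^ (A - 1) * exp (- (e / 4) * \<gamma> m) +
        (real m + 1) ^ C * real m ^ (A - 1) * exp (- (e / 4) * \<delta> m)) * (2 / (1 - s))) \<longlonglongrightarrow> (0 + 0) * (2 / (1 - s))"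
      by (intro tendsto_mult tendsto_add tendsto_const)
    then show ?thesis using s by (simp add: s_def powr_def algebra_simps add_divide_distrib)
  qed
  have "(\<lambda>m. (real m + 1) ^ C * suminf (t m) / bell_sum (Suc m)) \<longlonglongrightarrow> 0"
  proof (rule tendsto_sandwich[OF _ _ tendsto_const lim])
    have nonneg: "t m k \<ge> 0" for m k by (simp add: t_def)
    have summ: "summable (t m)" for m
      by (rule summable_comparison_test'[OF summable_power_over_fact[of "real A" m]]) (auto simp: t_def)
    show "eventually (\<lambda>m. 0 \<le> (real m + 1) ^ C * suminf (t m) / bell_sum (Suc m)) sequentially"
      using suminf_nonneg[OF summ nonneg] bell_sum_pos
      by (intro always_eventually allI divide_nonneg_nonneg mult_nonneg_nonneg) (auto simp: less_imp_le)
    show "eventually (\<lambda>m. (real m + 1) ^ C * suminf (t m) / bell_sum (Suc m) \<le>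
        (real m + 1) ^ C * (real m ^ (A - 1) * (s powr \<gamma> m + s powr \<delta> m) * (2 / (1 - s)))) sequentially"
      using bound
    proof eventually_elim
      case (elim m)
      have "(real m + 1) ^ C * suminf (t m) / bell_sum (Suc m) \<le>
          (real m + 1) ^ C * (real m ^ (A - 1) * bell_sum (Suc m) * (s powr \<gamma> m + s powr \<delta> m) * (2 / (1 - s))) / bell_sum (Suc m)"
        using elim bell_sum_pos[of "Suc m"] by (intro divide_right_mono mult_left_mono) auto
      also have "\<dots> = (real m + 1) ^ C * (real m ^ (A - 1) * (s powr \<gamma> m + s powr \<delta> m) * (2 / (1 - s)))"
        using bell_sum_pos[of "Suc m"] by simp
      finally show ?case .
    qed
  qed
  then show ?thesis by (simp add: t_def L_def)
qed

section \<open>From the mixture to the Poisson law\<close>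

definition mixing_weight :: "nat \<Rightarrow> nat \<Rightarrow> real" where
  "mixing_weight m k = (real k + 1) ^ m / fact k / bell_sum (Suc m)"

lemma mixing_weight_nonneg: "mixing_weight m k \<ge> 0"
  using bell_sum_pos[of "Suc m"] by (simp add: mixing_weight_def)

lemma mixing_weight_sums: "mixing_weight m sums 1"
proof -
  have "(\<lambda>k. (real k + 1) ^ m / fact k / bell_sum (Suc m)) sums (bell_sum (Suc m) / bell_sum (Suc m))"
    unfolding bell_sum_Suc[of m]
    by (intro sums_divide summable_sums summable_power_over_fact) auto
  then show ?thesis using bell_sum_pos[of "Suc m"] by (simp add: mixing_weight_def[abs_def])
qed

text \<open>At \<open>A = 1\<close> these are the mixing weights outside the window of binomial
  means within \<open>2 * e\<close> of \<open>poisson_rate m\<close>; a larger \<open>A\<close>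
  dominates the complex terms with \<open>norm z \<le> A\<close>.\<close>

definition bell_tail :: "real \<Rightarrow> nat \<Rightarrow> nat \<Rightarrow> nat \<Rightarrow> real" where
  "bell_tail e A m k = (if \<bar>real m / (real k + 1) - poisson_rate m\<bar> \<le> 2 * e then 0
     else (real k + real A) ^ m / fact k / bell_sum (Suc m))"

lemma summable_bell_tail: "summable (bell_tail e A m)"
proof (rule summable_comparison_test')
  show "summable (\<lambda>k. (real k + real A) ^ m / fact k / bell_sum (Suc m))"
    by (intro summable_divide summable_power_over_fact) auto
  show "norm (bell_tail e A m k) \<le> (real k + real A) ^ m / fact k / bell_sum (Suc m)" for k
    using bell_sum_pos[of "Suc m"] by (simp add: bell_tail_def)
qed

text \<open>The power \<open>C\<close> compensates for dividing by a Poisson generating function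
  that may be polynomially small.\<close>

lemma bell_tail_tendsto_0:
  assumes "e > 0" "A > 0"
  shows "(\<lambda>m. (real m + 1) ^ C * suminf (bell_tail e A m)) \<longlonglongrightarrow> 0"
proof -
  have "suminf (bell_tail e A m) = (\<Sum>k. if \<bar>real m / (real k + 1) - poisson_rate m\<bar> \<le> 2 * e then 0
     else (real k + real A) ^ m / fact k) / bell_sum (Suc m)" for m
  proof -
    have "summable (\<lambda>k. if \<bar>real m / (real k + 1) - poisson_rate m\<bar> \<le> 2 * e then 0
       else (real k + real A) ^ m / fact k)"
      by (rule summable_comparison_test'[OF summable_power_over_fact[of "real A" m]]) auto
    then show ?thesis
      by (subst suminf_divide[symmetric]) (auto simp: bell_tail_def intro!: arg_cong[of _ _ suminf])
  qed
  then show ?thesis using bell_sum_tail_tendsto_0[OF assms, of C] by simp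
qed

lemma smallo_1_poisson_rate:
  fixes \<mu> :: "nat \<Rightarrow> real"
  assumes "(\<lambda>n. \<mu> n - (ln (real n) - ln (ln (real n)))) \<in> o(\<lambda>_. 1)"
  shows "(\<lambda>m. poisson_rate m - \<mu> (Suc m)) \<longlonglongrightarrow> 0"
    and "eventually (\<lambda>m. \<mu> (Suc m) > 0 \<and> \<mu> (Suc m) \<le> ln (real m + 1)) sequentially"
proof -
  have "(\<lambda>n. \<mu> n - (ln (real n) - ln (ln (real n)))) \<longlonglongrightarrow> 0"
    using smalloD_tendsto[OF assms] by simp
  then have "(\<lambda>m. \<mu> (Suc m) - poisson_rate m) \<longlonglongrightarrow> 0"
    unfolding poisson_rate_def by (subst (asm) filterlim_sequentially_Suc[symmetric]) (simp add: add.commute)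
  then show lim: "(\<lambda>m. poisson_rate m - \<mu> (Suc m)) \<longlonglongrightarrow> 0"
    using tendsto_minus by fastforce
  have "eventually (\<lambda>m. \<bar>poisson_rate m - \<mu> (Suc m)\<bar> < 1) sequentially"
    using tendstoD[OF lim, of 1] by (simp add: dist_real_def)
  moreover have "eventually (\<lambda>m. poisson_rate m > 1) sequentially"
    "eventually (\<lambda>m. poisson_rate m + 1 \<le> ln (real m + 1)) sequentially"
    unfolding poisson_rate_def by real_asymp+
  ultimately show "eventually (\<lambda>m. \<mu> (Suc m) > 0 \<and> \<mu> (Suc m) \<le> ln (real m + 1)) sequentially"
    by eventually_elim auto
qed

text \<open>The common frame of both Poisson limits: an error \<open>\<delta>\<close> per unit of
  mixing weight inside the window and a constant times the tail outside.\<close>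

lemma abs_suminf_le_mixture:
  fixes f :: "nat \<Rightarrow> 'a::banach"
  assumes "\<And>k. norm (f k) \<le> mixing_weight m k * \<delta> + bell_tail e A m k * c" "f sums x"
  shows "norm x \<le> \<delta> + suminf (bell_tail e A m) * c"
proof -
  have "(\<lambda>k. mixing_weight m k * \<delta> + bell_tail e A m k * c) sums (1 * \<delta> + suminf (bell_tail e A m) * c)"
    by (intro sums_add sums_mult2 mixing_weight_sums summable_sums summable_bell_tail)
  then have g: "summable (\<lambda>k. mixing_weight m k * \<delta> + bell_tail e A m k * c)"
    "(\<Sum>k. mixing_weight m k * \<delta> + bell_tail e A m k * c) = \<delta> + suminf (bell_tail e A m) * c"
    by (auto simp: sums_iff)
  have "norm x = norm (suminf f)" using assms(2) by (simp add: sums_iff)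
  also have "\<dots> \<le> (\<Sum>k. norm (f k))"
    by (intro summable_norm summable_comparison_test'[OF g(1)]) (use assms(1) in auto)
  also have "\<dots> \<le> \<delta> + suminf (bell_tail e A m) * c"
    unfolding g(2)[symmetric]
    by (intro suminf_le assms(1) g(1) summable_comparison_test'[OF g(1)]) (use assms(1) in auto)
  finally show ?thesis .
qed

text \<open>Inside the window each binomial is replaced by the Poisson law of the same mean
  \<open>m / (k + 1)\<close>, and then by the one of rate \<open>\<mu>\<close>; the window bounds
  the difference of these rates. Outside, probabilities differ by at most 1.\<close>

lemma tv_dist_degree_poisson_le:
  assumes "m > 0" "\<mu> > 0" "e > 0" "poisson_rate m > 0"
  shows "tv_dist (degree_pmf (Suc m) (1 / 2)) (poisson_pmf \<mu>) \<le>
    (poisson_rate m + 2 * e)\<^sup>2 / real m + 2 * e + \<bar>poisson_rate m - \<mu>\<bar> + suminf (bell_tail e 1 m)"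
  unfolding tv_dist_def
proof (rule cSUP_least)
  fix E
  let ?D = "degree_pmf (Suc m) (1 / 2)" and ?L = "poisson_rate m"
  let ?\<delta> = "(?L + 2 * e)\<^sup>2 / real m + 2 * e + \<bar>?L - \<mu>\<bar>"
  let ?B = "\<lambda>k. measure_pmf.prob (binomial_pmf m (1 / (real k + 1))) E"
  let ?P = "measure_pmf.prob (poisson_pmf \<mu>) E"
  have "(\<lambda>k. mixing_weight m k * ?B k - mixing_weight m k * ?P) sums (measure_pmf.prob ?D E - 1 * ?P)"
    unfolding mixing_weight_def[abs_def]
    by (intro sums_diff prob_degree_half_sums sums_mult2 mixing_weight_sums[unfolded mixing_weight_def[abs_def]])
  moreover have "norm (mixing_weight m k * ?B k - mixing_weight m k * ?P) \<le> mixing_weight m k * ?\<delta> + bell_tail e 1 m k * 1" for k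
  proof -
    have eq: "norm (mixing_weight m k * ?B k - mixing_weight m k * ?P) = mixing_weight m k * \<bar>?B k - ?P\<bar>"
      using mixing_weight_nonneg[of m k] by (simp add: right_diff_distrib[symmetric] abs_mult)
    show ?thesis
    proof (cases "\<bar>real m / (real k + 1) - ?L\<bar> \<le> 2 * e")
      case True
      let ?Q = "measure_pmf.prob (poisson_pmf (real m * (1 / (real k + 1)))) E"
      have "\<bar>?B k - ?Q\<bar> \<le> real m * (1 / (real k + 1))\<^sup>2"
        using assms(1) by (intro prob_binomial_poisson_le) auto
      also have "\<dots> = (real m / (real k + 1))\<^sup>2 / real m"
        using assms(1) by (simp add: power_divide power2_eq_square)
      also have "\<dots> \<le> (?L + 2 * e)\<^sup>2 / real m"
        using True by (intro divide_right_mono power_mono) auto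
      finally have "\<bar>?B k - ?Q\<bar> \<le> (?L + 2 * e)\<^sup>2 / real m" .
      moreover have "\<bar>?Q - ?P\<bar> \<le> \<bar>real m * (1 / (real k + 1)) - \<mu>\<bar>"
        using assms(1,2) by (intro prob_poisson_poisson_le) auto
      ultimately have "\<bar>?B k - ?P\<bar> \<le> ?\<delta>" using True by simp
      then show ?thesis
        using True mixing_weight_nonneg[of m k] unfolding eq by (simp add: bell_tail_def mult_left_mono)
    next
      case False
      have "\<bar>?B k - ?P\<bar> \<le> 1"
        using measure_pmf.prob_le_1[of "binomial_pmf m (1 / (real k + 1))" E] measure_pmf.prob_le_1[of "poisson_pmf \<mu>" E]
          measure_nonneg[of "binomial_pmf m (1 / (real k + 1))" E] measure_nonneg[of "poisson_pmf \<mu>" E] by linarith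
      then have "mixing_weight m k * \<bar>?B k - ?P\<bar> \<le> mixing_weight m k * 1"
        by (intro mult_left_mono mixing_weight_nonneg)
      also have "\<dots> = bell_tail e 1 m k * 1" using False by (simp add: bell_tail_def mixing_weight_def)
      also have "\<dots> \<le> mixing_weight m k * ?\<delta> + bell_tail e 1 m k * 1"
        using mixing_weight_nonneg[of m k] assms by simp
      finally show ?thesis unfolding eq .
    qed
  qed
  ultimately have "norm (measure_pmf.prob ?D E - 1 * ?P) \<le> ?\<delta> + suminf (bell_tail e 1 m) * 1"
    by (rule abs_suminf_le_mixture[rotated])
  then show "\<bar>measure_pmf.prob ?D E - ?P\<bar> \<le> ?\<delta> + suminf (bell_tail e 1 m)" by simp
qed simp

lemma tv_dist_nonneg: "tv_dist P Q \<ge> 0"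
proof -
  have "bdd_above (range (\<lambda>E. \<bar>measure_pmf.prob P E - measure_pmf.prob Q E\<bar>))"
  proof (intro bdd_aboveI[of _ 1], safe)
    show "\<bar>measure_pmf.prob P E - measure_pmf.prob Q E\<bar> \<le> 1" for E
      using measure_pmf.prob_le_1[of P E] measure_pmf.prob_le_1[of Q E]
        measure_nonneg[of P E] measure_nonneg[of Q E] by linarith
  qed
  then have "\<bar>measure_pmf.prob P {} - measure_pmf.prob Q {}\<bar> \<le> tv_dist P Q"
    unfolding tv_dist_def by (intro cSUP_upper) auto
  then show ?thesis by simp
qed

lemma tendsto_tv_dist_degree_poisson:
  assumes "(\<lambda>n. \<mu> n - (ln (real n) - ln (ln (real n)))) \<in> o(\<lambda>_. 1)"
  shows "(\<lambda>n. tv_dist (degree_pmf n (1 / 2)) (poisson_pmf (\<mu> n))) \<longlonglongrightarrow> 0"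
proof -
  note \<mu> = smallo_1_poisson_rate[OF assms]
  have "(\<lambda>m. tv_dist (degree_pmf (Suc m) (1 / 2)) (poisson_pmf (\<mu> (Suc m)))) \<longlonglongrightarrow> 0"
  proof (rule tendstoI)
    fix \<epsilon> :: real assume \<epsilon>: "\<epsilon> > 0"
    define e where "e = \<epsilon> / 8"
    have e: "e > 0" using \<epsilon> by (simp add: e_def)
    have "(\<lambda>m. (poisson_rate m + 2 * e)\<^sup>2 / real m) \<longlonglongrightarrow> 0"
      unfolding poisson_rate_def by real_asymp
    then have "(\<lambda>m. (poisson_rate m + 2 * e)\<^sup>2 / real m + 2 * e + \<bar>poisson_rate m - \<mu> (Suc m)\<bar> + suminf (bell_tail e 1 m)) \<longlonglongrightarrow>
        0 + 2 * e + \<bar>0\<bar> + 0"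
      using bell_tail_tendsto_0[OF e, of 1 0]
      by (intro tendsto_add tendsto_const tendsto_rabs \<mu>(1)) auto
    moreover have "0 + 2 * e + \<bar>0\<bar> + 0 < \<epsilon>" using \<epsilon> by (simp add: e_def)
    ultimately have "eventually (\<lambda>m. (poisson_rate m + 2 * e)\<^sup>2 / real m + 2 * e + \<bar>poisson_rate m - \<mu> (Suc m)\<bar> + suminf (bell_tail e 1 m) < \<epsilon>) sequentially"
      by (rule order_tendstoD(2))
    moreover have "eventually (\<lambda>m. poisson_rate m > 0) sequentially"
      unfolding poisson_rate_def by real_asymp
    ultimately show "eventually (\<lambda>m. dist (tv_dist (degree_pmf (Suc m) (1 / 2)) (poisson_pmf (\<mu> (Suc m)))) 0 < \<epsilon>) sequentially"
      using \<mu>(2) eventually_gt_at_top[of 0]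
    proof eventually_elim
      case (elim m)
      have "tv_dist (degree_pmf (Suc m) (1 / 2)) (poisson_pmf (\<mu> (Suc m))) < \<epsilon>"
        using tv_dist_degree_poisson_le[of m "\<mu> (Suc m)" e] elim e by linarith
      then show ?case by (simp add: abs_of_nonneg tv_dist_nonneg)
    qed
  qed
  then show ?thesis by (rule LIMSEQ_imp_Suc)
qed

text \<open>The error must be relative, so every term is divided by the Poisson generating function
  \<open>c\<close>. Inside the window the quotient is the mixing weight times \<open>exp w\<close>
  with \<open>w\<close> near 0. Outside, \<open>inverse (norm c)\<close> is at most a power of
  \<open>m + 1\<close>, because \<open>\<mu> \<le> ln (m + 1)\<close>.\<close>

lemma norm_expectation_degree_ratio_le:
  fixes z :: complex
  assumes m: "m > 0" and \<mu>: "0 < \<mu>" "\<mu> \<le> ln (real m + 1)" and e: "e > 0" and L: "poisson_rate m > 0"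
    and \<eta>: "\<And>w :: complex. norm w < \<eta> \<Longrightarrow> norm (exp w - 1) \<le> \<epsilon>" and "\<epsilon> \<ge> 0"
    and small: "norm (z - 1) * (poisson_rate m + 2 * e) / real m \<le> 1 / 2"
    and bound: "2 * (norm (z - 1))\<^sup>2 * (poisson_rate m + 2 * e)\<^sup>2 / real m
      + (2 * e + \<bar>poisson_rate m - \<mu>\<bar>) * norm (z - 1) < \<eta>"
    and A: "norm z \<le> real A" "A > 0" and C: "norm (z - 1) \<le> real C"
  shows "norm (measure_pmf.expectation (degree_pmf (Suc m) (1 / 2)) (\<lambda>d. z ^ d) /
      measure_pmf.expectation (poisson_pmf \<mu>) (\<lambda>d. z ^ d) - 1) \<le>
    \<epsilon> + suminf (bell_tail e A m) * (2 * (real m + 1) ^ C)"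
proof -
  let ?L = "poisson_rate m"
  define c where "c = exp (complex_of_real \<mu> * (z - 1))"
  have c: "c \<noteq> 0" by (simp add: c_def)
  define b where "b = bell_sum (Suc m)"
  have b: "b > 0" by (simp add: b_def bell_sum_pos)
  have c_inv: "inverse (norm c) \<le> (real m + 1) ^ C"
  proof -
    have "inverse (norm c) = norm (exp (- (complex_of_real \<mu> * (z - 1))))"
      by (simp add: c_def exp_minus norm_inverse)
    also have "\<dots> \<le> exp (norm (- (complex_of_real \<mu> * (z - 1))))" by (rule norm_exp)
    also have "\<dots> = exp (\<mu> * norm (z - 1))" using \<mu> by (simp add: norm_mult)
    also have "\<dots> \<le> exp (ln (real m + 1) * real C)"
      using \<mu> C by (simp add: mult_mono)
    also have "\<dots> = (real m + 1) ^ C" by (simp add: mult.commute exp_of_nat_mult)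
    finally show ?thesis .
  qed
  let ?f = "\<lambda>k. (of_nat k + z) ^ m / of_real (fact k * b) / c - of_real (mixing_weight m k)"
  have "?f sums (measure_pmf.expectation (degree_pmf (Suc m) (1 / 2)) (\<lambda>d. z ^ d) / c - of_real 1)"
    unfolding b_def
    by (intro sums_diff sums_divide expectation_degree_half_sums sums_of_real mixing_weight_sums)
  moreover have "norm (?f k) \<le> mixing_weight m k * \<epsilon> + bell_tail e A m k * (2 * (real m + 1) ^ C)" for k
  proof (cases "\<bar>real m / (real k + 1) - ?L\<bar> \<le> 2 * e")
    case True
    \<comment> \<open>\<open>k + z = (k + 1) * (1 + x)\<close>, and \<open>m * x\<close> is the
      binomial mean times \<open>z - 1\<close>. Hence \<open>w\<close> splits into the second-order
      error of the logarithm and the difference of the rates times \<open>z - 1\<close>.\<close>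
    define x where "x = (z - 1) / of_real (real k + 1)"
    have k1: "complex_of_real (real k + 1) \<noteq> 0" by (simp del: of_real_add)
    have norm_x: "norm x = norm (z - 1) / (real k + 1)"
      by (simp add: x_def norm_divide del: of_real_add)
    have le: "real m / (real k + 1) \<le> ?L + 2 * e" using True by linarith
    have "norm x = norm (z - 1) * (real m / (real k + 1)) / real m" using m by (simp add: norm_x)
    also have "\<dots> \<le> norm (z - 1) * (?L + 2 * e) / real m"
      using le by (intro divide_right_mono mult_left_mono) auto
    finally have x_half: "norm x \<le> 1 / 2" using small by linarith
    have x1: "1 + x \<noteq> 0"
    proof
      assume "1 + x = 0"
      then have "x = - 1" by (simp add: add_eq_0_iff)
      with x_half show False by simp
    qed
    have "of_real (real k + 1) * x = z - 1" using k1 by (simp add: x_def del: of_real_add)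
    then have zk: "of_nat k + z = of_real (real k + 1) * (1 + x)"
      by (simp only: distrib_left) simp
    define w where "w = of_nat m * ln (1 + x) - of_real \<mu> * (z - 1)"
    have "(1 + x) ^ m / c = exp w"
      using x1 by (simp add: w_def c_def exp_diff exp_of_nat_mult)
    then have "(1 + x) ^ m = exp w * c" using c by (simp add: field_simps)
    then have "(of_nat k + z) ^ m / of_real (fact k * b) / c = of_real (mixing_weight m k) * exp w"
      unfolding zk power_mult_distrib using c by (simp add: mixing_weight_def b_def)
    then have f: "?f k = of_real (mixing_weight m k) * (exp w - 1)" by (simp add: algebra_simps)
    have "of_nat m * x = of_real (real m / (real k + 1)) * (z - 1)" by (simp add: x_def)
    then have "of_nat m * (ln (1 + x) - x) = of_nat m * ln (1 + x) - of_real (real m / (real k + 1)) * (z - 1)"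
      by (simp only: right_diff_distrib)
    moreover have "of_real (real m / (real k + 1) - \<mu>) * (z - 1) =
        of_real (real m / (real k + 1)) * (z - 1) - of_real \<mu> * (z - 1)"
      by (simp only: of_real_diff left_diff_distrib)
    ultimately have "w = of_nat m * (ln (1 + x) - x) + of_real (real m / (real k + 1) - \<mu>) * (z - 1)"
      by (simp only: w_def) simp
    then have "norm w \<le> norm (of_nat m * (ln (1 + x) - x)) + norm (of_real (real m / (real k + 1) - \<mu>) * (z - 1))"
      using norm_triangle_ineq by metis
    also have "norm (of_real (real m / (real k + 1) - \<mu>) * (z - 1)) \<le> (2 * e + \<bar>?L - \<mu>\<bar>) * norm (z - 1)"
      unfolding norm_mult norm_of_real using True by (intro mult_right_mono) auto
    also have "norm (of_nat m * (ln (1 + x) - x)) \<le> 2 * (norm (z - 1))\<^sup>2 * (?L + 2 * e)\<^sup>2 / real m"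
    proof -
      have "norm (ln (1 + x) - x) \<le> (norm x)\<^sup>2 / (1 - norm x)"
        using x_half by (intro Ln_approx_linear) auto
      also have "\<dots> \<le> (norm x)\<^sup>2 / (1 / 2)"
        using x_half by (intro divide_left_mono) auto
      finally have "real m * norm (ln (1 + x) - x) \<le> real m * (2 * (norm x)\<^sup>2)"
        by (intro mult_left_mono) auto
      also have "\<dots> = 2 * (norm (z - 1))\<^sup>2 * (real m / (real k + 1))\<^sup>2 / real m"
        using m by (simp add: norm_x power_divide power2_eq_square)
      also have "\<dots> \<le> 2 * (norm (z - 1))\<^sup>2 * (?L + 2 * e)\<^sup>2 / real m"
        using le by (intro divide_right_mono mult_left_mono power_mono) auto
      finally show ?thesis by (simp add: norm_mult)
    qed
    finally have "norm w < \<eta>" using bound by linarith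
    then have "norm (exp w - 1) \<le> \<epsilon>" by (rule \<eta>)
    then show ?thesis
      using True mixing_weight_nonneg[of m k] unfolding f by (simp add: norm_mult bell_tail_def mult_left_mono)
  next
    case False
    define T where "T = bell_tail e A m k"
    have T: "T = (real k + real A) ^ m / fact k / b" using False by (simp add: T_def bell_tail_def b_def)
    have T_nonneg: "T \<ge> 0" using b by (simp add: T)
    have "norm (of_nat k + z) \<le> real k + real A"
      using norm_triangle_ineq[of "of_nat k" z] A by simp
    then have "norm (of_nat k + z) ^ m / (fact k * b) / norm c \<le> (real k + real A) ^ m / (fact k * b) / norm c"
      using b by (intro divide_right_mono power_mono) auto
    also have "\<dots> = T * inverse (norm c)" by (simp add: T divide_inverse mult_ac)
    also have "\<dots> \<le> T * (real m + 1) ^ C" using T_nonneg c_inv by (intro mult_left_mono)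
    finally have 1: "norm ((of_nat k + z) ^ m / of_real (fact k * b) / c) \<le> T * (real m + 1) ^ C"
      using b by (simp add: norm_divide norm_power norm_mult)
    have "mixing_weight m k \<le> T"
      unfolding mixing_weight_def T b_def[symmetric]
      using A b by (intro divide_right_mono power_mono) auto
    also have "\<dots> \<le> T * (real m + 1) ^ C"
      using T_nonneg by (intro mult_left_mono[of 1 _ T, simplified]) (auto intro!: one_le_power)
    finally have 2: "norm (of_real (mixing_weight m k) :: complex) \<le> T * (real m + 1) ^ C"
      using mixing_weight_nonneg[of m k] by simp
    have "norm (?f k) \<le> T * (real m + 1) ^ C + T * (real m + 1) ^ C"
      using norm_triangle_ineq4[of "(of_nat k + z) ^ m / of_real (fact k * b) / c" "of_real (mixing_weight m k)"] 1 2
      by linarith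
    also have "\<dots> = T * (2 * (real m + 1) ^ C)" by simp
    also have "\<dots> \<le> mixing_weight m k * \<epsilon> + T * (2 * (real m + 1) ^ C)"
      using mixing_weight_nonneg[of m k] \<open>\<epsilon> \<ge> 0\<close> by simp
    finally show ?thesis by (simp only: T_def)
  qed
  ultimately have "norm (measure_pmf.expectation (degree_pmf (Suc m) (1 / 2)) (\<lambda>d. z ^ d) / c - of_real 1) \<le>
      \<epsilon> + suminf (bell_tail e A m) * (2 * (real m + 1) ^ C)"
    by (rule abs_suminf_le_mixture[rotated])
  then show ?thesis using \<mu> by (simp add: c_def expectation_poisson_power)
qed

lemma expectation_degree_asymp_equiv_poisson:
  fixes z :: complex
  assumes "(\<lambda>n. \<mu> n - (ln (real n) - ln (ln (real n)))) \<in> o(\<lambda>_. 1)"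
  shows "(\<lambda>n. measure_pmf.expectation (degree_pmf n (1 / 2)) (\<lambda>d. z ^ d))
    \<sim>[at_top] (\<lambda>n. measure_pmf.expectation (poisson_pmf (\<mu> n)) (\<lambda>d. z ^ d))"
proof (rule asymp_equivI')
  note \<mu> = smallo_1_poisson_rate[OF assms]
  let ?R = "\<lambda>n. measure_pmf.expectation (degree_pmf n (1 / 2)) (\<lambda>d. z ^ d) / measure_pmf.expectation (poisson_pmf (\<mu> n)) (\<lambda>d. z ^ d)"
  have "(\<lambda>m. ?R (Suc m)) \<longlonglongrightarrow> 1"
  proof (rule tendstoI)
    fix \<epsilon> :: real assume \<epsilon>: "\<epsilon> > 0"
    have "isCont (exp :: complex \<Rightarrow> complex) 0" by simp
    then obtain \<eta> where \<eta>: "\<eta> > 0" "\<And>w :: complex. norm w < \<eta> \<Longrightarrow> norm (exp w - 1) < \<epsilon> / 2"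
      using \<epsilon> half_gt_zero[OF \<epsilon>] unfolding continuous_at_eps_delta dist_norm by (metis diff_zero exp_zero)
    \<comment> \<open>The summand 1 keeps the denominator positive at \<open>z = 1\<close>; the
      window contributes \<open>2 * e * norm (z - 1) \<le> \<eta> / 2\<close> to
      \<open>w\<close>.\<close>
    define e where "e = \<eta> / (4 * (norm (z - 1) + 1))"
    have pos: "norm (z - 1) + 1 > 0" using norm_ge_zero[of "z - 1"] by linarith
    have e: "e > 0" using \<eta> pos by (simp add: e_def)
    have "e * norm (z - 1) \<le> e * (norm (z - 1) + 1)" using e by simp
    also have "\<dots> = \<eta> / 4" using pos by (simp add: e_def field_simps)
    finally have e_small: "e * norm (z - 1) \<le> \<eta> / 4" .
    define A where "A = nat \<lceil>norm z\<rceil> + 1"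
    have A: "norm z \<le> real A" "A > 0" unfolding A_def by linarith+
    define C where "C = nat \<lceil>norm (z - 1)\<rceil>"
    have C: "norm (z - 1) \<le> real C" unfolding C_def by linarith
    have lim1: "(\<lambda>m. norm (z - 1) * (poisson_rate m + 2 * e) / real m) \<longlonglongrightarrow> 0"
    proof -
      have "(\<lambda>m. (poisson_rate m + 2 * e) / real m) \<longlonglongrightarrow> 0" unfolding poisson_rate_def by real_asymp
      from tendsto_mult_right_zero[OF this, of "norm (z - 1)"] show ?thesis by simp
    qed
    then have "eventually (\<lambda>m. norm (z - 1) * (poisson_rate m + 2 * e) / real m < 1 / 2) sequentially"
      by (rule order_tendstoD) simp
    moreover have "eventually (\<lambda>m. 2 * (norm (z - 1))\<^sup>2 * (poisson_rate m + 2 * e)\<^sup>2 / real m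
        + (2 * e + \<bar>poisson_rate m - \<mu> (Suc m)\<bar>) * norm (z - 1) < \<eta>) sequentially"
    proof -
      have "(\<lambda>m. (poisson_rate m + 2 * e)\<^sup>2 / real m) \<longlonglongrightarrow> 0" unfolding poisson_rate_def by real_asymp
      from tendsto_mult_right_zero[OF this, of "2 * (norm (z - 1))\<^sup>2"]
      have "(\<lambda>m. 2 * (norm (z - 1))\<^sup>2 * (poisson_rate m + 2 * e)\<^sup>2 / real m) \<longlonglongrightarrow> 0" by simp
      then have "(\<lambda>m. 2 * (norm (z - 1))\<^sup>2 * (poisson_rate m + 2 * e)\<^sup>2 / real m
          + (2 * e + \<bar>poisson_rate m - \<mu> (Suc m)\<bar>) * norm (z - 1)) \<longlonglongrightarrow> 0 + (2 * e + \<bar>0\<bar>) * norm (z - 1)"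
        by (intro tendsto_add tendsto_mult tendsto_const tendsto_rabs \<mu>(1))
      moreover have "0 + (2 * e + \<bar>0\<bar>) * norm (z - 1) < \<eta>" using e_small \<eta>(1) by simp
      ultimately show ?thesis by (rule order_tendstoD(2))
    qed
    moreover have "eventually (\<lambda>m. suminf (bell_tail e A m) * (2 * (real m + 1) ^ C) < \<epsilon> / 2) sequentially"
    proof -
      have "(\<lambda>m. 2 * ((real m + 1) ^ C * suminf (bell_tail e A m))) \<longlonglongrightarrow> 0"
        by (intro tendsto_mult_right_zero bell_tail_tendsto_0 e A)
      then have "(\<lambda>m. suminf (bell_tail e A m) * (2 * (real m + 1) ^ C)) \<longlonglongrightarrow> 0" by (simp add: mult_ac)
      then show ?thesis using \<epsilon> by (intro order_tendstoD(2)) auto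
    qed
    moreover have "eventually (\<lambda>m. poisson_rate m > 0) sequentially"
      unfolding poisson_rate_def by real_asymp
    ultimately show "eventually (\<lambda>m. dist (?R (Suc m)) 1 < \<epsilon>) sequentially"
      using \<mu>(2) eventually_gt_at_top[of 0]
    proof eventually_elim
      case (elim m)
      have "norm (?R (Suc m) - 1) \<le> \<epsilon> / 2 + suminf (bell_tail e A m) * (2 * (real m + 1) ^ C)"
        using elim e \<epsilon> A C less_imp_le[OF \<eta>(2)] by (intro norm_expectation_degree_ratio_le[where \<eta> = \<eta>]) auto
      then show ?case using elim by (simp add: dist_norm)
    qed
  qed
  then show "?R \<longlonglongrightarrow> 1" by (rule LIMSEQ_imp_Suc)
qed

section \<open>The case p < 1/2\<close>

text \<open>Bender and Canfield: symmetrising the double sum \<open>S\<close> below in \<open>a\<close> and \<open>b\<close> turns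
  \<open>n (n + 1) (A\<^sub>n\<^sup>2 - A\<^bsub>n+1\<^esub> A\<^bsub>n-1\<^esub>)\<close> into a sum of products of two minors of equal sign, which
  involve \<open>A\<close> only up to index \<open>n\<close>.\<close>

lemma ratio_mono_of_exp_recurrence:
  fixes X A :: "nat \<Rightarrow> real"
  assumes A_pos: "\<And>n. A n > 0" and X_pos: "\<And>n. X n > 0" and X0: "X 0 = 1"
    and rec: "\<And>n. real (Suc n) * A (Suc n) = (\<Sum>d\<le>n. X (Suc d) * A (n - d))"
    and logconcave: "antimono (\<lambda>n. X (Suc n) / X n)"
  defines "y \<equiv> \<lambda>n. if n = 0 then 0 else A (n - 1) / A n"
  shows "incseq y" and "\<And>n. real n * y (Suc n) \<le> real (Suc n) * y n"
proof -
  \<comment> \<open>\<open>B\<close> continues \<open>A (n - 1)\<close> by 0 at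
    \<open>n = 0\<close>, so that the three convolution identities below run over all indices up to
    \<open>n\<close>.\<close>
  define B where "B = (\<lambda>n. if n = 0 then 0 else A (n - 1))"
  have y: "y n = B n / A n" for n by (simp add: y_def B_def)
  have n_A: "real n * A n = (\<Sum>a\<le>n. X (Suc a) * B (n - a))" for n
  proof (cases n)
    case (Suc m)
    have "(\<Sum>a\<le>n. X (Suc a) * B (n - a)) = (\<Sum>a\<le>m. X (Suc a) * B (n - a))"
      by (simp add: Suc B_def)
    also have "\<dots> = (\<Sum>a\<le>m. X (Suc a) * A (m - a))"
      by (intro sum.cong) (auto simp: Suc B_def)
    finally show ?thesis using rec[of m] Suc by simp
  qed (simp add: B_def)
  have Suc_A: "real (Suc n) * A n = (\<Sum>b\<le>n. X b * A (n - b))" for n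
  proof (cases n)
    case (Suc m)
    have "(\<Sum>b\<le>n. X b * A (n - b)) = A n + (\<Sum>d\<le>m. X (Suc d) * A (m - d))"
      unfolding Suc by (subst sum.atMost_Suc_shift) (simp add: X0)
    then show ?thesis using rec[of m] Suc by (simp add: algebra_simps)
  qed (simp add: X0)
  have n_B: "real n * B n = (\<Sum>b\<le>n. X b * B (n - b))" for n
  proof (cases n)
    case (Suc m)
    have "(\<Sum>b\<le>n. X b * B (n - b)) = (\<Sum>b\<le>m. X b * B (n - b))"
      by (simp add: Suc B_def)
    also have "\<dots> = (\<Sum>b\<le>m. X b * A (m - b))"
      by (intro sum.cong) (auto simp: Suc B_def)
    finally show ?thesis using Suc_A[of m] Suc by (simp add: B_def)
  qed (simp add: B_def)
  \<comment> \<open>The minor \<open>D a b\<close> involves \<open>y\<close> only at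
    \<open>n - a\<close> and \<open>n - b\<close>, so monotonicity up to \<open>n\<close> decides
    its sign; log-concavity of \<open>X\<close> gives the other minor the same sign.\<close>
  have step: "y n \<le> y (Suc n)" if IH: "\<And>k l. k \<le> l \<Longrightarrow> l \<le> n \<Longrightarrow> y k \<le> y l" for n
  proof (cases "n = 0")
    case True
    then show ?thesis using A_pos[of 0] A_pos[of 1] by (simp add: y_def)
  next
    case False
    define D where "D = (\<lambda>a b. B (n - a) * A (n - b) - A (n - a) * B (n - b))"
    define S where "S = (\<Sum>a\<le>n. \<Sum>b\<le>n. X (Suc a) * X b * D a b)"
    have "S = (\<Sum>a\<le>n. \<Sum>b\<le>n. (X (Suc a) * B (n - a)) * (X b * A (n - b)))
        - (\<Sum>a\<le>n. \<Sum>b\<le>n. (X (Suc a) * A (n - a)) * (X b * B (n - b)))"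
      unfolding S_def D_def sum_subtractf[symmetric] by (intro sum.cong refl) (simp add: algebra_simps)
    also have "\<dots> = (real n * A n) * (real (Suc n) * A n) - (real (Suc n) * A (Suc n)) * (real n * B n)"
      unfolding sum_product[symmetric] n_A[symmetric] Suc_A[symmetric] n_B[symmetric] rec[symmetric] ..
    finally have S: "S = real n * real (Suc n) * (A n * A n - A (Suc n) * B n)"
      by (simp add: algebra_simps)
    have "S = (\<Sum>a\<le>n. \<Sum>b\<le>n. X (Suc b) * X a * D b a)"
      unfolding S_def by (rule sum.swap)
    then have "2 * S = (\<Sum>a\<le>n. \<Sum>b\<le>n. X (Suc a) * X b * D a b + X (Suc b) * X a * D b a)"
      by (simp add: S_def sum.distrib)
    also have "\<dots> = (\<Sum>a\<le>n. \<Sum>b\<le>n. (X (Suc a) * X b - X (Suc b) * X a) * D a b)"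
      by (intro sum.cong refl) (simp add: D_def algebra_simps)
    also have "\<dots> \<ge> 0"
    proof (intro sum_nonneg)
      fix a b assume ab: "a \<in> {..n}" "b \<in> {..n}"
      have DX: "D a b = (y (n - a) - y (n - b)) * (A (n - a) * A (n - b))"
        using A_pos[of "n - a"] A_pos[of "n - b"] by (simp add: D_def y field_simps)
      have XX: "X (Suc a) * X b - X (Suc b) * X a = (X (Suc a) / X a - X (Suc b) / X b) * (X a * X b)"
        using X_pos[of a] X_pos[of b] by (simp add: field_simps)
      have "(X (Suc a) / X a - X (Suc b) / X b) * (y (n - a) - y (n - b)) \<ge> 0"
      proof (cases "a \<le> b")
        case True
        then show ?thesis using antimonoD[OF logconcave True] IH[of "n - b" "n - a"]
          by (intro mult_nonneg_nonneg) auto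
      next
        case False
        then show ?thesis using antimonoD[OF logconcave, of b a] IH[of "n - a" "n - b"]
          by (intro mult_nonpos_nonpos) auto
      qed
      then have "0 \<le> ((X (Suc a) / X a - X (Suc b) / X b) * (y (n - a) - y (n - b)))
          * ((X a * X b) * (A (n - a) * A (n - b)))"
        by (rule mult_nonneg_nonneg) (intro mult_nonneg_nonneg less_imp_le X_pos A_pos)
      then show "0 \<le> (X (Suc a) * X b - X (Suc b) * X a) * D a b"
        unfolding DX XX by (simp only: mult_ac)
    qed
    finally have "0 \<le> real n * real (Suc n) * (A n * A n - A (Suc n) * B n)"
      by (simp add: S)
    moreover have "0 < real n * real (Suc n)"
      using False by (intro mult_pos_pos) auto
    ultimately have "A (Suc n) * B n \<le> A n * A n"
      by (smt (verit) mult_pos_neg)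
    then show ?thesis
      using A_pos[of n] A_pos[of "Suc n"] by (simp add: y field_simps B_def)
  qed
  have "\<forall>k l. k \<le> l \<longrightarrow> l \<le> n \<longrightarrow> y k \<le> y l" for n
  proof (induction n)
    case (Suc n)
    then show ?case
      using step[of n] by (metis le_Suc_eq order_trans order_refl)
  qed auto
  then show mono: "incseq y" by (auto simp: incseq_def)
  \<comment> \<open>With \<open>y\<close> monotone, each minor
    \<open>A (n - a) * B n - B (n - a) * A n\<close> is already nonnegative by itself. Summed
    against \<open>X (Suc a)\<close> this is the log-convexity of
    \<open>fact n * A n\<close>.\<close>
  show "real n * y (Suc n) \<le> real (Suc n) * y n" for n
  proof -
    have "0 \<le> (\<Sum>a\<le>n. X (Suc a) * (A (n - a) * B n - B (n - a) * A n))"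
    proof (intro sum_nonneg mult_nonneg_nonneg)
      fix a show "0 \<le> A (n - a) * B n - B (n - a) * A n"
        using incseqD[OF mono, of "n - a" n] A_pos[of "n - a"] A_pos[of n]
        by (simp add: y field_simps)
    qed (use X_pos less_imp_le in auto)
    also have "\<dots> = (\<Sum>a\<le>n. X (Suc a) * A (n - a)) * B n - (\<Sum>a\<le>n. X (Suc a) * B (n - a)) * A n"
      unfolding sum_distrib_right sum_subtractf[symmetric]
      by (intro sum.cong refl) (simp add: algebra_simps)
    also have "\<dots> = real (Suc n) * A (Suc n) * B n - real n * A n * A n"
      unfolding n_A[symmetric] rec[symmetric] ..
    finally have "real n * A n * A n \<le> real (Suc n) * B n * A (Suc n)"
      by (simp add: algebra_simps)
    then show ?thesis
      using A_pos[of n] A_pos[of "Suc n"] by (simp add: y field_simps B_def)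
  qed
qed

section \<open>Slow variation of the weight ratios\<close>

definition weight_ratio :: "real \<Rightarrow> nat \<Rightarrow> real" where
  "weight_ratio r n = real n * cluster_weight r (n - 1) / cluster_weight r n"

lemma weight_ratio_0 [simp]: "weight_ratio r 0 = 0"
  by (simp add: weight_ratio_def)

lemma weight_ratio_pos: "r > 0 \<Longrightarrow> n > 0 \<Longrightarrow> weight_ratio r n > 0"
  by (simp add: weight_ratio_def cluster_weight_pos)

text \<open>Dividing the recursion of \<open>cluster_weight\<close> by \<open>fact n\<close> gives a
  recurrence of the required kind with \<open>X n = r ^ (n choose 2) / fact (n - 1)\<close>,
  preceded by \<open>X 0 = 1\<close>. Its quotients 1, \<open>r\<close>,
  \<open>r\<^sup>2 / 2\<close>, \<open>r ^ 3 / 3\<close> and so on decrease.\<close>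

lemma
  assumes "0 < r" "r < 1"
  shows incseq_weight_ratio: "incseq (weight_ratio r)"
    and weight_ratio_Suc_le: "real n * weight_ratio r (Suc n) \<le> real (Suc n) * weight_ratio r n"
proof -
  define A where "A = (\<lambda>n. cluster_weight r n / fact n)"
  define X where "X = (\<lambda>n. if n = 0 then 1 else r ^ (n choose 2) / fact (n - 1))"
  have wr: "weight_ratio r = (\<lambda>n. if n = 0 then 0 else A (n - 1) / A n)"
  proof
    show "weight_ratio r n = (if n = 0 then 0 else A (n - 1) / A n)" for n
      using cluster_weight_pos[OF assms(1), of n] by (cases n) (auto simp: weight_ratio_def A_def field_simps)
  qed
  have rec: "real (Suc n) * A (Suc n) = (\<Sum>d\<le>n. X (Suc d) * A (n - d))" for n
  proof -
    have "real (Suc n) * A (Suc n) = cluster_weight r (Suc n) / fact n"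
      by (simp add: A_def del: of_nat_Suc)
    also have "\<dots> = (\<Sum>d\<le>n. real (n choose d) / fact n * r ^ (Suc d choose 2) * cluster_weight r (n - d))"
      by (simp add: cluster_weight.simps(2) sum_divide_distrib)
    also have "\<dots> = (\<Sum>d\<le>n. X (Suc d) * A (n - d))"
      by (intro sum.cong) (auto simp: binomial_fact X_def A_def)
    finally show ?thesis .
  qed
  have ratio: "X (Suc n) / X n = (if n = 0 then 1 else r ^ n / n)" for n
  proof (cases n)
    case (Suc m)
    have "(Suc n choose 2) = (n choose 2) + n" by (simp add: numeral_2_eq_2)
    then show ?thesis
      using assms by (simp add: X_def power_add Suc del: binomial_Suc_Suc of_nat_Suc)
  qed (auto simp: X_def numeral_2_eq_2)
  have "X (Suc (Suc n)) / X (Suc n) \<le> X (Suc n) / X n" for n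
    unfolding ratio using assms power_decreasing[of n "Suc n" r]
    by (auto intro!: frac_le)
  then have anti: "antimono (\<lambda>n. X (Suc n) / X n)"
    by (rule decseq_SucI)
  have pos: "A n > 0" "X n > 0" for n
    using assms by (auto simp: A_def X_def cluster_weight_pos)
  note * = ratio_mono_of_exp_recurrence[of A X, OF pos _ rec anti]
  show "incseq (weight_ratio r)" unfolding wr by (rule *(1)) (simp add: X_def)
  show "real n * weight_ratio r (Suc n) \<le> real (Suc n) * weight_ratio r n"
    unfolding wr by (rule *(2)) (simp add: X_def)
qed

text \<open>The quotient \<open>weight_ratio r m / m\<close> decreases, and this iterates. With
  monotonicity, \<open>weight_ratio r (n - k)\<close> lies between \<open>1 - k / n\<close> and 1
  times \<open>weight_ratio r n\<close>.\<close>

lemma weight_ratio_diff_ge: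
  assumes "0 < r" "r < 1" "k \<le> n" "n > 0"
  shows "(1 - real k / real n) * weight_ratio r n \<le> weight_ratio r (n - k)"
  using assms(3)
proof (induction k)
  case (Suc k)
  define m where "m = n - Suc k"
  have m: "n - k = Suc m" "real m = real n - real k - 1" using Suc.prems by (auto simp: m_def)
  have "(real n - real k) * weight_ratio r n \<le> real n * weight_ratio r (Suc m)"
    using Suc assms by (simp add: m field_simps)
  then have "real m * ((real n - real k) * weight_ratio r n) \<le> real n * (real m * weight_ratio r (Suc m))"
    unfolding mult.left_commute[of "real n"] by (rule mult_left_mono) simp
  also have "\<dots> \<le> real n * (real (Suc m) * weight_ratio r m)"
    using weight_ratio_Suc_le[OF assms(1,2), of m] by (intro mult_left_mono) auto
  also have "real (Suc m) = real n - real k" using m by simp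
  finally have "(real n - real k) * (real m * weight_ratio r n) \<le> (real n - real k) * (real n * weight_ratio r m)"
    by (simp add: algebra_simps)
  then have "real m * weight_ratio r n \<le> real n * weight_ratio r m"
    using m by (subst (asm) mult_le_cancel_left_pos) auto
  then show ?case using assms m unfolding m_def[symmetric] by (simp add: field_simps)
qed (use assms in auto)

lemma prod_weight_ratio:
  assumes "r > 0" "d < n"
  shows "(\<Prod>i\<le>d. weight_ratio r (n - i)) =
    fact n / fact (n - Suc d) * cluster_weight r (n - Suc d) / cluster_weight r n"
  using assms(2)
proof (induction d)
  case 0
  then show ?case by (cases n) (auto simp: weight_ratio_def)
next
  case (Suc d)
  have "fact (n - Suc d) = real (n - Suc d) * (fact (n - Suc (Suc d)) :: real)"
    using Suc.prems by (subst fact_reduce) auto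
  with Suc show ?case
    using cluster_weight_pos[OF assms(1), of "n - Suc d"] by (simp add: weight_ratio_def)
qed

text \<open>The quotient of total weights telescopes into ratios. The formula covers every
  \<open>d\<close>: for \<open>d \<ge> n\<close> the factor \<open>weight_ratio r 0 = 0\<close>
  occurs.\<close>

lemma pmf_degree_pmf_weight_ratio:
  assumes "0 < p" "p < 1" "n > 0"
  defines "r \<equiv> p / (1 - p)"
  shows "pmf (degree_pmf n p) d =
    r ^ (Suc d choose 2) / (fact d * real n) * (\<Prod>i\<le>d. weight_ratio r (n - i))"
proof -
  obtain m where m: "n = Suc m" using assms by (cases n) auto
  have r: "r > 0" using assms by simp
  show ?thesis
  proof (cases "d \<le> m")
    case True
    then have "(\<Prod>i\<le>d. weight_ratio r (n - i)) = fact n / fact (m - d) * cluster_weight r (m - d) / cluster_weight r n"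
      using r m by (subst prod_weight_ratio) auto
    then show ?thesis
      using True pmf_degree_pmf[OF assms(1,2), of m d, folded r_def]
      by (simp add: m binomial_fact mult_ac del: of_nat_Suc)
  next
    case False
    then have "(\<Prod>i\<le>d. weight_ratio r (n - i)) = 0"
      using m by (intro prod_zero) (auto intro!: bexI[of _ n])
    moreover have "pmf (degree_pmf n p) d = 0"
      using False pmf_degree_pmf[OF assms(1,2), of m d, folded r_def] by (simp add: m)
    ultimately show ?thesis by simp
  qed
qed

section \<open>The centre of the degree law and its fractional part\<close>

definition degree_center :: "real \<Rightarrow> nat \<Rightarrow> real" where
  "degree_center \<rho> n = sqrt (2 * ln (real n) / \<rho>) - 1 - 1 / \<rho>"

text \<open>Solving the definition for \<open>ln n\<close> yields the exponent against which the
  normalisation arguments compare the weights.\<close>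

lemma ln_eq_degree_center:
  assumes "\<rho> > 0" "n > 0"
  shows "ln (real n) = \<rho> / 2 * (degree_center \<rho> n + 1)\<^sup>2 + (degree_center \<rho> n + 1) + 1 / (2 * \<rho>)"
proof -
  define s where "s = sqrt (2 * ln (real n) / \<rho>)"
  have "s\<^sup>2 = 2 * ln (real n) / \<rho>" using assms by (simp add: s_def)
  then have "ln (real n) = \<rho> / 2 * s\<^sup>2" using assms by (simp add: field_simps)
  also have "s = (degree_center \<rho> n + 1) + 1 / \<rho>" by (simp add: degree_center_def s_def)
  also have "\<rho> / 2 * ((degree_center \<rho> n + 1) + 1 / \<rho>)\<^sup>2 =
      \<rho> / 2 * (degree_center \<rho> n + 1)\<^sup>2 + (degree_center \<rho> n + 1) + 1 / (2 * \<rho>)"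
    using assms by (simp add: power2_eq_square field_simps)
  finally show ?thesis .
qed

lemma filterlim_degree_center: "\<rho> > 0 \<Longrightarrow> filterlim (degree_center \<rho>) at_top sequentially"
  unfolding degree_center_def by real_asymp

lemma degree_center_sublinear: "\<rho> > 0 \<Longrightarrow> (\<lambda>n. degree_center \<rho> n / real n) \<longlonglongrightarrow> 0"
  unfolding degree_center_def by real_asymp

text \<open>At the real point \<open>E k\<close> the centre equals \<open>k + a\<close>. Rounding up
  moves it by o(1), as it varies slowly, and never below \<open>k + a\<close>, so the floor is
  eventually \<open>k\<close> even if \<open>a = 0\<close>.\<close>

lemma exists_degree_center_subsequence:
  assumes rho: "\<rho> > 0" and a: "0 \<le> a" "a < 1"
  obtains s :: "nat \<Rightarrow> nat" where "strict_mono s"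
    "(\<lambda>k. degree_center \<rho> (s k) - real_of_int \<lfloor>degree_center \<rho> (s k)\<rfloor>) \<longlonglongrightarrow> a"
proof -
  define E where "E = (\<lambda>k. exp (\<rho> / 2 * (real k + a + 1 + 1 / \<rho>)\<^sup>2))"
  define s where "s = (\<lambda>k. nat \<lceil>E k\<rceil>)"
  have E1: "E k \<ge> 1" for k using rho by (simp add: E_def)
  \<comment> \<open>Increments of at least 1 make the ceilings strictly increasing.\<close>
  have E_Suc: "E (Suc k) \<ge> E k + 1" for k
  proof -
    have "\<rho> / 2 * (real (Suc k) + a + 1 + 1 / \<rho>)\<^sup>2 = \<rho> / 2 * (real k + a + 1 + 1 / \<rho>)\<^sup>2 + \<rho> * (real k + a + 3 / 2) + 1"
      using rho by (simp add: power2_eq_square field_simps)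
    moreover have "\<rho> * (real k + a + 3 / 2) \<ge> 0" using a rho by simp
    ultimately have "E (Suc k) \<ge> exp (\<rho> / 2 * (real k + a + 1 + 1 / \<rho>)\<^sup>2 + 1)"
      unfolding E_def by simp
    also have "exp (\<rho> / 2 * (real k + a + 1 + 1 / \<rho>)\<^sup>2 + 1) = E k * exp 1" by (simp add: E_def exp_add)
    also have "\<dots> \<ge> E k * 2" using E1[of k] exp_ge_add_one_self[of 1] by (intro mult_left_mono) auto
    finally show ?thesis using E1[of k] by linarith
  qed
  have mono: "strict_mono s"
    unfolding strict_mono_Suc_iff
  proof
    fix k
    have "\<lceil>E k\<rceil> + 1 \<le> \<lceil>E (Suc k)\<rceil>" "\<lceil>E k\<rceil> \<ge> 1" using E_Suc[of k] E1[of k] by linarith+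
    then show "s k < s (Suc k)" unfolding s_def by (subst nat_less_eq_zless) linarith+
  qed
  have s_bounds: "E k \<le> real (s k)" "real (s k) \<le> E k + 1" for k
    using E1[of k] unfolding s_def by linarith+
  define H where "H = (\<lambda>x. sqrt (2 * ln x / \<rho>) - 1 - 1 / \<rho>)"
  have H: "degree_center \<rho> n = H (real n)" for n by (simp add: H_def degree_center_def)
  have H_mono: "H x \<le> H y" if "0 < x" "x \<le> y" for x y
    using that rho by (simp add: H_def divide_right_mono)
  have HE: "H (E k) = real k + a" for k
    using rho a by (simp add: H_def E_def)
  have lower: "real k + a \<le> degree_center \<rho> (s k)" for k
    unfolding H HE[symmetric] using s_bounds E1[of k] by (intro H_mono) auto
  have upper: "degree_center \<rho> (s k) - real k \<le> H (E k + 1) - H (E k) + a" for k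
    using H_mono[of "real (s k)" "E k + 1"] s_bounds[of k] E1[of k] HE[of k] by (simp add: H)
  have "(\<lambda>k. H (E k + 1) - H (E k)) \<longlonglongrightarrow> 0"
  proof (rule filterlim_compose[of "\<lambda>x. H (x + 1) - H x"])
    show "((\<lambda>x. H (x + 1) - H x) \<longlongrightarrow> 0) at_top" unfolding H_def using rho by real_asymp
    have "real k \<le> E k" for k
    proof (induction k)
      case (Suc k)
      then show ?case using E_Suc[of k] by simp
    qed (simp add: E_def)
    then show "filterlim E at_top sequentially"
      by (intro filterlim_at_top_mono[OF filterlim_real_sequentially] always_eventually allI)
  qed
  then have step: "(\<lambda>k. H (E k + 1) - H (E k) + a) \<longlonglongrightarrow> 0 + a" by (intro tendsto_add tendsto_const)
  have lim: "(\<lambda>k. degree_center \<rho> (s k) - real k) \<longlonglongrightarrow> a"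
  proof (rule tendsto_sandwich[rotated 2])
    show "(\<lambda>k. a) \<longlonglongrightarrow> a" by simp
    show "(\<lambda>k. H (E k + 1) - H (E k) + a) \<longlonglongrightarrow> a" using step by simp
    show "eventually (\<lambda>k. a \<le> degree_center \<rho> (s k) - real k) sequentially"
    proof (intro always_eventually allI)
      show "a \<le> degree_center \<rho> (s k) - real k" for k using lower[of k] by linarith
    qed
    show "eventually (\<lambda>k. degree_center \<rho> (s k) - real k \<le> H (E k + 1) - H (E k) + a) sequentially"
      by (intro always_eventually allI upper)
  qed
  have "eventually (\<lambda>k. degree_center \<rho> (s k) - real k < 1) sequentially"
    using a by (intro order_tendstoD(2)[OF lim])
  then have "eventually (\<lambda>k. degree_center \<rho> (s k) - real k = degree_center \<rho> (s k) - real_of_int \<lfloor>degree_center \<rho> (s k)\<rfloor>) sequentially"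
  proof eventually_elim
    case (elim k)
    have "\<lfloor>degree_center \<rho> (s k)\<rfloor> = int k" using elim lower[of k] a by (intro floor_unique) auto
    then show ?case by simp
  qed
  with lim have "(\<lambda>k. degree_center \<rho> (s k) - real_of_int \<lfloor>degree_center \<rho> (s k)\<rfloor>) \<longlonglongrightarrow> a"
    by (rule Lim_transform_eventually)
  with mono show ?thesis by (rule that)
qed

lemma summable_on_power_nat_abs:
  fixes q :: real
  assumes "0 \<le> q" "q < 1"
  shows "(\<lambda>d::int. q ^ nat \<bar>d\<bar>) summable_on UNIV"
proof -
  have geom: "(\<lambda>n::nat. q ^ n) summable_on UNIV"
    using assms by (intro norm_summable_imp_summable_on) (simp add: summable_geometric)
  have "(\<lambda>d::int. q ^ nat \<bar>d\<bar>) summable_on range int"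
    using geom by (subst summable_on_reindex) (auto simp: o_def)
  moreover have "(\<lambda>d::int. q ^ nat \<bar>d\<bar>) summable_on range (\<lambda>n. - int n)"
    using geom by (subst summable_on_reindex) (auto simp: o_def inj_on_def)
  ultimately have "(\<lambda>d::int. q ^ nat \<bar>d\<bar>) summable_on (range int \<union> range (\<lambda>n. - int n))"
    by (rule summable_on_union)
  moreover have "range int \<union> range (\<lambda>n. - int n) = UNIV"
  proof (intro equalityI subsetI UNIV_I)
    fix x :: int
    show "x \<in> range int \<union> range (\<lambda>n. - int n)"
      by (cases x rule: int_cases2) auto
  qed
  ultimately show ?thesis by simp
qed

text \<open>One-sided Stirling estimate, coarse by a multiple of \<open>ln d\<close>. The form
  \<open>(d + 1) * ln d\<close> suits \<open>weight_ratio_upper\<close>, where the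
  \<open>d + 1\<close> factors \<open>h\<close> cancel it.\<close>

lemma ln_fact_le:
  assumes "d > 0"
  shows "ln (fact d :: real) \<le> (real d + 1) * ln (real d) - real d + 1"
  using assms
proof (induction d rule: nat_induct_non_zero)
  case (Suc d)
  have "- ln (1 + - 1 / (real d + 1)) \<ge> 1 / (real d + 1)"
    using ln_add_one_self_le_self2[of "- 1 / (real d + 1)"] Suc by (simp add: field_simps)
  moreover have "1 + - 1 / (real d + 1) = real d / (real d + 1)" by (simp add: field_simps)
  ultimately have "1 / (real d + 1) \<le> ln (real d + 1) - ln (real d)"
    using Suc by (simp add: ln_div)
  then have "(real d + 1) * (1 / (real d + 1)) \<le> (real d + 1) * (ln (real d + 1) - ln (real d))"
    by (intro mult_left_mono) auto
  then have "1 \<le> (real d + 1) * (ln (real d + 1) - ln (real d))" by simp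
  moreover have "ln (fact (Suc d) :: real) = ln (real d + 1) + ln (fact d)"
    by (simp add: ln_mult add.commute)
  ultimately show ?case using Suc by (simp add: algebra_simps)
qed simp

lemma power_choose_two:
  assumes "r > 0"
  shows "r ^ (Suc d choose 2) = exp (ln r * (real d * (real d + 1) / 2))"
proof -
  have "real (Suc d choose 2) = real d * (real d + 1) / 2"
    by (induction d) (auto simp: numeral_2_eq_2 field_simps)
  then show ?thesis using assms
    by (simp add: powr_realpow[symmetric] powr_def mult.commute)
qed

section \<open>Locating the weight ratio by normalisation\<close>

context
  fixes p r \<rho> :: real
  assumes p: "0 < p" "p < 1 / 2"
  defines "r \<equiv> p / (1 - p)"
  defines "\<rho> \<equiv> ln (1 - p) - ln p"
begin

lemma subcritical: "0 < r" "r < 1" "\<rho> > 0" "ln r = - \<rho>" "r = exp (- \<rho>)"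
proof -
  show "0 < r" "r < 1" using p by (auto simp: r_def field_simps)
  show *: "ln r = - \<rho>" using p by (simp add: r_def \<rho>_def ln_div)
  show "\<rho> > 0" using p by (simp add: \<rho>_def)
  show "r = exp (- \<rho>)" using * \<open>0 < r\<close> by (metis exp_ln)
qed

lemma pmf_degree:
  "n > 0 \<Longrightarrow> pmf (degree_pmf n p) d =
    r ^ (Suc d choose 2) / (fact d * real n) * (\<Prod>i\<le>d. weight_ratio r (n - i))"
  unfolding r_def using p by (intro pmf_degree_pmf_weight_ratio) auto

lemma set_degree_pmf: "n > 0 \<Longrightarrow> set_pmf (degree_pmf n p) \<subseteq> {..<n}"
proof
  fix d assume n: "n > 0" and d: "d \<in> set_pmf (degree_pmf n p)"
  show "d \<in> {..<n}"
  proof (rule ccontr)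
    assume "d \<notin> {..<n}"
    then have "(\<Prod>i\<le>d. weight_ratio r (n - i)) = 0"
      by (intro prod_zero) (auto intro!: bexI[of _ n])
    then show False using d n by (simp add: set_pmf_iff pmf_degree)
  qed
qed

text \<open>If the ratio is too large, the single probability at \<open>d\<close>, the floor of
  \<open>h\<close>, threatens to exceed 1. Half of \<open>\<eta>\<close> absorbs the drop from
  \<open>weight_ratio r n\<close> to \<open>weight_ratio r (n - i)\<close>; the other half leaves a
  term linear in \<open>h\<close> against a constant, which fails for large
  \<open>n\<close>.\<close>

lemma weight_ratio_upper:
  assumes n: "n > 0" and \<eta>: "\<eta> > 0"
  defines "h \<equiv> degree_center \<rho> n"
  assumes h: "h \<ge> 1" "h \<le> real n" "exp (- \<rho> * \<eta> / 2) \<le> 1 - h / real n"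
    and wr: "weight_ratio r n \<ge> exp (\<rho> * (h + 1 / 2 + \<eta>)) * h"
  shows "\<rho> * \<eta> / 2 * h \<le> \<rho> / 2 + 3 + 1 / (2 * \<rho>)"
proof -
  note rr = subcritical
  define d where "d = nat \<lfloor>h\<rfloor>"
  have d: "real d \<le> h" "h < real d + 1" "d \<ge> 1" using h by (auto simp: d_def le_nat_iff)
  define Y where "Y = exp (\<rho> * (h + 1 / 2 + \<eta> / 2)) * h"
  have Y: "Y > 0" "ln Y = \<rho> * (h + 1 / 2 + \<eta> / 2) + ln h"
    using h by (auto simp: Y_def ln_mult)
  have "Y \<le> weight_ratio r (n - i)" if "i \<le> d" for i
  proof -
    have "Y = exp (- \<rho> * \<eta> / 2) * (exp (\<rho> * (h + 1 / 2 + \<eta>)) * h)"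
      by (simp add: Y_def exp_add[symmetric] algebra_simps)
    also have "\<dots> \<le> (1 - real i / real n) * weight_ratio r n"
    proof (intro mult_mono wr)
      have "real i / real n \<le> h / real n" using that d by (intro divide_right_mono) auto
      then show "exp (- \<rho> * \<eta> / 2) \<le> 1 - real i / real n" using h by simp
      then show "0 \<le> 1 - real i / real n" using order_trans[OF exp_ge_zero] by blast
    qed (use h in auto)
    also have "real d \<le> real n" using h d by linarith
    then have "(1 - real i / real n) * weight_ratio r n \<le> weight_ratio r (n - i)"
      using that n rr by (intro weight_ratio_diff_ge) auto
    finally show ?thesis .
  qed
  then have "(\<Prod>i\<le>d. Y) \<le> (\<Prod>i\<le>d. weight_ratio r (n - i))"
    using Y by (intro prod_mono) auto
  then have "r ^ (Suc d choose 2) / (fact d * real n) * Y ^ Suc d \<le> pmf (degree_pmf n p) d"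
    unfolding pmf_degree[OF n] using rr by (intro mult_left_mono) auto
  also have "\<dots> \<le> 1" by (rule pmf_le_1)
  finally have "r ^ (Suc d choose 2) * Y ^ Suc d \<le> fact d * real n"
    using n by (simp add: field_simps)
  then have "ln (r ^ (Suc d choose 2) * Y ^ Suc d) \<le> ln (fact d * real n)"
    using rr Y by (subst ln_le_cancel_iff) (auto simp: n)
  then have "- \<rho> * (real d * (real d + 1) / 2) + (real d + 1) * (\<rho> * (h + 1 / 2 + \<eta> / 2) + ln h) \<le>
      ln (fact d) + ln (real n)"
    using n rr Y by (simp add: ln_mult power_choose_two ln_realpow add.commute[of 1 "real d"] del: power_Suc binomial_Suc_Suc)
  also have "ln (fact d) \<le> (real d + 1) * ln (real d) - real d + 1"
    using d by (intro ln_fact_le) auto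
  also have "(real d + 1) * ln (real d) \<le> (real d + 1) * ln h"
    using d by (intro mult_left_mono) auto
  also have "ln (real n) = \<rho> / 2 * (h + 1)\<^sup>2 + (h + 1) + 1 / (2 * \<rho>)"
    unfolding h_def using rr n by (intro ln_eq_degree_center) auto
  finally have *: "\<rho> / 2 * ((2 * h + 1 - real d) * (real d + 1)) + \<rho> * \<eta> / 2 * (real d + 1) \<le>
      \<rho> / 2 * (h + 1)\<^sup>2 + (h - real d + 2) + 1 / (2 * \<rho>)"
    by (simp add: algebra_simps add_divide_distrib diff_divide_distrib)
  \<comment> \<open>Rounding \<open>h\<close> down to \<open>d\<close> costs at most 1 next to
    \<open>(h + 1)\<^sup>2\<close>.\<close>
  have "(2 * h + 1 - real d) * (real d + 1) = (h + 1)\<^sup>2 - (h - real d)\<^sup>2"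
    by (simp add: power2_eq_square algebra_simps)
  moreover have "(h - real d)\<^sup>2 \<le> 1" using d by (intro power_le_one) auto
  ultimately have "\<rho> / 2 * ((h + 1)\<^sup>2 - 1) \<le> \<rho> / 2 * ((2 * h + 1 - real d) * (real d + 1))"
    using rr by (intro mult_left_mono) auto
  moreover have "\<rho> * \<eta> / 2 * h \<le> \<rho> * \<eta> / 2 * (real d + 1)"
    using d rr \<eta> by (intro mult_left_mono) auto
  ultimately show ?thesis using * d by (simp add: algebra_simps add_divide_distrib diff_divide_distrib)
qed

text \<open>If the ratio is too small, the total mass threatens to fall below 1. The weights are
  compared with those centred at \<open>g = h - \<eta>\<close>, each at most
  \<open>M * q ^ d\<close>; \<open>h ^ d / fact d \<le> exp h\<close> takes the place of Stirling's
  formula.\<close>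

lemma weight_ratio_lower:
  assumes n: "n > 0" and \<eta>: "\<eta> > 0"
  defines "h \<equiv> degree_center \<rho> n"
  assumes h: "h \<ge> 1"
    and wr: "weight_ratio r n \<le> exp (\<rho> * (h + 1 / 2 - \<eta>)) * h"
  shows "\<rho> * \<eta> / 2 * h \<le> ln h + \<rho> * \<eta>\<^sup>2 / 8 - ln (1 - exp (- \<rho> * \<eta> / 2))"
proof -
  note rr = subcritical
  define g where "g = h - \<eta>"
  define q where "q = exp (- \<rho> * \<eta> / 2)"
  have q: "0 < q" "q < 1" using rr \<eta> by (auto simp: q_def)
  define M where "M = exp (ln h + h + \<rho> / 2 * (g + 1)\<^sup>2 + \<rho> * \<eta> / 2 * g + \<rho> * \<eta>\<^sup>2 / 8)"
  define Y where "Y = exp (\<rho> * (g + 1 / 2)) * h"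
  have Y: "Y > 0" using h by (auto simp: Y_def)
  have term_le: "r ^ (Suc d choose 2) / fact d * (\<Prod>i\<le>d. weight_ratio r (n - i)) \<le> M * q ^ d" for d
  proof -
    have "(\<Prod>i\<le>d. weight_ratio r (n - i)) \<le> (\<Prod>i\<le>d. Y)"
    proof (intro prod_mono conjI)
      fix i
      show "0 \<le> weight_ratio r (n - i)"
        using weight_ratio_pos[of r "n - i"] rr by (cases "n - i") auto
      have "weight_ratio r (n - i) \<le> weight_ratio r n"
        using rr by (intro incseqD[OF incseq_weight_ratio]) auto
      also have "\<dots> \<le> Y" using wr by (simp add: Y_def g_def algebra_simps)
      finally show "weight_ratio r (n - i) \<le> Y" .
    qed
    then have "r ^ (Suc d choose 2) / fact d * (\<Prod>i\<le>d. weight_ratio r (n - i)) \<le>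
        r ^ (Suc d choose 2) / fact d * (\<Prod>i\<le>d. Y)"
      using rr by (intro mult_left_mono) auto
    also have "(\<Prod>i\<le>d. Y) = exp (real (Suc d) * (\<rho> * (g + 1 / 2))) * h ^ Suc d"
      by (simp only: prod_constant card_atMost Y_def power_mult_distrib exp_of_nat_mult)
    also have "r ^ (Suc d choose 2) / fact d * \<dots> =
        exp (- \<rho> * (real d * (real d + 1) / 2) + real (Suc d) * (\<rho> * (g + 1 / 2))) * h * (h ^ d / fact d)"
      using rr by (simp only: power_choose_two exp_add power_Suc) (simp add: mult_ac)
    also have "\<dots> \<le> exp (- \<rho> * (real d * (real d + 1) / 2) + real (Suc d) * (\<rho> * (g + 1 / 2))) * h * exp h"
      using h by (intro mult_left_mono power_div_fact_le_exp) auto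
    also have "\<dots> = exp (- \<rho> * (real d * (real d + 1) / 2) + real (Suc d) * (\<rho> * (g + 1 / 2)) + ln h + h)"
      using h by (simp add: exp_add)
    also have "\<dots> \<le> exp (ln h + h + \<rho> / 2 * (g + 1)\<^sup>2 + \<rho> * \<eta> / 2 * g + \<rho> * \<eta>\<^sup>2 / 8 + real d * (- \<rho> * \<eta> / 2))"
    proof -
      have "- \<rho> * (real d * (real d + 1) / 2) + real (Suc d) * (\<rho> * (g + 1 / 2)) =
          \<rho> / 2 * (g + 1)\<^sup>2 - \<rho> / 2 * (real d - g)\<^sup>2"
        by (simp add: power2_eq_square field_simps)
      \<comment> \<open>Replacing the square by its tangent of slope \<open>\<eta>\<close> makes the
        Gaussian bound geometric in \<open>d\<close>. The displacement gains about
        \<open>\<rho> * \<eta> * h\<close>, and the tangent gives back half of it.\<close>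
      moreover have "\<rho> / 2 * (real d - g)\<^sup>2 \<ge> \<rho> / 2 * (\<eta> * (real d - g) - \<eta>\<^sup>2 / 4)"
        using zero_le_power2[of "real d - g - \<eta> / 2"] rr
        by (intro mult_left_mono) (auto simp: power2_eq_square algebra_simps)
      moreover have "\<rho> / 2 * (\<eta> * (real d - g) - \<eta>\<^sup>2 / 4) =
          - (real d * (- \<rho> * \<eta> / 2)) - \<rho> * \<eta> / 2 * g - \<rho> * \<eta>\<^sup>2 / 8"
        by (simp add: field_simps)
      ultimately show ?thesis unfolding exp_le_cancel_iff by linarith
    qed
    also have "\<dots> = M * q ^ d"
      by (simp only: M_def q_def exp_add exp_of_nat_mult)
    finally show ?thesis .
  qed
  have "real n = real n * (\<Sum>d\<in>{..<n}. pmf (degree_pmf n p) d)"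
    using set_degree_pmf[OF n] by (subst sum_pmf_eq_1) auto
  also have "\<dots> = (\<Sum>d<n. r ^ (Suc d choose 2) / fact d * (\<Prod>i\<le>d. weight_ratio r (n - i)))"
    unfolding sum_distrib_left pmf_degree[OF n] using n by (intro sum.cong) auto
  also have "\<dots> \<le> (\<Sum>d<n. M * q ^ d)" by (intro sum_mono term_le)
  also have "\<dots> = M * ((1 - q ^ n) / (1 - q))"
    using q by (simp add: sum_distrib_left[symmetric] sum_gp_strict)
  also have "\<dots> \<le> M * (1 / (1 - q))"
    using q by (intro mult_left_mono divide_right_mono) (auto simp: M_def)
  finally have "real n \<le> M / (1 - q)" by simp
  then have "ln (real n) \<le> ln (M / (1 - q))"
    using n q by (subst ln_le_cancel_iff) (auto simp: M_def)
  also have "\<dots> = ln h + h + \<rho> / 2 * (g + 1)\<^sup>2 + \<rho> * \<eta> / 2 * g + \<rho> * \<eta>\<^sup>2 / 8 - ln (1 - q)"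
    using q by (simp add: M_def ln_div)
  also have "ln (real n) = \<rho> / 2 * (h + 1)\<^sup>2 + (h + 1) + 1 / (2 * \<rho>)"
    unfolding h_def using rr n by (intro ln_eq_degree_center) auto
  finally have *: "\<rho> * \<eta> / 2 * h + \<rho> * \<eta> + 1 + 1 / (2 * \<rho>) \<le> ln h + \<rho> * \<eta>\<^sup>2 / 8 - ln (1 - q)"
    by (simp add: g_def power2_eq_square field_simps)
  have "\<rho> * \<eta> > 0" "1 / (2 * \<rho>) > 0" using rr \<eta> by auto
  with * show ?thesis unfolding q_def by linarith
qed

text \<open>Both preceding bounds set a linear function of the centre against one of smaller order,
  so for large \<open>n\<close> neither hypothesis on the ratio can hold. With
  \<open>\<eta> = e / \<rho>\<close> a displacement \<open>\<eta>\<close> of the centre is an error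
  \<open>e\<close> in the logarithm.\<close>

lemma tendsto_ln_weight_ratio:
  "(\<lambda>n. ln (weight_ratio r n) - \<rho> * (degree_center \<rho> n + 1 / 2) - ln (degree_center \<rho> n)) \<longlonglongrightarrow> 0"
proof (rule tendstoI)
  fix e :: real assume e: "e > 0"
  note rr = subcritical
  define \<eta> where "\<eta> = e / \<rho>"
  have \<eta>: "\<eta> > 0" "\<rho> * \<eta> = e" using e rr by (auto simp: \<eta>_def)
  note lim = filterlim_degree_center[OF rr(3)]
  have ev1: "eventually (\<lambda>n. degree_center \<rho> n \<ge> 1) sequentially"
    using lim by (simp add: filterlim_at_top)
  have "eventually (\<lambda>n. degree_center \<rho> n / real n < 1 - exp (- \<rho> * \<eta> / 2)) sequentially"
    using e rr by (intro order_tendstoD(2)[OF degree_center_sublinear]) (auto simp: \<eta>_def)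
  moreover have "eventually (\<lambda>n. \<rho> * \<eta> / 2 * degree_center \<rho> n > \<rho> / 2 + 3 + 1 / (2 * \<rho>)) sequentially"
  proof -
    have "filterlim (\<lambda>x. \<rho> * \<eta> / 2 * x) at_top at_top" unfolding \<eta>(2) using e by real_asymp
    from filterlim_compose[OF this lim] show ?thesis by (simp only: filterlim_at_top_dense)
  qed
  moreover have "eventually (\<lambda>n. \<rho> * \<eta> / 2 * degree_center \<rho> n - ln (degree_center \<rho> n) >
      \<rho> * \<eta>\<^sup>2 / 8 - ln (1 - exp (- \<rho> * \<eta> / 2))) sequentially"
  proof -
    have "filterlim (\<lambda>x. \<rho> * \<eta> / 2 * x - ln x) at_top at_top" unfolding \<eta>(2) using e by real_asymp
    from filterlim_compose[OF this lim] show ?thesis by (simp only: filterlim_at_top_dense)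
  qed
  ultimately show "eventually (\<lambda>n. dist (ln (weight_ratio r n) - \<rho> * (degree_center \<rho> n + 1 / 2)
      - ln (degree_center \<rho> n)) 0 < e) sequentially"
    using ev1 eventually_gt_at_top[of 0]
  proof eventually_elim
    case (elim n)
    define h where "h = degree_center \<rho> n"
    note el = elim[folded h_def]
    have pos: "weight_ratio r n > 0" using rr el by (intro weight_ratio_pos) auto
    have "h < real n"
    proof -
      have "h / real n < 1" using el(1) by (smt (verit) exp_gt_zero)
      then show ?thesis using el by (simp add: field_simps)
    qed
    then have "\<not> weight_ratio r n \<ge> exp (\<rho> * (h + 1 / 2 + \<eta>)) * h"
      using weight_ratio_upper[of n \<eta>, folded h_def] el \<eta> by auto
    then have "ln (weight_ratio r n) < ln (exp (\<rho> * (h + 1 / 2 + \<eta>)) * h)"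
      using pos by (subst ln_less_cancel_iff) (use el in auto)
    then have 1: "ln (weight_ratio r n) < \<rho> * (h + 1 / 2 + \<eta>) + ln h"
      using el by (simp add: ln_mult)
    have "\<not> weight_ratio r n \<le> exp (\<rho> * (h + 1 / 2 - \<eta>)) * h"
      using weight_ratio_lower[of n \<eta>, folded h_def] el \<eta> by auto
    then have "ln (exp (\<rho> * (h + 1 / 2 - \<eta>)) * h) < ln (weight_ratio r n)"
      using pos by (subst ln_less_cancel_iff) (use el in auto)
    then have 2: "\<rho> * (h + 1 / 2 - \<eta>) + ln h < ln (weight_ratio r n)"
      using el by (simp add: ln_mult)
    show ?case using 1 2 \<eta>(2) unfolding h_def by (simp add: dist_real_def algebra_simps abs_less_iff)
  qed
qed

lemma pmf_degree_Suc:
  assumes "n > 0"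
  shows "pmf (degree_pmf n p) (Suc d) =
    r ^ Suc d / real (Suc d) * weight_ratio r (n - Suc d) * pmf (degree_pmf n p) d"
proof -
  have "(Suc (Suc d) choose 2) = (Suc d choose 2) + Suc d" by (simp add: numeral_2_eq_2)
  then have "r ^ (Suc (Suc d) choose 2) = r ^ (Suc d choose 2) * r ^ Suc d"
    by (simp only: power_add)
  then show ?thesis
    unfolding pmf_degree[OF assms] by (simp add: mult_ac del: of_nat_Suc power_Suc binomial_Suc_Suc)
qed

lemma pmf_degree_pos: "d < n \<Longrightarrow> pmf (degree_pmf n p) d > 0"
  using subcritical by (subst pmf_degree) (auto intro!: mult_pos_pos prod_pos divide_pos_pos weight_ratio_pos)

section \<open>Concentration and the discrete Gaussian limit\<close>

definition mode_degree :: "nat \<Rightarrow> nat" where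
  "mode_degree n = nat \<lfloor>degree_center \<rho> n\<rfloor>"

text \<open>Eventually the factors drop below \<open>1 / 2\<close>; the finitely many earlier ones
  go into \<open>C\<close>.\<close>

lemma prod_geometric_decay:
  fixes K q :: real
  assumes "0 < K" "0 < q" "q < 1"
  obtains C where "C > 0" "\<And>j. (\<Prod>i<j. K * q ^ i) \<le> C * (1 / 2) ^ j"
proof -
  define b where "b = (\<lambda>j. \<Prod>i<j. 2 * K * q ^ i)"
  have b_pos: "b j > 0" for j using assms by (auto simp: b_def intro!: prod_pos)
  have "(\<lambda>i. 2 * K * q ^ i) \<longlonglongrightarrow> 0"
    using assms by (auto intro!: tendsto_mult_right_zero LIMSEQ_power_zero)
  then have "eventually (\<lambda>i. 2 * K * q ^ i < 1) sequentially"
    by (rule order_tendstoD) simp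
  then obtain J where J: "\<And>i. i \<ge> J \<Longrightarrow> 2 * K * q ^ i < 1"
    by (auto simp: eventually_sequentially)
  define C where "C = (\<Sum>k\<le>J. b k)"
  have small: "b j \<le> C" if "j \<le> J" for j
    unfolding C_def using that b_pos by (intro member_le_sum) (auto simp: less_imp_le)
  have "b j \<le> C" for j
  proof (induction j)
    case (Suc j)
    show ?case
    proof (cases "Suc j \<le> J")
      case False
      then have "b j * (2 * K * q ^ j) \<le> b j * 1"
        using b_pos[of j] J[of j] by (intro mult_left_mono) auto
      then show ?thesis using Suc by (simp add: b_def)
    qed (rule small)
  qed (use small in auto)
  moreover have "b j = 2 ^ j * (\<Prod>i<j. K * q ^ i)" for j
    by (simp add: b_def prod.distrib power_mult_distrib)
  ultimately have "(\<Prod>i<j. K * q ^ i) \<le> C * (1 / 2) ^ j" for j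
    by (simp add: power_one_over field_simps)
  moreover have "C > 0" using small[of 0] b_pos[of 0] by linarith
  ultimately show ?thesis using that by blast
qed

text \<open>Quotients of successive probabilities, taken away from the mode, are at most
  \<open>K * r ^ i\<close> at distance \<open>i\<close>, uniformly in \<open>n\<close>. The
  resulting summable majorant serves both the mean and the limit law.\<close>

lemma eventually_pmf_degree_decay:
  obtains C where "C > 0"
    "eventually (\<lambda>n. \<forall>d. pmf (degree_pmf n p) d \<le>
       pmf (degree_pmf n p) (mode_degree n) * (C * (1 / 2) ^ nat \<bar>int d - int (mode_degree n)\<bar>)) sequentially"
proof -
  note rr = subcritical
  \<comment> \<open>The 1 is the error allowed in \<open>ln (weight_ratio r n)\<close>,
    \<open>\<rho> / 2\<close> comes from the half-integer shift and the rounding of the centre, and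
    2 from \<open>weight_ratio r n \<le> 2 * weight_ratio r (n - Suc d)\<close> below the
    centre.\<close>
  define K where "K = 2 * exp (\<rho> / 2 + 1)"
  have K: "K > 0" by (simp add: K_def)
  obtain C where C: "C > 0" "\<And>j. (\<Prod>i<j. K * r ^ i) \<le> C * (1 / 2) ^ j"
    using prod_geometric_decay[OF K rr(1,2)] by blast
  have "eventually (\<lambda>n. \<bar>ln (weight_ratio r n) - \<rho> * (degree_center \<rho> n + 1 / 2) - ln (degree_center \<rho> n)\<bar> < 1) sequentially"
    using tendstoD[OF tendsto_ln_weight_ratio, of 1] by (simp add: dist_real_def)
  moreover have "eventually (\<lambda>n. degree_center \<rho> n \<ge> 1) sequentially"
    using filterlim_degree_center[OF rr(3)] by (simp add: filterlim_at_top)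
  moreover have "eventually (\<lambda>n. degree_center \<rho> n / real n < 1 / 2) sequentially"
    by (intro order_tendstoD(2)[OF degree_center_sublinear]) (use rr in auto)
  ultimately have "eventually (\<lambda>n. \<forall>d. pmf (degree_pmf n p) d \<le>
       pmf (degree_pmf n p) (mode_degree n) * (C * (1 / 2) ^ nat \<bar>int d - int (mode_degree n)\<bar>)) sequentially"
    using eventually_gt_at_top[of 0]
  proof eventually_elim
    case (elim n)
    define h where "h = degree_center \<rho> n"
    define f where "f = mode_degree n"
    define T where "T = pmf (degree_pmf n p)"
    note el = elim[folded h_def]
    have f: "real f \<le> h" "h < real f + 1"
      using el(2) by (auto simp: f_def mode_degree_def h_def[symmetric])
    have T_Suc: "T (Suc d) = r ^ Suc d / real (Suc d) * weight_ratio r (n - Suc d) * T d" for d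
      unfolding T_def using el by (intro pmf_degree_Suc) auto
    have T_nonneg: "T d \<ge> 0" for d by (simp add: T_def)
    have wr_pos: "weight_ratio r n > 0" using rr el by (intro weight_ratio_pos) auto
    have up: "T (Suc d) \<le> K * r ^ (d - f) * T d" if d: "d \<ge> f" for d
    proof -
      have "ln (weight_ratio r n) \<le> \<rho> * (h + 1 / 2) + ln h + 1" using el by linarith
      also have "\<rho> * (h + 1 / 2) \<le> \<rho> * (real f + 3 / 2)"
        using f rr by (intro mult_left_mono) auto
      also have "ln h \<le> ln (real (Suc d))"
        using f d el by (subst ln_le_cancel_iff) auto
      finally have "ln (weight_ratio r n) + (real (Suc d) * ln r - ln (real (Suc d))) \<le>
          \<rho> / 2 + 1 + real (d - f) * ln r"
        using d rr by (simp add: of_nat_diff algebra_simps)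
      then have "exp (ln (weight_ratio r n) + (real (Suc d) * ln r - ln (real (Suc d)))) \<le>
          exp (\<rho> / 2 + 1 + real (d - f) * ln r)" by simp
      then have "weight_ratio r n * (r ^ Suc d / real (Suc d)) \<le> exp (\<rho> / 2 + 1) * r ^ (d - f)"
        using wr_pos rr(1) by (simp only: exp_add exp_diff exp_of_nat_mult exp_ln of_nat_0_less_iff zero_less_Suc)
      moreover have "weight_ratio r (n - Suc d) \<le> weight_ratio r n"
        using rr by (intro incseqD[OF incseq_weight_ratio]) auto
      then have "r ^ Suc d / real (Suc d) * weight_ratio r (n - Suc d) \<le> r ^ Suc d / real (Suc d) * weight_ratio r n"
        using rr by (intro mult_left_mono) auto
      moreover have "exp (\<rho> / 2 + 1) * r ^ (d - f) \<le> K * r ^ (d - f)"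
        using rr by (intro mult_right_mono) (auto simp: K_def)
      ultimately have "r ^ Suc d / real (Suc d) * weight_ratio r (n - Suc d) \<le> K * r ^ (d - f)"
        by (simp only: mult.commute)
      then show ?thesis unfolding T_Suc by (intro mult_right_mono T_nonneg)
    qed
    have down: "T d \<le> K * r ^ (f - Suc d) * T (Suc d)" if d: "d < f" for d
    proof -
      have dh: "real (Suc d) \<le> h" using d f by linarith
      have hn: "h < real n / 2" using el by (simp add: field_simps)
      have "1 / 2 \<le> 1 - real (Suc d) / real n"
        using dh hn el by (simp add: field_simps)
      then have "1 / 2 * weight_ratio r n \<le> (1 - real (Suc d) / real n) * weight_ratio r n"
        using wr_pos by (intro mult_right_mono) auto
      also have "\<dots> \<le> weight_ratio r (n - Suc d)"
        using dh hn rr el by (intro weight_ratio_diff_ge) auto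
      finally have wr: "weight_ratio r n \<le> 2 * weight_ratio r (n - Suc d)" by simp
      have "ln (real (Suc d)) \<le> ln h" using dh by (subst ln_le_cancel_iff) auto
      then have *: "\<rho> * (h + 1 / 2) + ln (real (Suc d)) \<le> ln (weight_ratio r n) + 1" using el by linarith
      have **: "\<rho> * real f \<le> \<rho> * h" using f rr by (intro mult_left_mono) auto
      have "- (real (f - Suc d) * ln r) - 1 - \<rho> / 2 \<le>
          ln (weight_ratio r n) + (real (Suc d) * ln r - ln (real (Suc d)))"
      proof -
        have "real (f - Suc d) * ln r = \<rho> * real (Suc d) - \<rho> * real f" "real (Suc d) * ln r = - (\<rho> * real (Suc d))"
          "\<rho> * (h + 1 / 2) = \<rho> * h + \<rho> / 2"
          using d rr by (simp_all add: of_nat_diff algebra_simps)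
        with * ** rr(3) show ?thesis by linarith
      qed
      then have "0 \<le> ln (weight_ratio r n) + (real (Suc d) * ln r - ln (real (Suc d))) + (\<rho> / 2 + 1 + real (f - Suc d) * ln r)"
        by simp
      then have "exp 0 \<le> exp (ln (weight_ratio r n) + (real (Suc d) * ln r - ln (real (Suc d))) + (\<rho> / 2 + 1 + real (f - Suc d) * ln r))"
        by (subst exp_le_cancel_iff)
      then have "1 \<le> weight_ratio r n * (r ^ Suc d / real (Suc d)) * (exp (\<rho> / 2 + 1) * r ^ (f - Suc d))"
        using wr_pos rr(1) by (simp only: exp_zero exp_add exp_diff exp_of_nat_mult exp_ln of_nat_0_less_iff zero_less_Suc)
      also have "\<dots> \<le> (2 * weight_ratio r (n - Suc d)) * (r ^ Suc d / real (Suc d)) * (exp (\<rho> / 2 + 1) * r ^ (f - Suc d))"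
        using rr by (intro mult_right_mono wr) auto
      finally have "1 * T d \<le> (2 * weight_ratio r (n - Suc d)) * (r ^ Suc d / real (Suc d)) * (exp (\<rho> / 2 + 1) * r ^ (f - Suc d)) * T d"
        by (intro mult_right_mono T_nonneg)
      then show ?thesis unfolding T_Suc by (simp add: K_def mult_ac)
    qed
    have up': "T (f + j) \<le> T f * (\<Prod>i<j. K * r ^ i)" for j
    proof (induction j)
      case (Suc j)
      have "T (f + Suc j) \<le> K * r ^ j * T (f + j)" using up[of "f + j"] by simp
      also have "\<dots> \<le> K * r ^ j * (T f * (\<Prod>i<j. K * r ^ i))"
        using K rr by (intro mult_left_mono Suc.IH) auto
      finally show ?case by (simp add: mult_ac)
    qed simp
    have down': "T (f - j) \<le> T f * (\<Prod>i<j. K * r ^ i)" if "j \<le> f" for j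
      using that
    proof (induction j)
      case (Suc j)
      have "T (f - Suc j) \<le> K * r ^ j * T (f - j)"
        using down[of "f - Suc j"] Suc.prems by (simp add: Suc_diff_Suc)
      also have "\<dots> \<le> K * r ^ j * (T f * (\<Prod>i<j. K * r ^ i))"
        using K rr Suc by (intro mult_left_mono Suc.IH) auto
      finally show ?case by (simp add: mult_ac)
    qed simp
    have "T d \<le> T f * (C * (1 / 2) ^ nat \<bar>int d - int f\<bar>)" for d
    proof -
      have "T d \<le> T f * (\<Prod>i<nat \<bar>int d - int f\<bar>. K * r ^ i)"
      proof (cases "d \<ge> f")
        case True
        then show ?thesis using up'[of "d - f"] by (simp add: of_nat_diff[symmetric] del: of_nat_diff)
      next
        case False
        then have "nat \<bar>int d - int f\<bar> = f - d" by linarith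
        then show ?thesis using down'[of "f - d"] False by simp
      qed
      also have "\<dots> \<le> T f * (C * (1 / 2) ^ nat \<bar>int d - int f\<bar>)"
        by (intro mult_left_mono C T_nonneg)
      finally show ?thesis .
    qed
    then show ?case by (simp add: T_def f_def)
  qed
  with C(1) show ?thesis using that by blast
qed

text \<open>The decay bound keeps the mean within O(1) of the centre, whose order is
  \<open>sqrt (ln n)\<close>.\<close>

lemma expectation_degree_bigtheta:
  "(\<lambda>n. measure_pmf.expectation (degree_pmf n p) real) \<in> \<Theta>(\<lambda>n. sqrt (ln (real n)))"
proof -
  note rr = subcritical
  obtain C where C: "C > 0" "eventually (\<lambda>n. \<forall>d. pmf (degree_pmf n p) d \<le>
       pmf (degree_pmf n p) (mode_degree n) * (C * (1 / 2) ^ nat \<bar>int d - int (mode_degree n)\<bar>)) sequentially"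
    using eventually_pmf_degree_decay by blast
  define g where "g = (\<lambda>j. real j * (C * (1 / 2) ^ j))"
  have g: "summable g"
  proof -
    have "summable (\<lambda>j. of_nat j * (1 / 2 :: real) ^ j)"
      by (rule summable_comparison_test_bigo[of "\<lambda>j. (3 / 4) ^ j"]) (simp, real_asymp)
    from summable_mult[OF this, of C] show ?thesis by (simp add: g_def mult_ac)
  qed
  have "eventually (\<lambda>n. norm (measure_pmf.expectation (degree_pmf n p) real - degree_center \<rho> n) \<le> (2 * suminf g + 1) * norm (1 :: real)) sequentially"
    using C(2) eventually_gt_at_top[of 0] filterlim_degree_center[OF rr(3), unfolded filterlim_at_top, rule_format, of 1]
  proof eventually_elim
    case (elim n)
    let ?f = "mode_degree n"
    have set: "set_pmf (degree_pmf n p) \<subseteq> {..<n}" by (rule set_degree_pmf[OF elim(2)])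
    have "measure_pmf.expectation (degree_pmf n p) real = (\<Sum>d<n. real d * pmf (degree_pmf n p) d)"
      using set by (subst integral_measure_pmf_real[of "{..<n}"]) auto
    moreover have "(\<Sum>d<n. pmf (degree_pmf n p) d) = 1"
      using set by (intro sum_pmf_eq_1) auto
    ultimately have "measure_pmf.expectation (degree_pmf n p) real - real ?f =
        (\<Sum>d<n. (real d - real ?f) * pmf (degree_pmf n p) d)"
      by (simp add: left_diff_distrib sum_subtractf sum_distrib_left[symmetric])
    then have "\<bar>measure_pmf.expectation (degree_pmf n p) real - real ?f\<bar> \<le>
        (\<Sum>d<n. \<bar>(real d - real ?f) * pmf (degree_pmf n p) d\<bar>)"
      by (simp only: sum_abs)
    also have "\<dots> \<le> (\<Sum>d<n. g (nat \<bar>int d - int ?f\<bar>))"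
    proof (intro sum_mono)
      fix d
      have "pmf (degree_pmf n p) d \<le> pmf (degree_pmf n p) ?f * (C * (1 / 2) ^ nat \<bar>int d - int ?f\<bar>)"
        using elim(1) by blast
      also have "\<dots> \<le> 1 * (C * (1 / 2) ^ nat \<bar>int d - int ?f\<bar>)"
        using C(1) by (intro mult_right_mono pmf_le_1) auto
      finally have "real (nat \<bar>int d - int ?f\<bar>) * pmf (degree_pmf n p) d \<le> g (nat \<bar>int d - int ?f\<bar>)"
        unfolding g_def by (intro mult_left_mono) auto
      moreover have "real (nat \<bar>int d - int ?f\<bar>) = \<bar>real d - real ?f\<bar>" by simp
      ultimately show "\<bar>(real d - real ?f) * pmf (degree_pmf n p) d\<bar> \<le> g (nat \<bar>int d - int ?f\<bar>)"
        by (simp only: abs_mult abs_of_nonneg[OF pmf_nonneg])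
    qed
    also have "\<dots> \<le> 2 * suminf g"
      using g C(1) by (intro sum_dist_le_suminf) (auto simp: g_def)
    finally have "\<bar>measure_pmf.expectation (degree_pmf n p) real - real ?f\<bar> \<le> 2 * suminf g" .
    moreover have "\<bar>real ?f - degree_center \<rho> n\<bar> \<le> 1"
      using elim(3) unfolding mode_degree_def by linarith
    ultimately show ?case by simp
  qed
  then have "(\<lambda>n. measure_pmf.expectation (degree_pmf n p) real - degree_center \<rho> n) \<in> O(\<lambda>_. 1)"
    by (rule bigoI)
  also have "(\<lambda>_. 1) \<in> o(\<lambda>n. sqrt (ln (real n)))" by real_asymp
  finally have small: "(\<lambda>n. measure_pmf.expectation (degree_pmf n p) real - degree_center \<rho> n) \<in> o(\<lambda>n. sqrt (ln (real n)))" .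
  have center: "degree_center \<rho> \<in> \<Theta>(\<lambda>n. sqrt (ln (real n)))"
    unfolding degree_center_def using rr(3) by real_asymp
  have "(\<lambda>n. measure_pmf.expectation (degree_pmf n p) real - degree_center \<rho> n) \<in> o(degree_center \<rho>)"
    using small center by (simp add: landau_o.small.cong_bigtheta[OF center])
  then have "(\<lambda>n. degree_center \<rho> n + (measure_pmf.expectation (degree_pmf n p) real - degree_center \<rho> n)) \<in> \<Theta>(degree_center \<rho>)"
    by (subst bigtheta_sym) (simp only: landau_theta.plus_absorb2 bigtheta_refl)
  then show ?thesis using center by (simp add: landau_theta.trans[OF _ center])
qed

text \<open>Quotients of neighbouring probabilities converge by the asymptotics of the weight ratio,
  hence so do the probabilities relative to the one at 0. The decay bound permits dominated
  convergence on every set, and dividing by the total mass eliminates the unknown probability at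
  0.\<close>

lemma discrete_gaussian_limit:
  fixes s :: "nat \<Rightarrow> nat"
  assumes s: "filterlim s at_top sequentially"
    and a: "(\<lambda>k. degree_center \<rho> (s k) - real_of_int \<lfloor>degree_center \<rho> (s k)\<rfloor>) \<longlonglongrightarrow> a"
  shows "int_conv_in_distr (\<lambda>k. map_pmf (\<lambda>d. int d - \<lfloor>degree_center \<rho> (s k)\<rfloor>) (degree_pmf (s k) p))
    (discrete_gaussian r a)"
proof -
  note rr = subcritical
  define h where "h = (\<lambda>k. degree_center \<rho> (s k))"
  define Q where "Q = (\<lambda>k. map_pmf (\<lambda>d. int d - \<lfloor>h k\<rfloor>) (degree_pmf (s k) p))"
  define v where "v = (\<lambda>j::int. exp (- \<rho> * ((real_of_int j - a)\<^sup>2 / 2)))"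
  have h_lim: "filterlim h at_top sequentially"
    unfolding h_def using filterlim_degree_center[OF rr(3)] s by (rule filterlim_compose)
  have a': "(\<lambda>k. h k - real_of_int \<lfloor>h k\<rfloor>) \<longlonglongrightarrow> a"
    using a by (simp add: h_def)
  have h_large: "eventually (\<lambda>k. h k \<ge> c) sequentially" for c
    using h_lim by (simp add: filterlim_at_top)
  have hs_lim: "(\<lambda>k. h k / real (s k)) \<longlonglongrightarrow> 0"
    unfolding h_def using degree_center_sublinear[OF rr(3)] s by (rule filterlim_compose)
  have Q: "pmf (Q k) (int d - \<lfloor>h k\<rfloor>) = pmf (degree_pmf (s k) p) d" for k d
    unfolding Q_def by (rule pmf_map_inj') (auto simp: inj_on_def)
  have Q_nat: "pmf (Q k) j = pmf (degree_pmf (s k) p) (nat (j + \<lfloor>h k\<rfloor>))" if "j + \<lfloor>h k\<rfloor> \<ge> 0" for k j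
    using Q[of k "nat (j + \<lfloor>h k\<rfloor>)"] that by simp
  have Q_zero: "pmf (Q k) j = 0" if "j + \<lfloor>h k\<rfloor> < 0" for k j
    using that by (auto simp: Q_def set_pmf_iff[symmetric] intro!: pmf_eq_0_set_pmf[THEN iffD2])
  have hj_ratio: "(\<lambda>k. (real_of_int (j + \<lfloor>h k\<rfloor>)) / h k) \<longlonglongrightarrow> 1" for j
  proof -
    have "(\<lambda>k. 1 + (real_of_int j - (h k - real_of_int \<lfloor>h k\<rfloor>)) / h k) \<longlonglongrightarrow> 1 + 0"
      by (intro tendsto_add tendsto_const real_tendsto_divide_at_top[OF _ h_lim, of _ "real_of_int j - a"]
            tendsto_diff a')
    moreover have "eventually (\<lambda>k. 1 + (real_of_int j - (h k - real_of_int \<lfloor>h k\<rfloor>)) / h k = real_of_int (j + \<lfloor>h k\<rfloor>) / h k) sequentially"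
      using h_large[of 1] by eventually_elim (simp add: field_simps)
    ultimately have "(\<lambda>k. real_of_int (j + \<lfloor>h k\<rfloor>) / h k) \<longlonglongrightarrow> 1 + 0"
      by (rule Lim_transform_eventually)
    then show ?thesis by simp
  qed
  have small: "(\<lambda>k. real_of_int (j + \<lfloor>h k\<rfloor>) / real (s k)) \<longlonglongrightarrow> 0" for j
  proof -
    have "(\<lambda>k. real_of_int (j + \<lfloor>h k\<rfloor>) / h k * (h k / real (s k))) \<longlonglongrightarrow> 1 * 0"
      by (intro tendsto_mult hj_ratio hs_lim)
    moreover have "eventually (\<lambda>k. real_of_int (j + \<lfloor>h k\<rfloor>) / h k * (h k / real (s k)) = real_of_int (j + \<lfloor>h k\<rfloor>) / real (s k)) sequentially"
      using h_large[of 1] by eventually_elim simp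
    ultimately have "(\<lambda>k. real_of_int (j + \<lfloor>h k\<rfloor>) / real (s k)) \<longlonglongrightarrow> 1 * 0"
      by (rule Lim_transform_eventually)
    then show ?thesis by simp
  qed
  have in_range: "eventually (\<lambda>k. 0 \<le> j + \<lfloor>h k\<rfloor> \<and> j + \<lfloor>h k\<rfloor> < int (s k)) sequentially" for j
    using order_tendstoD(2)[OF small[of j], of 1, OF zero_less_one] h_large[of "1 - real_of_int j"]
      eventually_compose_filterlim[OF eventually_gt_at_top[of 0] s]
  proof eventually_elim
    case (elim k)
    then have "real_of_int (j + \<lfloor>h k\<rfloor>) < real (s k)" by (simp add: field_simps)
    then show ?case using elim(2) by linarith
  qed
  have Q_pos: "eventually (\<lambda>k. pmf (Q k) j > 0) sequentially" for j
    using in_range[of j] by eventually_elim (auto simp: Q_nat intro!: pmf_degree_pos)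
  have ratio: "(\<lambda>k. pmf (Q k) (j + 1) / pmf (Q k) j) \<longlonglongrightarrow> exp (- \<rho> * (real_of_int j + 1 / 2 - a))" for j
  proof -
    define W where "W = (\<lambda>k. ln (weight_ratio r (s k)) - \<rho> * (h k + 1 / 2) - ln (h k))"
    \<comment> \<open>The index shift in \<open>R\<close> is o(s k), so slow variation squeezes
      \<open>R\<close> to 1.\<close>
    define R where "R = (\<lambda>k. weight_ratio r (s k - nat (j + 1 + \<lfloor>h k\<rfloor>)) / weight_ratio r (s k))"
    have W: "W \<longlonglongrightarrow> 0"
      unfolding W_def h_def using tendsto_ln_weight_ratio s by (rule filterlim_compose)
    have R: "R \<longlonglongrightarrow> 1"
    proof (rule tendsto_sandwich)
      show "eventually (\<lambda>k. 1 - real_of_int (j + 1 + \<lfloor>h k\<rfloor>) / real (s k) \<le> R k) sequentially"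
        using in_range[of "j + 1"]
      proof eventually_elim
        case (elim k)
        then have "(1 - real (nat (j + 1 + \<lfloor>h k\<rfloor>)) / real (s k)) * weight_ratio r (s k) \<le> weight_ratio r (s k - nat (j + 1 + \<lfloor>h k\<rfloor>))"
          using rr by (intro weight_ratio_diff_ge) auto
        moreover have "weight_ratio r (s k) > 0" using rr elim by (intro weight_ratio_pos) auto
        ultimately show ?case using elim by (simp add: R_def pos_le_divide_eq)
      qed
      show "eventually (\<lambda>k. R k \<le> 1) sequentially"
        using in_range[of "j + 1"]
      proof eventually_elim
        case (elim k)
        have "weight_ratio r (s k - nat (j + 1 + \<lfloor>h k\<rfloor>)) \<le> weight_ratio r (s k)"
          using rr by (intro incseqD[OF incseq_weight_ratio]) auto
        moreover have "weight_ratio r (s k) > 0" using rr elim by (intro weight_ratio_pos) auto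
        ultimately show ?case by (simp add: R_def)
      qed
      show "(\<lambda>k. 1 - real_of_int (j + 1 + \<lfloor>h k\<rfloor>) / real (s k)) \<longlonglongrightarrow> 1"
        using tendsto_diff[OF tendsto_const small[of "j + 1"], of 1] by simp
    qed auto
    have "(\<lambda>k. R k * inverse (real_of_int (j + 1 + \<lfloor>h k\<rfloor>) / h k) * exp (W k + \<rho> * ((h k - real_of_int \<lfloor>h k\<rfloor>) - real_of_int j - 1 / 2))) \<longlonglongrightarrow>
        1 * inverse 1 * exp (0 + \<rho> * (a - real_of_int j - 1 / 2))"
      using a' by (intro tendsto_mult tendsto_inverse tendsto_exp tendsto_add tendsto_diff tendsto_const R W hj_ratio) auto
    moreover have "eventually (\<lambda>k. R k * inverse (real_of_int (j + 1 + \<lfloor>h k\<rfloor>) / h k) * exp (W k + \<rho> * ((h k - real_of_int \<lfloor>h k\<rfloor>) - real_of_int j - 1 / 2)) =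
        pmf (Q k) (j + 1) / pmf (Q k) j) sequentially"
      using in_range[of "j + 1"] in_range[of j] Q_pos[of j] h_large[of 1]
    proof eventually_elim
      case (elim k)
      define d where "d = nat (j + \<lfloor>h k\<rfloor>)"
      have d: "nat (j + 1 + \<lfloor>h k\<rfloor>) = Suc d" "real_of_int (j + 1 + \<lfloor>h k\<rfloor>) = real (Suc d)"
        "real_of_int \<lfloor>h k\<rfloor> = real (Suc d) - 1 - real_of_int j"
        using elim by (auto simp: d_def)
      have wr: "weight_ratio r (s k) > 0" using rr elim by (intro weight_ratio_pos) auto
      have "W k + \<rho> * ((h k - real_of_int \<lfloor>h k\<rfloor>) - real_of_int j - 1 / 2) =
          ln (weight_ratio r (s k)) - ln (h k) + real (Suc d) * ln r"
        unfolding W_def d(3) rr(4) by (simp add: algebra_simps)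
      then have eq1: "exp (W k + \<rho> * ((h k - real_of_int \<lfloor>h k\<rfloor>) - real_of_int j - 1 / 2)) =
          weight_ratio r (s k) / h k * r ^ Suc d"
        using wr elim rr(1) by (simp only: exp_add exp_diff exp_of_nat_mult exp_ln)
      have eq2: "pmf (Q k) (j + 1) / pmf (Q k) j = r ^ Suc d / real (Suc d) * weight_ratio r (s k - Suc d)"
      proof -
        have "pmf (Q k) (j + 1) = pmf (degree_pmf (s k) p) (Suc d)" using elim d(1) by (subst Q_nat) auto
        moreover have "pmf (Q k) j = pmf (degree_pmf (s k) p) d" using elim by (subst Q_nat) (auto simp: d_def)
        moreover have "s k > 0" using elim by auto
        ultimately show ?thesis using elim(3) by (simp add: pmf_degree_Suc del: power_Suc of_nat_Suc)
      qed
      show ?case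
        unfolding eq1 eq2 R_def d(1,2) using elim(4) wr by (simp add: field_simps del: power_Suc of_nat_Suc)
    qed
    ultimately have "(\<lambda>k. pmf (Q k) (j + 1) / pmf (Q k) j) \<longlonglongrightarrow> 1 * inverse 1 * exp (0 + \<rho> * (a - real_of_int j - 1 / 2))"
      by (rule Lim_transform_eventually)
    then show ?thesis by (simp add: algebra_simps)
  qed
  have v_Suc: "v (j + 1) = v j * exp (- \<rho> * (real_of_int j + 1 / 2 - a))" for j
    unfolding v_def exp_add[symmetric] by (simp add: power2_eq_square field_simps)
  define V where "V = (\<lambda>k j. pmf (Q k) j / pmf (Q k) 0)"
  have V_lim: "(\<lambda>k. V k j) \<longlonglongrightarrow> v j / v 0" for j
  proof (induction j rule: int_induct[where k = 0])
    case base
    have "eventually (\<lambda>k. V k 0 = 1) sequentially"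
      using Q_pos[of 0] by eventually_elim (simp add: V_def)
    then have "(\<lambda>k. V k 0) \<longlonglongrightarrow> 1" by (rule tendsto_eventually)
    then show ?case by (simp add: v_def)
  next
    case (step1 j)
    have "(\<lambda>k. V k j * (pmf (Q k) (j + 1) / pmf (Q k) j)) \<longlonglongrightarrow> v j / v 0 * exp (- \<rho> * (real_of_int j + 1 / 2 - a))"
      by (intro tendsto_mult step1 ratio)
    moreover have "eventually (\<lambda>k. V k j * (pmf (Q k) (j + 1) / pmf (Q k) j) = V k (j + 1)) sequentially"
      using Q_pos[of j] by eventually_elim (simp add: V_def)
    ultimately have "(\<lambda>k. V k (j + 1)) \<longlonglongrightarrow> v j / v 0 * exp (- \<rho> * (real_of_int j + 1 / 2 - a))"
      by (rule Lim_transform_eventually)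
    then show ?case by (simp only: v_Suc times_divide_eq_left)
  next
    case (step2 j)
    have "(\<lambda>k. V k j / (pmf (Q k) (j - 1 + 1) / pmf (Q k) (j - 1))) \<longlonglongrightarrow> v j / v 0 / exp (- \<rho> * (real_of_int (j - 1) + 1 / 2 - a))"
      by (intro tendsto_divide step2 ratio) auto
    moreover have "eventually (\<lambda>k. V k j / (pmf (Q k) (j - 1 + 1) / pmf (Q k) (j - 1)) = V k (j - 1)) sequentially"
      using Q_pos[of j] Q_pos[of "j - 1"] by eventually_elim (simp add: V_def)
    ultimately have "(\<lambda>k. V k (j - 1)) \<longlonglongrightarrow> v j / v 0 / exp (- \<rho> * (real_of_int (j - 1) + 1 / 2 - a))"
      by (rule Lim_transform_eventually)
    moreover have "v j / v 0 / exp (- \<rho> * (real_of_int (j - 1) + 1 / 2 - a)) = v (j - 1) / v 0"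
      using v_Suc[of "j - 1"] by simp
    ultimately show ?case by (simp only:)
  qed
  obtain C where C: "C > 0" "eventually (\<lambda>n. \<forall>d. pmf (degree_pmf n p) d \<le>
       pmf (degree_pmf n p) (mode_degree n) * (C * (1 / 2) ^ nat \<bar>int d - int (mode_degree n)\<bar>)) sequentially"
    using eventually_pmf_degree_decay by blast
  have V_bound: "eventually (\<lambda>k. \<forall>j. \<bar>V k j\<bar> \<le> C * (1 / 2) ^ nat \<bar>j\<bar>) sequentially"
    using filterlim_iff[THEN iffD1, OF s, rule_format, OF C(2)] h_large[of 1] Q_pos[of 0]
  proof eventually_elim
    case (elim k)
    have mode: "int (mode_degree (s k)) = \<lfloor>h k\<rfloor>" using elim(2) by (simp add: mode_degree_def h_def)
    then have mode': "mode_degree (s k) = nat \<lfloor>h k\<rfloor>" by linarith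
    show ?case
    proof
      fix j
      show "\<bar>V k j\<bar> \<le> C * (1 / 2) ^ nat \<bar>j\<bar>"
      proof (cases "j + \<lfloor>h k\<rfloor> \<ge> 0")
        case True
        then have "pmf (Q k) j \<le> pmf (Q k) 0 * (C * (1 / 2) ^ nat \<bar>j\<bar>)"
          using elim(1)[rule_format, of "nat (j + \<lfloor>h k\<rfloor>)"] elim(2) mode' mode by (simp add: Q_nat)
        then show ?thesis using elim(3) by (simp add: V_def field_simps)
      next
        case False
        then show ?thesis using C(1) by (simp add: V_def Q_zero)
      qed
    qed
  qed
  then obtain k0 where k0: "\<And>k j. k \<ge> k0 \<Longrightarrow> \<bar>V k j\<bar> \<le> C * (1 / 2) ^ nat \<bar>j\<bar>"
    by (auto simp: eventually_sequentially)
  have "(\<lambda>j::int. C * (1 / 2 :: real) ^ nat \<bar>j\<bar>) summable_on UNIV"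
    by (intro summable_on_cmult_right summable_on_power_nat_abs) auto
  then have "Infinite_Set_Sum.abs_summable_on (\<lambda>j::int. C * (1 / 2 :: real) ^ nat \<bar>j\<bar>) UNIV"
    using C(1) by (subst abs_summable_equivalent[symmetric]) simp
  then have bound_int: "integrable (count_space A) (\<lambda>j::int. C * (1 / 2 :: real) ^ nat \<bar>j\<bar>)" for A
    unfolding abs_summable_on_def[symmetric] by (rule abs_summable_on_subset) auto
  have infsetsum_lim: "(\<lambda>k. infsetsum (V k) A) \<longlonglongrightarrow> infsetsum (\<lambda>j. v j / v 0) A" for A
  proof (rule LIMSEQ_offset[where k = k0])
    show "(\<lambda>k. infsetsum (V (k + k0)) A) \<longlonglongrightarrow> infsetsum (\<lambda>j. v j / v 0) A"
      unfolding infsetsum_def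
    proof (rule integral_dominated_convergence[OF _ _ bound_int[of A]])
      show "AE j in count_space A. (\<lambda>k. V (k + k0) j) \<longlonglongrightarrow> v j / v 0"
        using V_lim LIMSEQ_ignore_initial_segment by (intro AE_I2) blast
      show "AE j in count_space A. norm (V (k + k0) j) \<le> C * (1 / 2) ^ nat \<bar>j\<bar>" for k
        using k0[of "k + k0"] by (intro AE_I2) auto
    qed auto
  qed
  define Z where "Z = (\<Sum>\<^sub>\<infinity>d'::int. r powr ((real_of_int d' - a)\<^sup>2 / 2))"
  have dg: "pmf (discrete_gaussian r a) j = v j / v 0 * (v 0 / Z)" for j
    using pmf_discrete_gaussian[OF rr(1,2), of a j] rr by (simp add: Z_def v_def powr_def mult.commute)
  have prob_dg: "measure_pmf.prob (discrete_gaussian r a) A = infsetsum (\<lambda>j. v j / v 0) A * (v 0 / Z)" for A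
    unfolding measure_pmf_conv_infsetsum dg unfolding infsetsum_def by (rule integral_mult_left_zero)
  have prob_Q: "measure_pmf.prob (Q k) A = infsetsum (V k) A * pmf (Q k) 0" if "pmf (Q k) 0 > 0" for k A
  proof -
    have "measure_pmf.prob (Q k) A = infsetsum (\<lambda>j. V k j * pmf (Q k) 0) A"
      unfolding measure_pmf_conv_infsetsum using that by (intro infsetsum_cong) (auto simp: V_def)
    then show ?thesis by (simp add: infsetsum_def)
  qed
  \<comment> \<open>Neither normaliser is computed: total mass 1 determines \<open>v 0 / Z\<close>
    here and \<open>pmf (Q k) 0\<close> below.\<close>
  have total: "infsetsum (\<lambda>j. v j / v 0) UNIV * (v 0 / Z) = 1"
    unfolding prob_dg[symmetric] by simp
  then have total': "infsetsum (\<lambda>j. v j / v 0) UNIV \<noteq> 0"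
    by (metis mult_zero_left zero_neq_one)
  with total have v0Z: "v 0 / Z = 1 / infsetsum (\<lambda>j. v j / v 0) UNIV"
    by (metis nonzero_eq_divide_eq mult.commute)
  have lim: "(\<lambda>k. measure_pmf.prob (Q k) A) \<longlonglongrightarrow> measure_pmf.prob (discrete_gaussian r a) A" for A
  proof -
    have "(\<lambda>k. infsetsum (V k) A / infsetsum (V k) UNIV) \<longlonglongrightarrow> infsetsum (\<lambda>j. v j / v 0) A / infsetsum (\<lambda>j. v j / v 0) UNIV"
      using total' by (intro tendsto_divide infsetsum_lim)
    also have "infsetsum (\<lambda>j. v j / v 0) A / infsetsum (\<lambda>j. v j / v 0) UNIV = measure_pmf.prob (discrete_gaussian r a) A"
      unfolding prob_dg v0Z by simp
    finally show ?thesis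
    proof (rule Lim_transform_eventually)
      show "eventually (\<lambda>k. infsetsum (V k) A / infsetsum (V k) UNIV = measure_pmf.prob (Q k) A) sequentially"
        using Q_pos[of 0]
      proof eventually_elim
        case (elim k)
        then have "infsetsum (V k) UNIV * pmf (Q k) 0 = 1"
          by (simp only: prob_Q[symmetric]) simp
        then show ?case
          using prob_Q[OF elim, of A] by (cases "infsetsum (V k) UNIV = 0") (auto simp: divide_eq_eq mult_ac)
      qed
    qed
  qed
  show ?thesis
    \<comment> \<open>Convergence on every set includes preimages of half-lines, so the distribution
      functions converge at every point.\<close>
    unfolding int_conv_in_distr_def weak_conv_m_def weak_conv_def cdf_def2
    using lim by (simp add: measure_distr Q_def h_def)
qed

end

theorem theorem1p3:
  fixes p :: real
  assumes "0 < p" and "p < 1"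
  shows
    "(p > 1 / 2 \<longrightarrow> (\<lambda>n. measure_pmf.prob (degree_pmf n p) {n - 1}) \<longlonglongrightarrow> 1)
   \<and> (p = 1 / 2 \<longrightarrow>
        (\<forall>\<mu> :: nat \<Rightarrow> real.
           (\<lambda>n. \<mu> n - (ln (real n) - ln (ln (real n)))) \<in> o(\<lambda>_. 1) \<longrightarrow>
             (\<forall>z :: complex.
                (\<lambda>n. measure_pmf.expectation (degree_pmf n p) (\<lambda>d. z ^ d))
                  \<sim>[at_top] (\<lambda>n. measure_pmf.expectation (poisson_pmf (\<mu> n)) (\<lambda>d. z ^ d)))
           \<and> (\<lambda>n. tv_dist (degree_pmf n p) (poisson_pmf (\<mu> n))) \<longlonglongrightarrow> 0))
   \<and> (p < 1 / 2 \<longrightarrow>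
        (\<lambda>n. measure_pmf.expectation (degree_pmf n p) real) \<in> \<Theta>(\<lambda>n. sqrt (ln (real n)))
      \<and> (\<forall>a :: real. 0 \<le> a \<and> a < 1 \<longrightarrow>
           (\<exists>r :: nat \<Rightarrow> nat. strict_mono r \<and>
              int_conv_in_distr
                (\<lambda>k. map_pmf
                   (\<lambda>d. int d - \<lfloor>sqrt (2 * ln (real (r k)) / (ln (1 - p) - ln p))
                                    - 1 - 1 / (ln (1 - p) - ln p)\<rfloor>)
                   (degree_pmf (r k) p))
                (discrete_gaussian (p / (1 - p)) a))))"
proof (intro conjI impI allI)
  assume "p > 1 / 2"
  then show "(\<lambda>n. measure_pmf.prob (degree_pmf n p) {n - 1}) \<longlonglongrightarrow> 1"
    using assms by (intro tendsto_prob_complete_graph)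
next
  fix \<mu> :: "nat \<Rightarrow> real" and z :: complex
  assume p: "p = 1 / 2" and \<mu>: "(\<lambda>n. \<mu> n - (ln (real n) - ln (ln (real n)))) \<in> o(\<lambda>_. 1)"
  show "(\<lambda>n. measure_pmf.expectation (degree_pmf n p) (\<lambda>d. z ^ d))
      \<sim>[at_top] (\<lambda>n. measure_pmf.expectation (poisson_pmf (\<mu> n)) (\<lambda>d. z ^ d))"
    unfolding p using \<mu> by (rule expectation_degree_asymp_equiv_poisson)
next
  fix \<mu> :: "nat \<Rightarrow> real"
  assume p: "p = 1 / 2" and \<mu>: "(\<lambda>n. \<mu> n - (ln (real n) - ln (ln (real n)))) \<in> o(\<lambda>_. 1)"
  show "(\<lambda>n. tv_dist (degree_pmf n p) (poisson_pmf (\<mu> n))) \<longlonglongrightarrow> 0"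
    unfolding p using \<mu> by (rule tendsto_tv_dist_degree_poisson)
next
  assume "p < 1 / 2"
  then show "(\<lambda>n. measure_pmf.expectation (degree_pmf n p) real) \<in> \<Theta>(\<lambda>n. sqrt (ln (real n)))"
    using assms by (intro expectation_degree_bigtheta)
next
  fix a :: real
  assume p: "p < 1 / 2" and a: "0 \<le> a \<and> a < 1"
  define \<rho> where "\<rho> = ln (1 - p) - ln p"
  have "\<rho> > 0" using assms p by (simp add: \<rho>_def)
  then obtain s :: "nat \<Rightarrow> nat" where s: "strict_mono s"
    "(\<lambda>k. degree_center \<rho> (s k) - real_of_int \<lfloor>degree_center \<rho> (s k)\<rfloor>) \<longlonglongrightarrow> a"
    using exists_degree_center_subsequence[of \<rho> a] a by blast
  have "int_conv_in_distr (\<lambda>k. map_pmf (\<lambda>d. int d - \<lfloor>degree_center \<rho> (s k)\<rfloor>) (degree_pmf (s k) p))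
      (discrete_gaussian (p / (1 - p)) a)"
    unfolding \<rho>_def using assms(1) p filterlim_subseq[OF s(1)] s(2)[unfolded \<rho>_def]
    by (rule discrete_gaussian_limit)
  then show "\<exists>r :: nat \<Rightarrow> nat. strict_mono r \<and>
      int_conv_in_distr
        (\<lambda>k. map_pmf
           (\<lambda>d. int d - \<lfloor>sqrt (2 * ln (real (r k)) / (ln (1 - p) - ln p))
                            - 1 - 1 / (ln (1 - p) - ln p)\<rfloor>)
           (degree_pmf (r k) p))
        (discrete_gaussian (p / (1 - p)) a)"
    using s(1) unfolding degree_center_def \<rho>_def by blast
qed

end
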